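(* Let $G$ be a compact Lie group and $n\ge 1$. Then there is a homotopy equivalence \[ \Sigma\,\mathrm{Rep}(\mathbb{Z}^{n},G)\simeq \bigvee_{1\le r\le n}\Sigma\Big(\bigvee^{\binom{n}{r}}\mathrm{Rep}(\mathbb{Z}^{r},G)/\bar{S}^{1}_{r}(G)\Big). \]
   Context: $\mathrm{Hom}(\mathbb{Z}^{n},G)$ is identified with the subspace of $G^n$ of commuting $n$-tuples; $G$ acts on it by conjugation and $\mathrm{Rep}(\mathbb{Z}^{n},G)=\mathrm{Hom}(\mathbb{Z}^{n},G)/G$ is the orbit space. $\bar S^1_r(G)\subset \mathrm{Rep}(\mathbb{Z}^r,G)$ is the image of the subspace of commuting $r$-tuples with at least one entry equal to $1_G$. $\Sigma$ denotes suspension (basepoint the class of $(1_G,\dots,1_G)$) and $\bigvee^{k}X$ the wedge of $k$ copies of $X$. *)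

theory Defs
  imports "HOL-Analysis.Analysis" "HOL-Algebra.Group_Action"
begin

section \<open>Smooth manifolds and Lie groups\<close>

text \<open>
  The model space of dimension \<open>d\<close> is the library's \<open>Euclidean_space d\<close>: functions
  \<open>nat \<Rightarrow> real\<close> vanishing at all indices \<open>\<ge> d\<close>. This makes the dimension a number rather than
  a type and includes dimension 0, so finite groups are compact Lie groups.
\<close>

text \<open>
  \<open>C_k k d S f\<close>: the function \<open>f\<close> is \<open>k\<close> times continuously differentiable on \<open>S\<close>, expressed
  by iterated partial derivatives; \<open>g i\<close> is the \<open>i\<close>-th partial derivative. It is only
  meaningful for \<open>S\<close> open in \<open>Euclidean_space d\<close>, and is only used for such \<open>S\<close>.
\<close>

primrec C_k :: "nat \<Rightarrow> nat \<Rightarrow> (nat \<Rightarrow> real) set \<Rightarrow> ((nat \<Rightarrow> real) \<Rightarrow> real) \<Rightarrow> bool" where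
  "C_k 0 d S f \<longleftrightarrow> continuous_map (subtopology (Euclidean_space d) S) euclideanreal f"
| "C_k (Suc k) d S f \<longleftrightarrow>
     continuous_map (subtopology (Euclidean_space d) S) euclideanreal f \<and>
     (\<exists>g. \<forall>i<d. C_k k d S (g i) \<and>
        (\<forall>x\<in>S. ((\<lambda>t. f (x(i := t))) has_real_derivative g i x) (at (x i))))"

definition smooth_on :: "nat \<Rightarrow> (nat \<Rightarrow> real) set \<Rightarrow> ((nat \<Rightarrow> real) \<Rightarrow> real) \<Rightarrow> bool" where
  "smooth_on d S f \<longleftrightarrow> (\<forall>k. C_k k d S f)"

type_synonym 'a chart = "'a set \<times> ('a \<Rightarrow> nat \<Rightarrow> real)"

definition is_chart :: "'a topology \<Rightarrow> nat \<Rightarrow> 'a chart \<Rightarrow> bool" where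
  "is_chart X d = (\<lambda>(U, \<phi>).
     openin X U \<and> openin (Euclidean_space d) (\<phi> ` U) \<and>
     homeomorphic_map (subtopology X U) (subtopology (Euclidean_space d) (\<phi> ` U)) \<phi>)"

definition smooth_atlas :: "'a topology \<Rightarrow> nat \<Rightarrow> 'a chart set \<Rightarrow> bool" where
  "smooth_atlas X d A \<longleftrightarrow>
     (\<forall>c\<in>A. is_chart X d c) \<and> \<Union> (fst ` A) = topspace X \<and>
     (\<forall>(U, \<phi>)\<in>A. \<forall>(V, \<psi>)\<in>A. \<forall>j<d.
        smooth_on d (\<phi> ` (U \<inter> V)) (\<lambda>z. \<psi> (inv_into U \<phi> z) j))"

definition smooth_map ::
  "'a topology \<Rightarrow> nat \<Rightarrow> 'a chart set \<Rightarrow> 'b topology \<Rightarrow> nat \<Rightarrow> 'b chart set \<Rightarrow> ('a \<Rightarrow> 'b) \<Rightarrow> bool" where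
  "smooth_map X d A Y e B f \<longleftrightarrow>
     continuous_map X Y f \<and>
     (\<forall>(U, \<phi>)\<in>A. \<forall>(V, \<psi>)\<in>B. \<forall>j<e.
        smooth_on d (\<phi> ` (U \<inter> f -` V)) (\<lambda>z. \<psi> (f (inv_into U \<phi> z)) j))"

text \<open>
  The atlas of product charts on a product manifold, of dimension \<open>d + e\<close>. Only the dimension
  \<open>d\<close> of the first factor is needed, since the coordinates of the second are shifted by \<open>d\<close>.
\<close>

definition prod_atlas :: "nat \<Rightarrow> 'a chart set \<Rightarrow> 'b chart set \<Rightarrow> ('a \<times> 'b) chart set" where
  "prod_atlas d A B =
     {(U \<times> V, \<lambda>(x, y) i. if i < d then \<phi> x i else \<psi> y (i - d)) | U \<phi> V \<psi>. (U, \<phi>) \<in> A \<and> (V, \<psi>) \<in> B}"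

locale lie_group = group G for G (structure) +
  fixes T :: "'a topology" and d :: nat and A :: "'a chart set"
  assumes topspace_eq: "topspace T = carrier G"
    and Hausdorff: "Hausdorff_space T"
    and second_countable: "second_countable T"
    and atlas: "smooth_atlas T d A"
    and smooth_mult:
      "smooth_map (prod_topology T T) (d + d) (prod_atlas d A A) T d A (\<lambda>(x, y). x \<otimes> y)"
    and smooth_inv: "smooth_map T d A T d A (\<lambda>x. inv x)"

locale compact_lie_group = lie_group +
  assumes compact: "compact_space T"

section \<open>Quotients, wedges and reduced suspensions\<close>

definition quotient_topology :: "'a topology \<Rightarrow> ('a \<Rightarrow> 'b) \<Rightarrow> 'b topology" where
  "quotient_topology X q =
     topology (\<lambda>V. V \<subseteq> q ` topspace X \<and> openin X {x \<in> topspace X. q x \<in> V})"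

lemma istopology_quotient:
  "istopology (\<lambda>V. V \<subseteq> q ` topspace X \<and> openin X {x \<in> topspace X. q x \<in> V})"
proof -
  have 1: "{x \<in> topspace X. q x \<in> S \<inter> R} =
      {x \<in> topspace X. q x \<in> S} \<inter> {x \<in> topspace X. q x \<in> R}" for S R
    by auto
  have 2: "{x \<in> topspace X. q x \<in> \<Union>K} = (\<Union>S\<in>K. {x \<in> topspace X. q x \<in> S})" for K
    by auto
  show ?thesis
    unfolding istopology_def 1 2 by blast
qed

lemma openin_quotient_topology:
  "openin (quotient_topology X q) V \<longleftrightarrow>
     V \<subseteq> q ` topspace X \<and> openin X {x \<in> topspace X. q x \<in> V}"
  by (simp add: quotient_topology_def istopology_quotient)

lemma topspace_quotient_topology [simp]: "topspace (quotient_topology X q) = q ` topspace X"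
proof -
  have "{x \<in> topspace X. q x \<in> q ` topspace X} = topspace X"
    by auto
  then have "openin (quotient_topology X q) (q ` topspace X)"
    by (simp add: openin_quotient_topology)
  then show ?thesis
    by (meson openin_quotient_topology openin_subset openin_topspace subset_antisym)
qed

lemma quotient_map_quotient_topology: "quotient_map X (quotient_topology X q) q"
  by (simp add: quotient_map_def openin_quotient_topology)

text \<open>A pointed space is a topology together with its basepoint.\<close>

type_synonym 'a pointed = "'a topology \<times> 'a"

text \<open>
  The space \<open>X/A\<close>, for nonempty \<open>A \<subseteq> topspace X\<close>. Its points are the equivalence classes: the
  set \<open>A\<close>, which is the basepoint, and the singletons \<open>{x}\<close> with \<open>x \<notin> A\<close>.
\<close>

definition collapse :: "'a topology \<Rightarrow> 'a set \<Rightarrow> 'a set pointed" where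
  "collapse X A = (quotient_topology X (\<lambda>x. if x \<in> A then A else {x}), A)"

definition wedge :: "'i set \<Rightarrow> ('i \<Rightarrow> 'a pointed) \<Rightarrow> ('i \<times> 'a) set pointed" where
  "wedge I P = collapse (sum_topology (\<lambda>i. fst (P i)) I) ((\<lambda>i. (i, snd (P i))) ` I)"

definition suspension :: "'a pointed \<Rightarrow> ('a \<times> real) set pointed" where
  "suspension = (\<lambda>(X, p).
     collapse (prod_topology X (top_of_set {0..1}))
       (topspace X \<times> {0, 1} \<union> {p} \<times> {0..1}))"

section \<open>Spaces of commuting tuples and representation spaces\<close>

context
  fixes G :: "('a, 'b) monoid_scheme" (structure) and T :: "'a topology"
begin

text \<open>
  Tuples \<open>(x 0, \<dots>, x (n - 1))\<close> are extensional functions on \<open>{..<n}\<close>. A homomorphism from the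
  free abelian group of rank \<open>n\<close> is identified with the commuting tuple of the images of the
  standard generators.
\<close>

definition Hom_Z :: "nat \<Rightarrow> (nat \<Rightarrow> 'a) topology" where
  "Hom_Z n = subtopology (product_topology (\<lambda>_. T) {..<n})
     {x. \<forall>i<n. \<forall>j<n. x i \<otimes> x j = x j \<otimes> x i}"

definition conj_tuple :: "nat \<Rightarrow> 'a \<Rightarrow> (nat \<Rightarrow> 'a) \<Rightarrow> (nat \<Rightarrow> 'a)" where
  "conj_tuple n g x = (\<lambda>i\<in>{..<n}. g \<otimes> x i \<otimes> inv g)"

definition Rep_class :: "nat \<Rightarrow> (nat \<Rightarrow> 'a) \<Rightarrow> (nat \<Rightarrow> 'a) set" where
  "Rep_class n x = orbit G (conj_tuple n) x"

definition Rep_Z :: "nat \<Rightarrow> (nat \<Rightarrow> 'a) set topology" where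
  "Rep_Z n = quotient_topology (Hom_Z n) (Rep_class n)"

definition Rep_base :: "nat \<Rightarrow> (nat \<Rightarrow> 'a) set" where
  "Rep_base n = Rep_class n (\<lambda>i\<in>{..<n}. \<one>)"

definition S1_bar :: "nat \<Rightarrow> (nat \<Rightarrow> 'a) set set" where
  "S1_bar r = Rep_class r ` {x \<in> topspace (Hom_Z r). \<exists>i<r. x i = \<one>}"

end

end

theory Submission
  imports Defs "HOL-Homology.Invariance_of_Domain"
begin

text \<open>
  Pointed maps from a reduced suspension of a space to another space are loops: maps on the product
  of the space with the unit interval that are constant on the subset collapsed to the basepoint.
  Setting one coordinate to the unit gives commuting idempotents on the representation space. For
  one such idempotent \<open>e\<close>, each loop \<open>f\<close> is homotopic to the concatenation of \<open>f \<circ> e\<close> with a loop that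
  is trivial on the image of \<open>e\<close>, and the two parts are unique up to homotopy. Iterating over the
  coordinates identifies homotopy classes of loops on the representation space with families,
  indexed by the subsets \<open>I\<close> of \<open>{..<n}\<close>, of classes of loops on the quotients of the statement.
  The homotopy equivalence follows by a Yoneda argument, applied to loops in the two spaces at hand.

  The step for one idempotent needs a neighbourhood of the unit of \<open>G\<close> that contracts to the unit
  equivariantly under conjugation, and hence compatibly with commutation. No exponential map is
  used: in a chart, squaring expands distances near the unit, so that small elements have unique,
  and therefore equivariant, small square roots. Products of iterated roots of \<open>x\<close> are the dyadic
  powers of \<open>x\<close>, and these extend to a continuous family of real powers with exponents in \<open>{0..1}\<close>.
\<close>

section \<open>Maps out of quotients, wedges and suspensions\<close>

text \<open>The usual splitting of a suspension along a retract \<open>A\<close> of \<open>X\<close>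
  passes through \<open>X / A\<close> and a cofibration. Here the splitting itself never leaves
  \<open>X\<close>: a map on \<open>A\<close> is a map on \<open>X\<close> invariant under the
  retraction, and a map on \<open>X / A\<close> is one that is trivial on \<open>A\<close>. The
  obstacle is the second condition. On \<open>A\<close>, the inverse of \<open>f \<circ> e\<close>
  followed by \<open>f\<close> is only null-homotopic, not constant. Making it constant there,
  continuously on \<open>X\<close>, is what requires a neighbourhood of \<open>A\<close> that
  deforms into \<open>A\<close>, and the deformation has to commute with the remaining idempotents
  to allow iteration. For the real powers the balance of constants is this: squaring expands by at
  least 3/2, so a root contracts by 2/3, while left multiplication expands by at most 5/4. One step
  of the functional equation therefore scales errors by at most 5/6, and the iteration
  converges.\<close>

abbreviation II :: "real topology" where "II \<equiv> top_of_set {0..1}"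

lemma continuous_map_II:
  assumes "continuous_map X euclideanreal f" "\<And>x. x \<in> topspace X \<Longrightarrow> 0 \<le> f x \<and> f x \<le> 1"
  shows "continuous_map X II f"
  using assms by (auto simp: continuous_map_in_subtopology)

lemma continuous_map_comp:
  assumes "continuous_map Y Z h" "continuous_map X Y g"
  shows "continuous_map X Z (\<lambda>x. h (g x))"
  using continuous_map_compose [OF assms(2,1)] by (simp add: o_def)

lemma continuous_map_II_euclidean:
  "continuous_map X II f \<Longrightarrow> continuous_map X euclideanreal f"
  by (simp add: continuous_map_in_subtopology)

lemma continuous_map_projections:
  "continuous_map (prod_topology A B) A (\<lambda>y. fst y)"
  "continuous_map (prod_topology A B) B (\<lambda>y. snd y)"
  "continuous_map (prod_topology A (prod_topology B C)) B (\<lambda>y. fst (snd y))"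
  "continuous_map (prod_topology A (prod_topology B C)) C (\<lambda>y. snd (snd y))"
  "continuous_map (prod_topology (prod_topology A B) C) A (\<lambda>y. fst (fst y))"
  "continuous_map (prod_topology (prod_topology A B) C) B (\<lambda>y. snd (fst y))"
  using continuous_map_fst continuous_map_snd
    continuous_map_compose [OF continuous_map_snd continuous_map_fst]
    continuous_map_compose [OF continuous_map_snd continuous_map_snd]
    continuous_map_compose [OF continuous_map_fst continuous_map_fst]
    continuous_map_compose [OF continuous_map_fst continuous_map_snd]
  by (auto simp: o_def)

text \<open>The definition of \<open>homotopic_with\<close> fixes both ends at every element of the
  type. For a \<open>P\<close> that depends only on the values on \<open>topspace X\<close>, it is
  enough to check them there.\<close>

lemma homotopic_withI:
  assumes cong: "\<And>h k. (\<And>x. x \<in> topspace X \<Longrightarrow> h x = k x) \<Longrightarrow> P h = P k"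
    and "continuous_map (prod_topology II X) Y h"
    and "\<And>x. x \<in> topspace X \<Longrightarrow> h (0, x) = f x" "\<And>x. x \<in> topspace X \<Longrightarrow> h (1, x) = g x"
    and "\<And>s. s \<in> {0..1} \<Longrightarrow> P (\<lambda>x. h (s, x))"
  shows "homotopic_with P X Y f g"
  unfolding homotopic_with [of X P Y f g, OF cong, simplified]
  using assms(2-5) by auto

text \<open>The product with a locally compact Hausdorff space preserves quotient maps, so a
  homotopy descends to a quotient just as a single map does.\<close>

lemma quotient_map_lift_param:
  assumes q: "quotient_map A B q" and \<Theta>: "locally_compact_space \<Theta>" "Hausdorff_space \<Theta>"
    and h: "continuous_map (prod_topology \<Theta> A) Z h"
    and resp: "\<And>s x y. \<lbrakk>s \<in> topspace \<Theta>; x \<in> topspace A; y \<in> topspace A; q x = q y\<rbrakk> \<Longrightarrow> h (s, x) = h (s, y)"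
  obtains k where "continuous_map (prod_topology \<Theta> B) Z k"
    "\<And>s x. s \<in> topspace \<Theta> \<Longrightarrow> x \<in> topspace A \<Longrightarrow> k (s, q x) = h (s, x)"
proof -
  have Q: "quotient_map (prod_topology \<Theta> A) (prod_topology \<Theta> B) (\<lambda>(s, x). (s, q x))"
    by (rule quotient_map_prod_right [OF \<Theta>(1) _ q]) (use \<Theta> in auto)
  have R: "h z = h w" if "z \<in> topspace (prod_topology \<Theta> A)" "w \<in> topspace (prod_topology \<Theta> A)"
      "(\<lambda>(s, x). (s, q x)) z = (\<lambda>(s, x). (s, q x)) w" for z w
    using resp [of "fst z" "snd z" "snd w"] that by (cases z; cases w) simp
  obtain k where k: "continuous_map (prod_topology \<Theta> B) Z k"
    "\<And>z. z \<in> topspace (prod_topology \<Theta> A) \<Longrightarrow> k ((\<lambda>(s, x). (s, q x)) z) = h z"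
    by (rule quotient_map_lift_exists [OF Q h R]) (assumption, assumption, assumption, rule that)
  have "k (s, q x) = h (s, x)" if "s \<in> topspace \<Theta>" "x \<in> topspace A" for s x
    using k(2) [of "(s, x)"] that by simp
  with k(1) that show ?thesis by blast
qed

definition collapse_map :: "'x set \<Rightarrow> 'x \<Rightarrow> 'x set" where
  "collapse_map S x = (if x \<in> S then S else {x})"

lemma collapse_map_eq_iff: "collapse_map S x = collapse_map S y \<longleftrightarrow> x = y \<or> x \<in> S \<and> y \<in> S"
  by (auto simp: collapse_map_def)

lemma collapse_eq: "collapse X S = (quotient_topology X (collapse_map S), S)"
  unfolding collapse_def collapse_map_def ..

lemma quotient_map_collapse: "quotient_map X (fst (collapse X S)) (collapse_map S)"
  unfolding collapse_eq fst_conv by (rule quotient_map_quotient_topology)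

lemma snd_collapse [simp]: "snd (collapse X S) = S"
  by (simp add: collapse_eq)

lemma collapse_lift:
  assumes \<Theta>: "locally_compact_space \<Theta>" "Hausdorff_space \<Theta>"
    and h: "continuous_map (prod_topology \<Theta> X) Z h"
    and z: "\<And>s x. \<lbrakk>s \<in> topspace \<Theta>; x \<in> topspace X; x \<in> S\<rbrakk> \<Longrightarrow> h (s, x) = z"
  obtains k where "continuous_map (prod_topology \<Theta> (fst (collapse X S))) Z k"
    "\<And>s x. s \<in> topspace \<Theta> \<Longrightarrow> x \<in> topspace X \<Longrightarrow> k (s, collapse_map S x) = h (s, x)"
proof (rule quotient_map_lift_param [OF quotient_map_collapse [of X S] \<Theta> h])
  fix s x y assume "s \<in> topspace \<Theta>" "x \<in> topspace X" "y \<in> topspace X" "collapse_map S x = collapse_map S y"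
  then show "h (s, x) = h (s, y)" using z unfolding collapse_map_eq_iff by metis
qed (rule that, assumption+)

text \<open>Products distribute over disjoint sums: the injections of the summands are open, so a
  box over one summand is a box over the sum.\<close>

lemma continuous_map_sum_param:
  assumes h: "\<And>i. i \<in> I \<Longrightarrow> continuous_map (prod_topology \<Theta> (X i)) Z (h i)"
  shows "continuous_map (prod_topology \<Theta> (sum_topology X I)) Z (\<lambda>(s, i, x). h i (s, x))"
  unfolding continuous_map
proof (intro conjI allI impI)
  show "(\<lambda>(s, i, x). h i (s, x)) ` topspace (prod_topology \<Theta> (sum_topology X I)) \<subseteq> topspace Z"
    using h by (auto simp: continuous_map_def Pi_iff)
  fix U assume U: "openin Z U"
  let ?W = "{w \<in> topspace (prod_topology \<Theta> (sum_topology X I)). (\<lambda>(s, i, x). h i (s, x)) w \<in> U}"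
  show "openin (prod_topology \<Theta> (sum_topology X I)) ?W"
    unfolding openin_prod_topology_alt
  proof (intro allI impI)
    fix s j assume sj: "(s, j) \<in> ?W"
    obtain i x where j: "j = (i, x)" by (cases j)
    have i: "i \<in> I" and sx: "(s, x) \<in> {w \<in> topspace (prod_topology \<Theta> (X i)). h i w \<in> U}" using sj j by auto
    have "openin (prod_topology \<Theta> (X i)) {w \<in> topspace (prod_topology \<Theta> (X i)). h i w \<in> U}"
      by (rule openin_continuous_map_preimage [OF h [OF i] U])
    from this [unfolded openin_prod_topology_alt, rule_format, OF sx]
    obtain A B where AB: "openin \<Theta> A" "openin (X i) B" "s \<in> A" "x \<in> B"
      "A \<times> B \<subseteq> {w \<in> topspace (prod_topology \<Theta> (X i)). h i w \<in> U}" by blast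
    have "openin (sum_topology X I) (Pair i ` B)"
      using open_map_component_injection [OF i, of X] AB(2) unfolding open_map_def by blast
    moreover have "A \<times> Pair i ` B \<subseteq> ?W" using AB(5) i by auto
    ultimately show "\<exists>A B. openin \<Theta> A \<and> openin (sum_topology X I) B \<and> s \<in> A \<and> j \<in> B \<and> A \<times> B \<subseteq> ?W"
      using AB j by blast
  qed
qed

definition wedge_in :: "'i set \<Rightarrow> ('i \<Rightarrow> 'x pointed) \<Rightarrow> 'i \<Rightarrow> 'x \<Rightarrow> ('i \<times> 'x) set" where
  "wedge_in I P i x = collapse_map ((\<lambda>i. (i, snd (P i))) ` I) (i, x)"

definition suspension_in :: "'x pointed \<Rightarrow> 'x \<times> real \<Rightarrow> ('x \<times> real) set" where
  "suspension_in P = collapse_map (topspace (fst P) \<times> {0, 1} \<union> {snd P} \<times> {0..1})"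

lemma continuous_map_wedge_in:
  "i \<in> I \<Longrightarrow> continuous_map (fst (P i)) (fst (wedge I P)) (wedge_in I P i)"
  unfolding wedge_in_def [abs_def] wedge_def
  by (rule continuous_map_comp [OF quotient_imp_continuous_map [OF quotient_map_collapse]])
    (rule continuous_map_component_injection)

lemma wedge_in_base: "i \<in> I \<Longrightarrow> wedge_in I P i (snd (P i)) = snd (wedge I P)"
  by (simp add: wedge_in_def wedge_def collapse_map_def)

lemma topspace_wedge: "topspace (fst (wedge I P)) = (\<Union>i\<in>I. wedge_in I P i ` topspace (fst (P i)))"
  unfolding wedge_def collapse_eq by (auto simp: wedge_in_def)

lemma wedge_lift:
  assumes \<Theta>: "locally_compact_space \<Theta>" "Hausdorff_space \<Theta>"
    and h: "\<And>i. i \<in> I \<Longrightarrow> continuous_map (prod_topology \<Theta> (fst (P i))) Z (h i)"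
    and z: "\<And>s i. \<lbrakk>s \<in> topspace \<Theta>; i \<in> I\<rbrakk> \<Longrightarrow> h i (s, snd (P i)) = z"
  obtains k where "continuous_map (prod_topology \<Theta> (fst (wedge I P))) Z k"
    "\<And>s i x. \<lbrakk>s \<in> topspace \<Theta>; i \<in> I; x \<in> topspace (fst (P i))\<rbrakk> \<Longrightarrow> k (s, wedge_in I P i x) = h i (s, x)"
proof -
  let ?S = "(\<lambda>i. (i, snd (P i))) ` I"
  have c: "continuous_map (prod_topology \<Theta> (sum_topology (\<lambda>i. fst (P i)) I)) Z (\<lambda>(s, i, x). h i (s, x))"
    by (rule continuous_map_sum_param [OF h])
  obtain k where k: "continuous_map (prod_topology \<Theta> (fst (wedge I P))) Z k"
    "\<And>s x. s \<in> topspace \<Theta> \<Longrightarrow> x \<in> topspace (sum_topology (\<lambda>i. fst (P i)) I) \<Longrightarrow>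
       k (s, collapse_map ?S x) = (\<lambda>(s, i, x). h i (s, x)) (s, x)"
    unfolding wedge_def
    by (rule collapse_lift [OF \<Theta> c, of ?S z]) (use z in auto)
  have "k (s, wedge_in I P i x) = h i (s, x)" if "s \<in> topspace \<Theta>" "i \<in> I" "x \<in> topspace (fst (P i))" for s i x
    using k(2) [of s "(i, x)"] that by (simp add: wedge_in_def)
  with k(1) that show ?thesis by blast
qed

lemma continuous_map_suspension_in:
  "continuous_map (prod_topology (fst P) II) (fst (suspension P)) (suspension_in P)"
  unfolding suspension_in_def suspension_def
  by (cases P) (simp add: quotient_imp_continuous_map [OF quotient_map_collapse])

lemma suspension_in_base:
  assumes "t \<in> {0, 1} \<and> x \<in> topspace (fst P) \<or> x = snd P \<and> t \<in> {0..1}"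
  shows "suspension_in P (x, t) = snd (suspension P)"
  using assms unfolding suspension_in_def suspension_def by (cases P) (auto simp: collapse_map_def)

lemma topspace_suspension:
  "topspace (fst (suspension P)) = suspension_in P ` (topspace (fst P) \<times> {0..1})"
  unfolding suspension_in_def suspension_def collapse_eq by (cases P) simp

lemma suspension_lift:
  assumes \<Theta>: "locally_compact_space \<Theta>" "Hausdorff_space \<Theta>"
    and h: "continuous_map (prod_topology \<Theta> (prod_topology (fst P) II)) Z h"
    and z: "\<And>s x t. \<lbrakk>s \<in> topspace \<Theta>; x \<in> topspace (fst P); t \<in> {0..1}; t \<in> {0, 1} \<or> x = snd P\<rbrakk> \<Longrightarrow> h (s, x, t) = z"
  obtains k where "continuous_map (prod_topology \<Theta> (fst (suspension P))) Z k"
    "\<And>s x t. \<lbrakk>s \<in> topspace \<Theta>; x \<in> topspace (fst P); t \<in> {0..1}\<rbrakk> \<Longrightarrow> k (s, suspension_in P (x, t)) = h (s, x, t)"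
proof -
  obtain X p where P: "P = (X, p)" by (cases P)
  let ?S = "topspace X \<times> {0, 1} \<union> {p} \<times> {0..1}"
  obtain k where k: "continuous_map (prod_topology \<Theta> (fst (suspension P))) Z k"
    "\<And>s x. s \<in> topspace \<Theta> \<Longrightarrow> x \<in> topspace (prod_topology X II) \<Longrightarrow> k (s, collapse_map ?S x) = h (s, x)"
    unfolding suspension_def P prod.case
    by (rule collapse_lift [OF \<Theta> h [unfolded P fst_conv], of ?S z]) (use z P in auto)
  have "k (s, suspension_in P (x, t)) = h (s, x, t)" if "s \<in> topspace \<Theta>" "x \<in> topspace (fst P)" "t \<in> {0..1}" for s x t
    using k(2) [of s "(x, t)"] that by (simp add: suspension_in_def P)
  with k(1) that show ?thesis by blast
qed

lemma locally_compact_II: "locally_compact_space II" "Hausdorff_space II"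
  by (auto intro: compact_imp_locally_compact_space Hausdorff_space_subtopology simp: compact_space_subtopology)

section \<open>The iterated wedge of suspensions and its universal property\<close>

locale wedge_of_suspensions =
  fixes X :: "nat \<Rightarrow> 'x topology" and S :: "nat \<Rightarrow> 'x set" and R :: "nat set" and N :: "nat \<Rightarrow> nat"
  assumes S: "r \<in> R \<Longrightarrow> S r \<subseteq> topspace (X r) \<and> S r \<noteq> {}"
    and N: "r \<in> R \<Longrightarrow> N r > 0"
begin

abbreviation "layer r \<equiv> wedge {..<N r} (\<lambda>_. collapse (X r) (S r))"

abbreviation "whole \<equiv> wedge R (\<lambda>r. suspension (layer r))"

text \<open>The characteristic map of copy \<open>k\<close> in rank \<open>r\<close>. Through it,
  maps out of \<open>whole\<close> become families of loops on the spaces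
  \<open>X r\<close>.\<close>

definition inclusion where
  "inclusion r k = (\<lambda>(x, t). wedge_in R (\<lambda>r. suspension (layer r)) r
     (suspension_in (layer r) (wedge_in {..<N r} (\<lambda>_. collapse (X r) (S r)) k (collapse_map (S r) x), t)))"

lemma collapse_in: "x \<in> topspace (X r) \<Longrightarrow> collapse_map (S r) x \<in> topspace (fst (collapse (X r) (S r)))"
  by (simp add: collapse_eq)

lemma continuous_map_inclusion:
  assumes "r \<in> R" "k < N r"
  shows "continuous_map (prod_topology (X r) II) (fst whole) (inclusion r k)"
proof -
  have 1: "continuous_map (X r) (fst (layer r)) (\<lambda>x. wedge_in {..<N r} (\<lambda>_. collapse (X r) (S r)) k (collapse_map (S r) x))"
    using continuous_map_comp [OF continuous_map_wedge_in [of k "{..<N r}" "\<lambda>_. collapse (X r) (S r)"]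
        quotient_imp_continuous_map [OF quotient_map_collapse [of "X r" "S r"]]] assms by simp
  have 2: "continuous_map (prod_topology (X r) II) (prod_topology (fst (layer r)) II)
     (\<lambda>z. (wedge_in {..<N r} (\<lambda>_. collapse (X r) (S r)) k (collapse_map (S r) (fst z)), snd z))"
    by (intro continuous_map_pairedI continuous_map_snd continuous_map_comp [OF 1 continuous_map_fst])
  show ?thesis
    using continuous_map_comp [OF continuous_map_wedge_in [OF assms(1), of "\<lambda>r. suspension (layer r)"]
        continuous_map_comp [OF continuous_map_suspension_in 2]]
    by (simp add: inclusion_def case_prod_unfold)
qed

lemma layer_base:
  assumes "r \<in> R" "k < N r" "x \<in> S r"
  shows "wedge_in {..<N r} (\<lambda>_. collapse (X r) (S r)) k (collapse_map (S r) x) = snd (layer r)"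
  using wedge_in_base [of k "{..<N r}" "\<lambda>_. collapse (X r) (S r)"] assms by (simp add: collapse_map_def)

lemma layer_in:
  assumes "k < N r" "x \<in> topspace (X r)"
  shows "wedge_in {..<N r} (\<lambda>_. collapse (X r) (S r)) k (collapse_map (S r) x) \<in> topspace (fst (layer r))"
  using assms collapse_in by (auto simp: topspace_wedge)

lemma inclusion_base:
  assumes "r \<in> R" "k < N r" "x \<in> topspace (X r)" "t \<in> {0..1}" "x \<in> S r \<or> t \<in> {0, 1}"
  shows "inclusion r k (x, t) = snd whole"
proof -
  have "suspension_in (layer r) (wedge_in {..<N r} (\<lambda>_. collapse (X r) (S r)) k (collapse_map (S r) x), t) = snd (suspension (layer r))"
    by (rule suspension_in_base) (use assms layer_base layer_in in auto)
  then show ?thesis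
    using wedge_in_base [OF assms(1), of "\<lambda>r. suspension (layer r)"] by (simp add: inclusion_def)
qed

lemma inclusion_surj:
  assumes "w \<in> topspace (fst whole)"
  obtains r k x t where "r \<in> R" "k < N r" "x \<in> topspace (X r)" "t \<in> {0..1}" "w = inclusion r k (x, t)"
proof -
  obtain r u where r: "r \<in> R" "u \<in> topspace (fst (suspension (layer r)))" "w = wedge_in R (\<lambda>r. suspension (layer r)) r u"
    using assms unfolding topspace_wedge [of R] by blast
  obtain y t where y: "y \<in> topspace (fst (layer r))" "t \<in> {0..1}" "u = suspension_in (layer r) (y, t)"
    using r(2) unfolding topspace_suspension by blast
  obtain k q where k: "k < N r" "q \<in> topspace (fst (collapse (X r) (S r)))" "y = wedge_in {..<N r} (\<lambda>_. collapse (X r) (S r)) k q"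
    using y(1) unfolding topspace_wedge by blast
  obtain x where "x \<in> topspace (X r)" "q = collapse_map (S r) x"
    using k(2) unfolding collapse_eq by auto
  then show ?thesis using that r y k by (simp add: inclusion_def)
qed

text \<open>The constructions are undone from the inside out: collapse, wedge of copies, suspension,
  wedge over the ranks. One common value \<open>z\<close> on all collapsed subsets makes every stage
  respect basepoints.\<close>

lemma total_lift:
  assumes h: "\<And>r k. \<lbrakk>r \<in> R; k < N r\<rbrakk> \<Longrightarrow> continuous_map (prod_topology II (prod_topology (X r) II)) Z (h r k)"
    and z: "\<And>r k s x t. \<lbrakk>r \<in> R; k < N r; s \<in> {0..1}; x \<in> topspace (X r); t \<in> {0..1}; x \<in> S r \<or> t \<in> {0, 1}\<rbrakk> \<Longrightarrow> h r k (s, x, t) = z"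
  obtains g where "continuous_map (prod_topology II (fst whole)) Z g"
    "\<And>r k s x t. \<lbrakk>r \<in> R; k < N r; s \<in> {0..1}; x \<in> topspace (X r); t \<in> {0..1}\<rbrakk> \<Longrightarrow> g (s, inclusion r k (x, t)) = h r k (s, x, t)"
proof -
  let ?Q = "\<lambda>r. collapse (X r) (S r)"
  \<comment> \<open>Before the suspension stage the loop coordinate \<open>t\<close> is still free
    and joins the homotopy time \<open>s\<close> as a parameter. This is why the lifting lemmas
    allow any locally compact Hausdorff parameter space.\<close>
  let ?\<Theta> = "prod_topology II II"
  have \<Theta>: "locally_compact_space ?\<Theta>" "Hausdorff_space ?\<Theta>"
    using locally_compact_II by (metis locally_compact_space_prod_topology, metis Hausdorff_space_prod_topology)
  have "\<exists>g. continuous_map (prod_topology II (fst (suspension (layer r)))) Z g \<and>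
     (\<forall>k<N r. \<forall>s\<in>{0..1}. \<forall>x\<in>topspace (X r). \<forall>t\<in>{0..1}.
       g (s, suspension_in (layer r) (wedge_in {..<N r} (\<lambda>_. ?Q r) k (collapse_map (S r) x), t)) = h r k (s, x, t))" (is "\<exists>g. ?P g")
    if r: "r \<in> R" for r
  proof -
    have "\<exists>g. continuous_map (prod_topology ?\<Theta> (fst (?Q r))) Z g \<and>
       (\<forall>s\<in>{0..1}. \<forall>t\<in>{0..1}. \<forall>x\<in>topspace (X r). g ((s, t), collapse_map (S r) x) = h r k (s, x, t))" if k: "k < N r" for k
    proof -
      have "continuous_map (prod_topology ?\<Theta> (X r)) Z (\<lambda>w. h r k (fst (fst w), snd w, snd (fst w)))"
        by (rule continuous_map_comp [OF h [OF r k]]) (intro continuous_map_pairedI continuous_map_projections)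
      then obtain g where "continuous_map (prod_topology ?\<Theta> (fst (?Q r))) Z g"
        "\<And>s x. s \<in> topspace ?\<Theta> \<Longrightarrow> x \<in> topspace (X r) \<Longrightarrow> g (s, collapse_map (S r) x) = h r k (fst s, x, snd s)"
        by (rule collapse_lift [OF \<Theta>, of _ _ _ "S r" z]) (use z [OF r k] in auto)
      then show ?thesis by (intro exI [of _ g]) auto
    qed
    then obtain g1 where g1: "\<And>k. k < N r \<Longrightarrow> continuous_map (prod_topology ?\<Theta> (fst (?Q r))) Z (g1 k)"
       "\<And>k s t x. \<lbrakk>k < N r; s \<in> {0..1}; t \<in> {0..1}; x \<in> topspace (X r)\<rbrakk> \<Longrightarrow> g1 k ((s, t), collapse_map (S r) x) = h r k (s, x, t)"
      by metis
    obtain g2 where g2: "continuous_map (prod_topology ?\<Theta> (fst (layer r))) Z g2"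
      "\<And>s k q. \<lbrakk>s \<in> topspace ?\<Theta>; k \<in> {..<N r}; q \<in> topspace (fst (?Q r))\<rbrakk> \<Longrightarrow> g2 (s, wedge_in {..<N r} (\<lambda>_. ?Q r) k q) = g1 k (s, q)"
    proof (rule wedge_lift [OF \<Theta>, of "{..<N r}" "\<lambda>_. ?Q r" Z g1 z])
      fix s k assume s: "s \<in> topspace ?\<Theta>" and k: "k \<in> {..<N r}"
      obtain x where x: "x \<in> S r" "x \<in> topspace (X r)" using S [OF r] by blast
      have "snd (?Q r) = collapse_map (S r) x" using x by (simp add: collapse_map_def)
      then show "g1 k (s, snd (?Q r)) = z"
        using g1(2) [of k "fst s" "snd s" x] z [OF r, of k "fst s" x "snd s"] s k x by (cases s) auto
    qed (use g1 in auto)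
    have g2h: "g2 ((s, t), wedge_in {..<N r} (\<lambda>_. ?Q r) k (collapse_map (S r) x)) = h r k (s, x, t)"
      if "k < N r" "s \<in> {0..1}" "t \<in> {0..1}" "x \<in> topspace (X r)" for k s t x
      using g2(2) [of "(s, t)" k "collapse_map (S r) x"] g1(2) [OF that] collapse_in that by simp
    have c3: "continuous_map (prod_topology II (prod_topology (fst (layer r)) II)) Z (\<lambda>w. g2 ((fst w, snd (snd w)), fst (snd w)))"
      by (rule continuous_map_comp [OF g2(1)]) (intro continuous_map_pairedI continuous_map_projections)
    obtain g3 where g3: "continuous_map (prod_topology II (fst (suspension (layer r)))) Z g3"
      "\<And>s y t. \<lbrakk>s \<in> topspace II; y \<in> topspace (fst (layer r)); t \<in> {0..1}\<rbrakk> \<Longrightarrow> g3 (s, suspension_in (layer r) (y, t)) = g2 ((s, t), y)"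
    proof (rule suspension_lift [OF locally_compact_II c3, of z])
      fix s y and t :: real assume s: "s \<in> topspace II" and y: "y \<in> topspace (fst (layer r))" and t: "t \<in> {0..1}" "t \<in> {0, 1} \<or> y = snd (layer r)"
      show "g2 ((fst (s, y, t), snd (snd (s, y, t))), fst (snd (s, y, t))) = z"
      proof (cases "y = snd (layer r)")
        case True
        \<comment> \<open>The basepoint of a layer is the image of any point of \<open>S r\<close>
          in copy 0, which exists because \<open>N r > 0\<close>.\<close>
        obtain x where x: "x \<in> S r" "x \<in> topspace (X r)" using S [OF r] by blast
        have "y = wedge_in {..<N r} (\<lambda>_. ?Q r) 0 (collapse_map (S r) x)" using layer_base [OF r N [OF r] x(1)] True by simp
        then show ?thesis using g2h [OF N [OF r], of s t x] z [OF r N [OF r], of s x t] s t x by simp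
      next
        case False
        then have t01: "t \<in> {0, 1}" using t by simp
        obtain k q where k: "k < N r" "q \<in> topspace (fst (?Q r))" "y = wedge_in {..<N r} (\<lambda>_. ?Q r) k q"
          using y unfolding topspace_wedge by blast
        obtain x where x: "x \<in> topspace (X r)" "q = collapse_map (S r) x"
          using k(2) unfolding collapse_eq by auto
        show ?thesis using g2h [OF k(1), of s t x] z [OF r k(1), of s x t] s t t01 x k(3) by simp
      qed
    qed (rule that, assumption, simp)
    have "?P g3"
      using g3 g2h layer_in by simp
    then show ?thesis by blast
  qed
  then obtain g3 where g3: "\<And>r. r \<in> R \<Longrightarrow> continuous_map (prod_topology II (fst (suspension (layer r)))) Z (g3 r)"
     "\<And>r k s x t. \<lbrakk>r \<in> R; k < N r; s \<in> {0..1}; x \<in> topspace (X r); t \<in> {0..1}\<rbrakk> \<Longrightarrow>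
       g3 r (s, suspension_in (layer r) (wedge_in {..<N r} (\<lambda>_. ?Q r) k (collapse_map (S r) x), t)) = h r k (s, x, t)"
    by metis
  obtain g where g: "continuous_map (prod_topology II (fst whole)) Z g"
    "\<And>s r u. \<lbrakk>s \<in> topspace II; r \<in> R; u \<in> topspace (fst (suspension (layer r)))\<rbrakk> \<Longrightarrow>
      g (s, wedge_in R (\<lambda>r. suspension (layer r)) r u) = g3 r (s, u)"
  proof (rule wedge_lift [OF locally_compact_II, of R "\<lambda>r. suspension (layer r)" Z g3 z])
    fix s r assume s: "s \<in> topspace II" and r: "r \<in> R"
    obtain x where x: "x \<in> S r" "x \<in> topspace (X r)" using S [OF r] by blast
    have "snd (suspension (layer r)) = suspension_in (layer r) (wedge_in {..<N r} (\<lambda>_. ?Q r) 0 (collapse_map (S r) x), 0)"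
      by (rule suspension_in_base [symmetric]) (use layer_in [OF N [OF r] x(2)] in auto)
    then show "g3 r (s, snd (suspension (layer r))) = z"
      using g3(2) [OF r N [OF r], of s x 0] z [OF r N [OF r], of s x 0] s x by simp
  qed (use g3 in auto)
  show ?thesis
  proof (rule that [OF g(1)])
    fix r k and s t :: real and x assume *: "r \<in> R" "k < N r" "s \<in> {0..1}" "x \<in> topspace (X r)" "t \<in> {0..1}"
    have "suspension_in (layer r) (wedge_in {..<N r} (\<lambda>_. ?Q r) k (collapse_map (S r) x), t) \<in> topspace (fst (suspension (layer r)))"
      unfolding topspace_suspension using layer_in * by blast
    then show "g (s, inclusion r k (x, t)) = h r k (s, x, t)"
      using g(2) [of s r] g3(2) [OF *] * by (simp add: inclusion_def)
  qed
qed

end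

section \<open>Splitting the suspension of a space with commuting retractions\<close>

definition loop_join :: "('x \<times> real \<Rightarrow> 'z) \<Rightarrow> ('x \<times> real \<Rightarrow> 'z) \<Rightarrow> 'x \<times> real \<Rightarrow> 'z" where
  "loop_join f g = (\<lambda>(x, t). if t \<le> 1/2 then f (x, 2 * t) else g (x, 2 * t - 1))"

definition rev_loop :: "('x \<times> real \<Rightarrow> 'z) \<Rightarrow> 'x \<times> real \<Rightarrow> 'z" where
  "rev_loop f = (\<lambda>(x, t). f (x, 1 - t))"

lemma continuous_map_II_split:
  assumes p: "continuous_map X euclideanreal p"
    and f: "continuous_map (subtopology X {x \<in> topspace X. p x \<le> c}) Y f"
    and g: "continuous_map (subtopology X {x \<in> topspace X. c \<le> p x}) Y g"
    and fg: "\<And>x. x \<in> topspace X \<Longrightarrow> p x = c \<Longrightarrow> f x = g x"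
  shows "continuous_map X Y (\<lambda>x. if p x \<le> c then f x else g x)"
  by (rule continuous_map_cases_le [OF p _ f g fg]) auto

lemma continuous_map_snd_II:
  "continuous_map (subtopology (prod_topology X II) S) euclideanreal snd"
  by (rule continuous_map_from_subtopology [OF continuous_map_II_euclidean [OF continuous_map_snd]])

lemma continuous_map_join:
  assumes f: "continuous_map (prod_topology X II) Z f" and g: "continuous_map (prod_topology X II) Z g"
    and fg: "\<And>x. x \<in> topspace X \<Longrightarrow> f (x, 1) = g (x, 0)"
  shows "continuous_map (prod_topology X II) Z (loop_join f g)"
proof -
  let ?P = "prod_topology X II"
  have *: "loop_join f g = (\<lambda>z. if snd z \<le> 1/2 then f (fst z, 2 * snd z) else g (fst z, 2 * snd z - 1))"
    by (auto simp: loop_join_def fun_eq_iff)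
  show ?thesis
    unfolding *
  proof (rule continuous_map_II_split)
    show "continuous_map ?P euclideanreal snd"
      by (rule continuous_map_II_euclidean [OF continuous_map_snd])
    show "continuous_map (subtopology ?P {x \<in> topspace ?P. snd x \<le> 1/2}) Z (\<lambda>x. f (fst x, 2 * snd x))"
      by (rule continuous_map_comp [OF f], intro continuous_map_pairedI continuous_map_II continuous_map_real_mult
          continuous_map_snd_II continuous_map_from_subtopology continuous_map_fst) auto
    show "continuous_map (subtopology ?P {x \<in> topspace ?P. 1/2 \<le> snd x}) Z (\<lambda>x. g (fst x, 2 * snd x - 1))"
      by (rule continuous_map_comp [OF g], intro continuous_map_pairedI continuous_map_II continuous_map_real_mult
          continuous_map_diff continuous_map_snd_II continuous_map_from_subtopology continuous_map_fst) auto
    show "f (fst x, 2 * snd x) = g (fst x, 2 * snd x - 1)"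
      if "x \<in> topspace ?P" "snd x = 1/2" for x
    proof -
      have "2 * snd x = 1" "2 * snd x - 1 = 0" using that by auto
      moreover have "fst x \<in> topspace X" using that by auto
      ultimately show ?thesis using fg by presburger
    qed
  qed
qed

lemma continuous_map_reparam:
  assumes f: "continuous_map (prod_topology X II) Z f"
    and p: "continuous_map Y X p" and q: "continuous_map Y II q"
  shows "continuous_map Y Z (\<lambda>y. f (p y, q y))"
  by (rule continuous_map_comp [OF f], intro continuous_map_pairedI p q)

lemma continuous_map_rev_loop:
  assumes f: "continuous_map (prod_topology X II) Z f"
  shows "continuous_map (prod_topology X II) Z (rev_loop f)"
proof -
  have *: "rev_loop f = (\<lambda>z. f (fst z, 1 - snd z))"
    by (auto simp: rev_loop_def fun_eq_iff)
  show ?thesis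
    unfolding *
    by (rule continuous_map_reparam [OF f], intro continuous_map_fst)
       (intro continuous_map_II continuous_map_diff continuous_map_II_euclidean [OF continuous_map_snd], auto)
qed

text \<open>The deformation \<open>D i\<close> pushes the neighbourhood \<open>v i x < 1\<close> of the image of \<open>e i\<close> into that image.\<close>

locale idempotent_cube =
  fixes X :: "'x topology" and n :: nat and e :: "nat \<Rightarrow> 'x \<Rightarrow> 'x"
    and D :: "nat \<Rightarrow> real \<times> 'x \<Rightarrow> 'x" and v :: "nat \<Rightarrow> 'x \<Rightarrow> real"
  assumes e_cont: "i < n \<Longrightarrow> continuous_map X X (e i)"
    and e_idem: "\<lbrakk>i < n; x \<in> topspace X\<rbrakk> \<Longrightarrow> e i (e i x) = e i x"
    and e_comm: "\<lbrakk>i < n; j < n; x \<in> topspace X\<rbrakk> \<Longrightarrow> e i (e j x) = e j (e i x)"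
    and D_cont: "i < n \<Longrightarrow> continuous_map (prod_topology II X) X (D i)"
    and D_0: "\<lbrakk>i < n; x \<in> topspace X\<rbrakk> \<Longrightarrow> D i (0, x) = x"
    and D_e: "\<lbrakk>i < n; j < n; i \<noteq> j; x \<in> topspace X; s \<in> {0..1}\<rbrakk> \<Longrightarrow> D i (s, e j x) = e j (D i (s, x))"
    and D_e_self: "\<lbrakk>i < n; x \<in> topspace X; s \<in> {0..1}\<rbrakk> \<Longrightarrow> D i (s, e i x) = e i x"
    and v_cont: "i < n \<Longrightarrow> continuous_map X euclideanreal (v i)"
    and v_nonneg: "\<lbrakk>i < n; x \<in> topspace X\<rbrakk> \<Longrightarrow> 0 \<le> v i x"
    and v_e: "\<lbrakk>i < n; j < n; i \<noteq> j; x \<in> topspace X\<rbrakk> \<Longrightarrow> v i (e j x) = v i x"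
    and v_e_self: "\<lbrakk>i < n; x \<in> topspace X\<rbrakk> \<Longrightarrow> v i (e i x) = 0"
    and D_1: "\<lbrakk>i < n; x \<in> topspace X; v i x < 1\<rbrakk> \<Longrightarrow> e i (D i (1, x)) = D i (1, x)"
begin

text \<open>These loops are the pointed maps from the suspension of \<open>Y / B\<close>, where \<open>Y\<close> is the common image
  of the \<open>e j\<close> with \<open>j \<in> J\<close>, and \<open>B\<close> is the union of the images in \<open>Y\<close> of the \<open>e k\<close> with \<open>k \<in> K\<close>.\<close>

definition admissible :: "'z \<Rightarrow> nat set \<Rightarrow> nat set \<Rightarrow> ('x \<times> real \<Rightarrow> 'z) \<Rightarrow> bool" where
  "admissible z J K f \<longleftrightarrow> (\<forall>x\<in>topspace X. f (x, 0) = z \<and> f (x, 1) = z \<and>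
     (\<forall>t\<in>{0..1}. ((\<forall>i<n. e i x = x) \<longrightarrow> f (x, t) = z) \<and>
       (\<forall>j\<in>J. f (e j x, t) = f (x, t)) \<and> (\<forall>k\<in>K. e k x = x \<longrightarrow> f (x, t) = z)))"

abbreviation loop_homotopic where
  "loop_homotopic Z z J K f g \<equiv> homotopic_with (admissible z J K) (prod_topology X II) Z f g"

lemma e_in [simp]: "i < n \<Longrightarrow> x \<in> topspace X \<Longrightarrow> e i x \<in> topspace X"
  using e_cont by (meson continuous_map_image_subset_topspace image_subset_iff)

lemma D_in [simp]: "i < n \<Longrightarrow> x \<in> topspace X \<Longrightarrow> s \<in> {0..1} \<Longrightarrow> D i (s, x) \<in> topspace X"
  using D_cont [of i] by (auto simp: continuous_map_def)

lemma admissible_cong: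
  assumes "J \<subseteq> {..<n}" "\<And>x. x \<in> topspace (prod_topology X II) \<Longrightarrow> h x = k x"
  shows "admissible z J K h = admissible z J K k"
proof -
  have "h (x, t) = k (x, t)" if "x \<in> topspace X" "t \<in> {0..1}" for x t
    using assms(2) that by auto
  moreover have "h (e j x, t) = k (e j x, t)" if "x \<in> topspace X" "t \<in> {0..1}" "j \<in> J" for x t j
    using assms that by auto
  ultimately show ?thesis
    unfolding admissible_def by (auto intro!: ball_cong conj_cong)
qed

lemma loop_homotopicI:
  assumes "J \<subseteq> {..<n}"
    and "continuous_map (prod_topology II (prod_topology X II)) Z h"
    and "\<And>x t. x \<in> topspace X \<Longrightarrow> t \<in> {0..1} \<Longrightarrow> h (0, x, t) = f (x, t)"
    and "\<And>x t. x \<in> topspace X \<Longrightarrow> t \<in> {0..1} \<Longrightarrow> h (1, x, t) = g (x, t)"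
    and "\<And>s. s \<in> {0..1} \<Longrightarrow> admissible z J K (\<lambda>x. h (s, x))"
  shows "loop_homotopic Z z J K f g"
proof (rule homotopic_withI [of _ _ _ h])
  show "admissible z J K u = admissible z J K w"
    if "\<And>x. x \<in> topspace (prod_topology X II) \<Longrightarrow> u x = w x" for u w
    by (rule admissible_cong [OF assms(1) that])
qed (use assms in auto)

section \<open>Concatenation of admissible loops and its group laws up to homotopy\<close>

lemma admissible_join:
  "admissible z J K f \<Longrightarrow> admissible z J K g \<Longrightarrow> admissible z J K (loop_join f g)"
  unfolding admissible_def loop_join_def by auto

lemma admissible_rev_loop:
  "admissible z J K f \<Longrightarrow> admissible z J K (rev_loop f)"
  unfolding admissible_def rev_loop_def by auto

lemma admissible_const: "admissible z J K (\<lambda>_. z)"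
  unfolding admissible_def by auto

lemma admissible_mono:
  "admissible z J K f \<Longrightarrow> J' \<subseteq> J \<Longrightarrow> K' \<subseteq> K \<Longrightarrow> admissible z J' K' f"
  unfolding admissible_def by blast

lemma admissible_ends:
  assumes "admissible z J K f" "x \<in> topspace X"
  shows "f (x, 0) = z" "f (x, 1) = z"
  using assms unfolding admissible_def by auto

lemma continuous_map_join_admissible:
  assumes "continuous_map (prod_topology X II) Z f" "continuous_map (prod_topology X II) Z g"
    "admissible z J K f" "admissible z J K g"
  shows "continuous_map (prod_topology X II) Z (loop_join f g)"
  using assms by (intro continuous_map_join) (auto simp: admissible_ends)

lemma loop_homotopicD:
  assumes "loop_homotopic Z z J K f g"
  shows "continuous_map (prod_topology X II) Z f" "continuous_map (prod_topology X II) Z g"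
    "admissible z J K f" "admissible z J K g"
  using homotopic_with_imp_continuous_maps [OF assms] homotopic_with_imp_property [OF assms] by auto

lemma loop_homotopic_join:
  assumes J: "J \<subseteq> {..<n}" and f: "loop_homotopic Z z J K f f'" and g: "loop_homotopic Z z J K g g'"
  shows "loop_homotopic Z z J K (loop_join f g) (loop_join f' g')"
proof -
  obtain h where h: "continuous_map (prod_topology II (prod_topology X II)) Z h"
     "\<And>x. h (0, x) = f x" "\<And>x. h (1, x) = f' x" "\<And>s. s \<in> {0..1} \<Longrightarrow> admissible z J K (\<lambda>x. h (s, x))"
    using f unfolding homotopic_with_def by auto
  obtain k where k: "continuous_map (prod_topology II (prod_topology X II)) Z k"
     "\<And>x. k (0, x) = g x" "\<And>x. k (1, x) = g' x" "\<And>s. s \<in> {0..1} \<Longrightarrow> admissible z J K (\<lambda>x. k (s, x))"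
    using g unfolding homotopic_with_def by auto
  \<comment> \<open>With \<open>(s, x)\<close> regarded as the space variable, the joined homotopy
    is an ordinary concatenation of loops.\<close>
  let ?h = "\<lambda>((s, x), t). h (s, x, t)"
  let ?k = "\<lambda>((s, x), t). k (s, x, t)"
  have assoc: "continuous_map (prod_topology (prod_topology II X) II) Z (\<lambda>((s, x), t). u (s, x, t))"
    if "continuous_map (prod_topology II (prod_topology X II)) Z u" for u
  proof -
    have "continuous_map (prod_topology (prod_topology II X) II) Z (\<lambda>y. u (fst (fst y), snd (fst y), snd y))"
      by (rule continuous_map_comp [OF that]) (intro continuous_map_pairedI continuous_map_projections)
    then show ?thesis by (simp add: case_prod_unfold)
  qed
  have jc: "continuous_map (prod_topology (prod_topology II X) II) Z (loop_join ?h ?k)"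
    by (intro continuous_map_join assoc h k) (use h(4) k(4) admissible_ends in fastforce)
  have *: "continuous_map (prod_topology II (prod_topology X II)) Z (\<lambda>(s, y). loop_join (\<lambda>y. h (s, y)) (\<lambda>y. k (s, y)) y)"
  proof -
    have "continuous_map (prod_topology II (prod_topology X II)) Z (\<lambda>y. loop_join ?h ?k ((fst y, fst (snd y)), snd (snd y)))"
      by (rule continuous_map_comp [OF jc]) (intro continuous_map_pairedI continuous_map_projections)
    moreover have "loop_join ?h ?k ((fst y, fst (snd y)), snd (snd y))
        = (\<lambda>(s, y). loop_join (\<lambda>y. h (s, y)) (\<lambda>y. k (s, y)) y) y" for y
      by (cases y) (auto simp: loop_join_def)
    ultimately show ?thesis by simp
  qed
  show ?thesis
  proof (rule loop_homotopicI [OF J *])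
    show "admissible z J K (\<lambda>x. (\<lambda>(s, y). loop_join (\<lambda>y. h (s, y)) (\<lambda>y. k (s, y)) y) (s, x))"
      if "s \<in> {0..1}" for s
      using admissible_join [OF h(4) [OF that] k(4) [OF that]] by simp
  qed (simp_all add: h k loop_join_def)
qed

lemma loop_homotopic_rev_loop:
  assumes J: "J \<subseteq> {..<n}" and f: "loop_homotopic Z z J K f f'"
  shows "loop_homotopic Z z J K (rev_loop f) (rev_loop f')"
proof -
  have eq: "rev_loop f = f \<circ> (\<lambda>z. (fst z, 1 - snd z))" for f :: "'x \<times> real \<Rightarrow> 'c"
    by (auto simp: rev_loop_def)
  show ?thesis
    unfolding eq
  proof (rule homotopic_with_compose_continuous_map_right [OF f])
    show "continuous_map (prod_topology X II) (prod_topology X II) (\<lambda>z. (fst z, 1 - snd z))"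
      by (intro continuous_map_pairedI continuous_map_fst)
         (intro continuous_map_II continuous_map_diff continuous_map_II_euclidean [OF continuous_map_snd], auto)
    show "admissible z J K (f \<circ> (\<lambda>z. (fst z, 1 - snd z)))" if "admissible z J K f" for f
      using admissible_rev_loop [OF that] by (simp add: eq)
  qed
qed

text \<open>The straight line from \<open>p\<close> to \<open>q\<close> moves only the loop
  coordinate, so the conditions on points of \<open>X\<close> persist; at both ends it rests at 0 or
  1, where \<open>f\<close> has the value \<open>z\<close>. Associativity, unit and inverse laws are
  all instances.\<close>

lemma loop_homotopic_reparam:
  assumes J: "J \<subseteq> {..<n}" and fc: "continuous_map (prod_topology X II) Z f" and f: "admissible z J K f"
    and p: "continuous_on {0..1} p" "p ` {0..1} \<subseteq> {0..1}" and q: "continuous_on {0..1} q" "q ` {0..1} \<subseteq> {0..1}"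
    and pq: "p 0 = q 0" "p 1 = q 1" "p 0 \<in> {0, 1}" "p 1 \<in> {0, 1}"
  shows "loop_homotopic Z z J K (\<lambda>(x, t). f (x, p t)) (\<lambda>(x, t). f (x, q t))"
proof (rule loop_homotopicI [OF J])
  let ?h = "\<lambda>w. f (fst (snd w), (1 - fst w) * p (snd (snd w)) + fst w * q (snd (snd w)))"
  have cv: "0 \<le> (1 - s) * a + s * b \<and> (1 - s) * a + s * b \<le> 1"
    if "s \<in> {0..1}" "a \<in> {0..1}" "b \<in> {0..1}" for s a b :: real
    using that convex_bound_le [of a 1 b "1-s" s] by (auto simp: )
  have pc: "continuous_map II euclideanreal p" "continuous_map II euclideanreal q"
    using p q by auto
  have c2: "continuous_map (prod_topology II (prod_topology X II)) II (\<lambda>w. snd (snd w))"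
    by (rule continuous_map_projections)
  show "continuous_map (prod_topology II (prod_topology X II)) Z ?h"
    apply (rule continuous_map_reparam [OF fc])
     apply (rule continuous_map_projections)
    apply (rule continuous_map_II)
     apply (intro continuous_map_add continuous_map_real_mult continuous_map_diff continuous_map_comp [OF pc(1) c2]
       continuous_map_comp [OF pc(2) c2] continuous_map_II_euclidean [OF continuous_map_fst])
     apply simp
    using cv p q by (force simp: image_subset_iff)
  show "?h (0, x, t) = (case (x, t) of (x, t) \<Rightarrow> f (x, p t))" for x t by simp
  show "?h (1, x, t) = (case (x, t) of (x, t) \<Rightarrow> f (x, q t))" for x t by simp
  fix s :: real assume s: "s \<in> {0..1}"
  have "(1 - s) * p t + s * q t \<in> {0..1}" if "t \<in> {0..1}" for t
    using cv [OF s, of "p t" "q t"] that p q by (auto simp: image_subset_iff)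
  moreover have "(1 - s) * p 0 + s * q 0 \<in> {0, 1}" "(1 - s) * p 1 + s * q 1 \<in> {0, 1}"
    using pq by (auto simp: algebra_simps)
  ultimately show "admissible z J K (\<lambda>x. ?h (s, x))"
    using f unfolding admissible_def by auto
qed

lemma loop_homotopic_assoc:
  assumes J: "J \<subseteq> {..<n}" and c: "continuous_map (prod_topology X II) Z f" "continuous_map (prod_topology X II) Z g"
      "continuous_map (prod_topology X II) Z h"
    and a: "admissible z J K f" "admissible z J K g" "admissible z J K h"
  shows "loop_homotopic Z z J K (loop_join (loop_join f g) h) (loop_join f (loop_join g h))"
proof -
  \<comment> \<open>The two bracketings differ by the piecewise linear map with slopes 2, 1 and 1/2,
    changing at 1/4 and 1/2. It is concave, hence the minimum of its three lines.\<close>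
  let ?p = "\<lambda>t::real. min (2 * t) (min (t + 1/4) ((t + 1) / 2))"
  have p: "continuous_on {0..1} ?p" "?p ` {0..1} \<subseteq> {0..1}"
    by (intro continuous_intros) (auto simp: min_def)
  have 1: "loop_homotopic Z z J K (\<lambda>(x, t). loop_join f (loop_join g h) (x, ?p t)) (\<lambda>(x, t). loop_join f (loop_join g h) (x, t))"
  proof (rule loop_homotopic_reparam [OF J _ _ p])
    show "continuous_map (prod_topology X II) Z (loop_join f (loop_join g h))"
      by (rule continuous_map_join_admissible [OF c(1) continuous_map_join_admissible [OF c(2,3) a(2,3)] a(1) admissible_join [OF a(2,3)]])
    show "admissible z J K (loop_join f (loop_join g h))"
      by (intro admissible_join a)
  qed auto
  have eq: "loop_join (loop_join f g) h (x, t) = loop_join f (loop_join g h) (x, ?p t)" if "t \<in> {0..1}" for x t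
  proof -
    consider "t \<le> 1/4" | "1/4 < t" "t \<le> 1/2" | "1/2 < t" by linarith
    then show ?thesis
    proof cases
      case 1
      then have "?p t = 2 * t" using that by (auto simp: min_def)
      with 1 show ?thesis by (simp add: loop_join_def)
    next
      case 2
      then have "?p t = t + 1/4" using that by (auto simp: min_def field_simps)
      moreover have "2 * (2 * (t + 1 / 4) - 1) = 2 * (2 * t) - 1" by (simp add: algebra_simps)
      ultimately show ?thesis using 2 by (simp add: loop_join_def)
    next
      case 3
      then have "?p t = (t + 1) / 2" using that by (auto simp: min_def field_simps)
      moreover have "2 * (2 * ((t + 1) / 2) - 1) - 1 = 2 * t - 1" by simp
      ultimately show ?thesis using 3 by (simp add: loop_join_def del: distrib_left_numeral)
    qed
  qed
  have "loop_homotopic Z z J K (loop_join (loop_join f g) h) (\<lambda>(x, t). loop_join f (loop_join g h) (x, ?p t))"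
  proof (rule homotopic_with_equal)
    show "continuous_map (prod_topology X II) Z (loop_join (loop_join f g) h)"
      by (rule continuous_map_join_admissible [OF continuous_map_join_admissible [OF c(1,2) a(1,2)] c(3) admissible_join [OF a(1,2)] a(3)])
    show "admissible z J K (\<lambda>(x, t). loop_join f (loop_join g h) (x, ?p t))"
      using loop_homotopicD [OF 1] by simp
  qed (use eq in \<open>auto intro!: admissible_join a\<close>)
  from homotopic_with_trans [OF this 1] show ?thesis
    unfolding case_prod_eta .
qed

lemma loop_homotopic_const_join:
  assumes J: "J \<subseteq> {..<n}" and c: "continuous_map (prod_topology X II) Z f" and a: "admissible z J K f"
  shows "loop_homotopic Z z J K (loop_join (\<lambda>_. z) f) f"
proof -
  let ?p = "\<lambda>t::real. max 0 (2 * t - 1)"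
  have p: "continuous_on {0..1} ?p" "?p ` {0..1} \<subseteq> {0..1}"
    by (intro continuous_intros) auto
  have 1: "loop_homotopic Z z J K (\<lambda>(x, t). f (x, ?p t)) (\<lambda>(x, t). f (x, t))"
    by (rule loop_homotopic_reparam [OF J c a p]) auto
  \<comment> \<open>Continuity of a constant requires \<open>z\<close> to be a point of
    \<open>Z\<close>; it is one because \<open>z\<close> is the initial value of \<open>f\<close>,
    unless \<open>X\<close> is empty.\<close>
  have z: "continuous_map (prod_topology X II) Z (\<lambda>_. z)"
  proof (rule continuous_map_eq)
    show "continuous_map (prod_topology X II) Z (\<lambda>y. f (fst y, 0))"
      by (intro continuous_map_reparam [OF c] continuous_map_fst) auto
  qed (use admissible_ends [OF a] in auto)
  have "loop_homotopic Z z J K (loop_join (\<lambda>_. z) f) (\<lambda>(x, t). f (x, ?p t))"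
  proof (rule homotopic_with_equal)
    show "admissible z J K (loop_join (\<lambda>_. z) f)"
      by (intro admissible_join admissible_const a)
    show "admissible z J K (\<lambda>(x, t). f (x, ?p t))"
      using loop_homotopicD [OF 1] by simp
    show "continuous_map (prod_topology X II) Z (loop_join (\<lambda>_. z) f)"
      by (rule continuous_map_join_admissible [OF z c admissible_const a])
    show "loop_join (\<lambda>_. z) f y = (case y of (x, t) \<Rightarrow> f (x, max 0 (2 * t - 1)))"
      if yP: "y \<in> topspace (prod_topology X II)" for y
    proof -
      obtain x t where y: "y = (x, t)" "x \<in> topspace X" using yP by auto
      have "max 0 (2 * t - 1) = (if t \<le> 1/2 then 0 else 2 * t - 1)" by auto
      then show ?thesis using y admissible_ends [OF a y(2)] by (simp add: loop_join_def)
    qed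
  qed
  from homotopic_with_trans [OF this 1] show ?thesis
    unfolding case_prod_eta .
qed

lemma loop_homotopic_rev_join:
  assumes J: "J \<subseteq> {..<n}" and c: "continuous_map (prod_topology X II) Z f" and a: "admissible z J K f"
  shows "loop_homotopic Z z J K (loop_join (rev_loop f) f) (\<lambda>_. z)"
proof -
  \<comment> \<open>The path followed back and forth starts and ends at parameter 1, so its
    parameter function contracts to the constant 1.\<close>
  have 1: "loop_homotopic Z z J K (\<lambda>(x, t). f (x, \<bar>2 * t - 1\<bar>)) (\<lambda>(x, t). f (x, 1))"
    by (rule loop_homotopic_reparam [OF J])
       (use c a in \<open>auto intro!: continuous_intros simp: max_def\<close>)
  have "loop_homotopic Z z J K (loop_join (rev_loop f) f) (\<lambda>(x, t). f (x, \<bar>2 * t - 1\<bar>))"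
  proof (rule homotopic_with_equal)
    show "admissible z J K (loop_join (rev_loop f) f)"
      by (intro admissible_join admissible_rev_loop a)
    show "continuous_map (prod_topology X II) Z (loop_join (rev_loop f) f)"
      by (rule continuous_map_join_admissible [OF continuous_map_rev_loop [OF c] c admissible_rev_loop [OF a] a])
    show "admissible z J K (\<lambda>(x, t). f (x, \<bar>2 * t - 1\<bar>))"
      using loop_homotopicD [OF 1] by simp
    show "loop_join (rev_loop f) f y = (case y of (x, t) \<Rightarrow> f (x, \<bar>2 * t - 1\<bar>))" for y
      by (cases y) (simp add: loop_join_def rev_loop_def)
  qed
  from homotopic_with_trans [OF this 1]
  have 0: "loop_homotopic Z z J K (loop_join (rev_loop f) f) (\<lambda>(x, t). f (x, 1))" .
  have "loop_homotopic Z z J K (\<lambda>(x, t). f (x, 1)) (\<lambda>_. z)"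
    by (rule homotopic_with_equal)
      (use loop_homotopicD [OF 1] admissible_ends [OF a] in \<open>auto intro!: admissible_const\<close>)
  then show ?thesis
    by (rule homotopic_with_trans [OF 0])
qed

lemma loop_homotopic_cancel:
  assumes J: "J \<subseteq> {..<n}" and c: "continuous_map (prod_topology X II) Z f" "continuous_map (prod_topology X II) Z g"
    and a: "admissible z J K f" "admissible z J K g"
  shows "loop_homotopic Z z J K (loop_join (rev_loop f) (loop_join f g)) g"
proof -
  note r = continuous_map_rev_loop [OF c(1)] admissible_rev_loop [OF a(1)]
  have 1: "loop_homotopic Z z J K (loop_join (rev_loop f) (loop_join f g)) (loop_join (loop_join (rev_loop f) f) g)"
    using loop_homotopic_assoc [OF J r(1) c r(2) a] by (rule homotopic_with_symD)
  have 2: "loop_homotopic Z z J K (loop_join (loop_join (rev_loop f) f) g) (loop_join (\<lambda>_. z) g)"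
    by (rule loop_homotopic_join [OF J loop_homotopic_rev_join [OF J c(1) a(1)]]) (simp add: c a)
  have 3: "loop_homotopic Z z J K (loop_join (\<lambda>_. z) g) g"
    by (rule loop_homotopic_const_join [OF J c(2) a(2)])
  show ?thesis
    by (rule homotopic_with_trans [OF 1 homotopic_with_trans [OF 2 3]])
qed

lemma rev_loop_rev_loop [simp]: "rev_loop (rev_loop f) = f"
  by (auto simp: rev_loop_def)

section \<open>Splitting off the image of one idempotent\<close>

lemma admissible_base:
  "admissible z J K f \<Longrightarrow> x \<in> topspace X \<Longrightarrow> t \<in> {0..1} \<Longrightarrow> (\<And>i. i < n \<Longrightarrow> e i x = x) \<Longrightarrow> f (x, t) = z"
  and admissible_invariant:
  "admissible z J K f \<Longrightarrow> j \<in> J \<Longrightarrow> x \<in> topspace X \<Longrightarrow> t \<in> {0..1} \<Longrightarrow> f (e j x, t) = f (x, t)"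
  and admissible_vanish:
  "admissible z J K f \<Longrightarrow> k \<in> K \<Longrightarrow> e k x = x \<Longrightarrow> x \<in> topspace X \<Longrightarrow> t \<in> {0..1} \<Longrightarrow> f (x, t) = z"
  unfolding admissible_def by blast+

text \<open>At time 0, \<open>compress i\<close> turns \<open>H\<close> into the inverse of \<open>H \<circ> e i\<close> followed by \<open>H\<close>. On the image of
  \<open>e i\<close> this is a path followed back and forth; once \<open>D i\<close> has pushed a neighbourhood into that
  image, the second half of the homotopy retracts the path to its endpoint there.\<close>

definition compress :: "nat \<Rightarrow> real \<Rightarrow> ('x \<times> real \<Rightarrow> 'z) \<Rightarrow> 'x \<times> real \<Rightarrow> 'z" where
  "compress i \<tau> H = (\<lambda>(x, t).
     let y = D i (min 1 (2 * \<tau>), x); \<sigma> = max 0 (2 * \<tau> - 1) * max 0 (1 - v i x)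
     in if t \<le> 1/2 then H (e i y, max \<sigma> (1 - 2 * t)) else H (y, max \<sigma> (2 * t - 1)))"

lemma cutoff_unit:
  assumes "i < n" "x \<in> topspace X" "\<tau> \<in> {0..1}"
  shows "max 0 (2 * \<tau> - 1) * max 0 (1 - v i x) \<in> {0..1}"
proof -
  have "0 \<le> max 0 (2 * \<tau> - 1)" "max 0 (2 * \<tau> - 1) \<le> 1" "0 \<le> max 0 (1 - v i x)" "max 0 (1 - v i x) \<le> 1"
    using assms v_nonneg [of i x] by auto
  then show ?thesis by (auto intro: mult_le_one)
qed

text \<open>A nonzero cutoff means that the deformation has already run to its end and that
  \<open>x\<close> started in the region pushed into the image of \<open>e i\<close>. The two halves
  of \<open>compress\<close> then evaluate the loop at the same point.\<close>

lemma cutoff_pos_fixed: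
  assumes "i < n" "x \<in> topspace X" "max 0 (2 * \<tau> - 1) * max 0 (1 - v i x) \<noteq> 0"
  shows "e i (D i (min 1 (2 * \<tau>), x)) = D i (min 1 (2 * \<tau>), x)"
proof -
  have "v i x < 1" "min 1 (2 * \<tau>) = 1" using assms by (auto simp: max_def min_def split: if_splits)
  then show ?thesis using D_1 assms by simp
qed

text \<open>The extra parameter \<open>s\<close> lets one statement serve twice: for the homotopy in
  \<open>\<tau>\<close> and for the compression of a given homotopy at
  \<open>\<tau> = 1\<close>.\<close>

lemma continuous_map_compress:
  fixes H :: "real \<times> 'x \<times> real \<Rightarrow> 'z"
  assumes i: "i < n" and H: "continuous_map (prod_topology II (prod_topology X II)) Z H"
    and ends: "\<And>s x. s \<in> {0..1} \<Longrightarrow> x \<in> topspace X \<Longrightarrow> H (s, x, 0) = z"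
  shows "continuous_map (prod_topology II (prod_topology II (prod_topology X II))) Z
    (\<lambda>(\<tau>, s, y). compress i \<tau> (\<lambda>y. H (s, y)) y)"
proof -
  let ?P = "prod_topology II (prod_topology II (prod_topology X II))"
  define y where "y = (\<lambda>w::real \<times> real \<times> 'x \<times> real. D i (min 1 (2 * fst w), fst (snd (snd w))))"
  define \<sigma> where "\<sigma> = (\<lambda>w::real \<times> real \<times> 'x \<times> real. max 0 (2 * fst w - 1) * max 0 (1 - v i (fst (snd (snd w)))))"
  have eq: "(\<lambda>(\<tau>, s, y). compress i \<tau> (\<lambda>y. H (s, y)) y) =
     (\<lambda>w. if snd (snd (snd w)) \<le> 1/2 then H (fst (snd w), e i (y w), max (\<sigma> w) (1 - 2 * snd (snd (snd w))))
        else H (fst (snd w), y w, max (\<sigma> w) (2 * snd (snd (snd w)) - 1)))"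
    by (auto simp: fun_eq_iff compress_def y_def \<sigma>_def Let_def)
  have px: "continuous_map ?P X (\<lambda>w. fst (snd (snd w)))" and pt: "continuous_map ?P II (\<lambda>w. snd (snd (snd w)))"
    using continuous_map_comp [OF continuous_map_projections(3) continuous_map_projections(2)]
      continuous_map_comp [OF continuous_map_projections(4) continuous_map_projections(2)] by auto
  have p\<tau>: "continuous_map ?P euclideanreal (\<lambda>w. fst w)"
    by (rule continuous_map_II_euclidean [OF continuous_map_projections(1)])
  have ptR: "continuous_map ?P euclideanreal (\<lambda>w. snd (snd (snd w)))"
    by (rule continuous_map_II_euclidean [OF pt])
  have yc: "continuous_map ?P X y"
    unfolding y_def
    by (rule continuous_map_comp [OF D_cont [OF i]], intro continuous_map_pairedI px continuous_map_II
        continuous_map_real_min continuous_map_real_mult p\<tau>) auto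
  have ec: "continuous_map ?P X (\<lambda>w. e i (y w))"
    by (rule continuous_map_comp [OF e_cont [OF i] yc])
  have \<sigma>c: "continuous_map ?P euclideanreal \<sigma>"
    unfolding \<sigma>_def
    by (intro continuous_map_real_mult continuous_map_real_max continuous_map_diff p\<tau>
        continuous_map_comp [OF v_cont [OF i] px]) auto
  have \<sigma>u: "\<sigma> w \<in> {0..1}" if "w \<in> topspace ?P" for w
    using cutoff_unit [OF i, of "fst (snd (snd w))" "fst w"] that by (auto simp: \<sigma>_def)
  have tu: "snd (snd (snd w)) \<in> {0..1}" if "w \<in> topspace ?P" for w
    using that by auto
  let ?L = "subtopology ?P {w \<in> topspace ?P. snd (snd (snd w)) \<le> 1/2}"
  let ?R = "subtopology ?P {w \<in> topspace ?P. 1/2 \<le> snd (snd (snd w))}"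
  have L: "continuous_map ?L II (\<lambda>w. max (\<sigma> w) (1 - 2 * snd (snd (snd w))))"
  proof (rule continuous_map_II)
    show "continuous_map ?L euclideanreal (\<lambda>w. max (\<sigma> w) (1 - 2 * snd (snd (snd w))))"
      by (intro continuous_map_from_subtopology continuous_map_real_max \<sigma>c continuous_map_diff
          continuous_map_real_mult ptR) auto
    show "0 \<le> max (\<sigma> w) (1 - 2 * snd (snd (snd w))) \<and> max (\<sigma> w) (1 - 2 * snd (snd (snd w))) \<le> 1"
      if "w \<in> topspace ?L" for w
    proof -
      have "w \<in> topspace ?P" using that unfolding topspace_subtopology by blast
      from \<sigma>u [OF this] tu [OF this] show ?thesis by (simp add: max_def)
    qed
  qed
  have R: "continuous_map ?R II (\<lambda>w. max (\<sigma> w) (2 * snd (snd (snd w)) - 1))"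
  proof (rule continuous_map_II)
    show "continuous_map ?R euclideanreal (\<lambda>w. max (\<sigma> w) (2 * snd (snd (snd w)) - 1))"
      by (intro continuous_map_from_subtopology continuous_map_real_max \<sigma>c continuous_map_diff
          continuous_map_real_mult ptR) auto
    show "0 \<le> max (\<sigma> w) (2 * snd (snd (snd w)) - 1) \<and> max (\<sigma> w) (2 * snd (snd (snd w)) - 1) \<le> 1"
      if "w \<in> topspace ?R" for w
    proof -
      have "w \<in> topspace ?P" using that unfolding topspace_subtopology by blast
      from \<sigma>u [OF this] tu [OF this] show ?thesis by (simp add: max_def)
    qed
  qed
  have ps: "continuous_map ?P II (\<lambda>w. fst (snd w))" by (rule continuous_map_projections)
  show ?thesis
    unfolding eq
  proof (rule continuous_map_II_split [OF ptR])
    show "continuous_map ?L Z (\<lambda>w. H (fst (snd w), e i (y w), max (\<sigma> w) (1 - 2 * snd (snd (snd w)))))"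
      by (rule continuous_map_comp [OF H])
         (intro continuous_map_pairedI L continuous_map_from_subtopology [OF ec] continuous_map_from_subtopology [OF ps])
    show "continuous_map ?R Z (\<lambda>w. H (fst (snd w), y w, max (\<sigma> w) (2 * snd (snd (snd w)) - 1)))"
      by (rule continuous_map_comp [OF H])
         (intro continuous_map_pairedI R continuous_map_from_subtopology [OF yc] continuous_map_from_subtopology [OF ps])
    fix w assume w: "w \<in> topspace ?P" "snd (snd (snd w)) = 1/2"
    have yX: "y w \<in> topspace X" "e i (y w) \<in> topspace X"
      using yc ec w(1) by (auto simp: continuous_map_def Pi_iff)
    have sI: "fst (snd w) \<in> {0..1}" using w(1) by auto
    have t: "1 - 2 * snd (snd (snd w)) = 0" "2 * snd (snd (snd w)) - 1 = 0"
      using w(2) by simp_all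
    show "H (fst (snd w), e i (y w), max (\<sigma> w) (1 - 2 * snd (snd (snd w)))) =
          H (fst (snd w), y w, max (\<sigma> w) (2 * snd (snd (snd w)) - 1))"
    \<comment> \<open>At \<open>t = 1/2\<close> the halves agree for one of two reasons: both take
      the initial value \<open>z\<close> of a loop, or \<open>e i\<close> fixes the point
      already.\<close>
    proof (cases "\<sigma> w = 0")
      case True
      then show ?thesis unfolding t using ends [OF sI] yX by simp
    next
      case False
      then have "e i (y w) = y w"
        using cutoff_pos_fixed [OF i, of "fst (snd (snd w))" "fst w"] w(1) by (auto simp: \<sigma>_def y_def)
      then show ?thesis unfolding t by simp
    qed
  qed
qed

text \<open>\<open>compress i\<close> is built from \<open>e i\<close>, \<open>D i\<close> and
  \<open>v i\<close>, which are compatible with every \<open>e j\<close> for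
  \<open>j \<noteq> i\<close>; hence \<open>i\<close> must not lie in \<open>J\<close>. Vanishing
  only needs points fixed by \<open>e k\<close> to stay fixed, and this holds for
  \<open>k = i\<close> too.\<close>

lemma admissible_compress:
  assumes i: "i < n" and J: "J \<subseteq> {..<n} - {i}" and K: "K \<subseteq> {..<n}" and \<tau>: "\<tau> \<in> {0..1}"
    and H: "admissible z J K H"
  shows "admissible z J K (compress i \<tau> H)"
  unfolding admissible_def
proof (intro ballI conjI impI)
  fix x assume x: "x \<in> topspace X"
  define s where "s = min 1 (2 * \<tau>)"
  have s: "s \<in> {0..1}" using \<tau> by (auto simp: s_def)
  define \<sigma> where "\<sigma> = max 0 (2 * \<tau> - 1) * max 0 (1 - v i x)"
  have \<sigma>: "\<sigma> \<in> {0..1}" unfolding \<sigma>_def by (rule cutoff_unit [OF i x \<tau>])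
  have y: "D i (s, x) \<in> topspace X" "e i (D i (s, x)) \<in> topspace X" using i x s by auto
  note H' = H [unfolded admissible_def, rule_format]
  have c: "compress i \<tau> H (x, t) = (if t \<le> 1/2 then H (e i (D i (s, x)), max \<sigma> (1 - 2 * t)) else H (D i (s, x), max \<sigma> (2 * t - 1)))" for t
    by (simp add: compress_def s_def \<sigma>_def)
  show "compress i \<tau> H (x, 0) = z" "compress i \<tau> H (x, 1) = z"
    unfolding c using \<sigma> H' y by (auto simp: max_def)
  fix t :: real assume t: "t \<in> {0..1}"
  have m: "t \<le> 1/2 \<Longrightarrow> max \<sigma> (1 - 2 * t) \<in> {0..1}" "\<not> t \<le> 1/2 \<Longrightarrow> max \<sigma> (2 * t - 1) \<in> {0..1}"
    using \<sigma> t by auto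
  \<comment> \<open>The deformation never leaves the fixed point set of \<open>e k\<close>: for
    \<open>k \<noteq> i\<close> by commutation, for \<open>k = i\<close> because it is stationary
    there.\<close>
  have fixed: "e k (D i (s, x)) = D i (s, x) \<and> e k (e i (D i (s, x))) = e i (D i (s, x))" if "k < n" "e k x = x" for k
  proof -
    have *: "e k (D i (s, x)) = D i (s, x)"
    proof (cases "k = i")
      case True then show ?thesis using D_e_self [OF i x s] that by simp
    next
      case False then show ?thesis using D_e [OF i that(1) _ x s] that by simp
    qed
    moreover have "e k (e i (D i (s, x))) = e i (D i (s, x))"
      using e_comm [OF that(1) i y(1)] * by simp
    ultimately show ?thesis by simp
  qed
  show "compress i \<tau> H (x, t) = z" if a: "\<forall>i<n. e i x = x"
    using admissible_base [OF H y(1)] admissible_base [OF H y(2)] fixed a m by (simp add: c)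
  show "compress i \<tau> H (e j x, t) = compress i \<tau> H (x, t)" if j: "j \<in> J" for j
  proof -
    have jn: "j < n" "i \<noteq> j" using J j by auto
    have 1: "D i (s, e j x) = e j (D i (s, x))" "v i (e j x) = v i x"
      using D_e [OF i jn x s] v_e [OF i jn x] by auto
    have 2: "e i (e j (D i (s, x))) = e j (e i (D i (s, x)))"
      by (rule e_comm [OF i jn(1) y(1)])
    have 3: "compress i \<tau> H (e j x, t) = (if t \<le> 1/2 then H (e j (e i (D i (s, x))), max \<sigma> (1 - 2 * t))
        else H (e j (D i (s, x)), max \<sigma> (2 * t - 1)))"
      by (simp add: compress_def 1 2 flip: s_def \<sigma>_def)
    show ?thesis
      unfolding 3 c using admissible_invariant [OF H j y(1) m(2)] admissible_invariant [OF H j y(2) m(1)] by auto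
  qed
  show "compress i \<tau> H (x, t) = z" if k: "k \<in> K" "e k x = x" for k
  proof -
    have "e k (D i (s, x)) = D i (s, x)" "e k (e i (D i (s, x))) = e i (D i (s, x))"
      using K fixed k by blast+
    then show ?thesis
      unfolding c using admissible_vanish [OF H k(1) _ y(1) m(2)] admissible_vanish [OF H k(1) _ y(2) m(1)] by auto
  qed
qed

text \<open>On the image of \<open>e i\<close> the height \<open>v i\<close> is 0, so at
  \<open>\<tau> = 1\<close> the cutoff is 1 and the loop is only evaluated at its endpoint.\<close>

lemma admissible_compress_1:
  assumes i: "i < n" and J: "J \<subseteq> {..<n} - {i}" and K: "K \<subseteq> {..<n}"
    and H: "admissible z J K H"
  shows "admissible z J (insert i K) (compress i 1 H)"
proof -
  have "compress i 1 H (x, t) = z" if x: "x \<in> topspace X" and t: "t \<in> {0..1}" and ex: "e i x = x" for x t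
  proof -
    have D: "D i (1, x) = x" and v: "v i x = 0"
      using D_e_self [OF i x, of 1] v_e_self [OF i x] ex by auto
    have "max 1 (1 - 2 * t) = 1" "max 1 (2 * t - 1) = 1" using t by auto
    then show ?thesis
      using H x by (simp add: compress_def D v ex admissible_def)
  qed
  with admissible_compress [OF i J K _ H, of 1] show ?thesis
    unfolding admissible_def by auto
qed

lemma compress_0:
  assumes i: "i < n" and H: "admissible z J K H" and x: "x \<in> topspace X" "t \<in> {0..1}"
  shows "compress i 0 H (x, t) = loop_join (rev_loop (\<lambda>(x, t). H (e i x, t))) H (x, t)"
  using D_0 [OF i x(1)] x by (simp add: compress_def loop_join_def rev_loop_def)

text \<open>Idempotency gives the new invariance under \<open>e i\<close>; the old conditions
  survive because the idempotents commute.\<close>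

lemma admissible_retract:
  assumes i: "i < n" and J: "J \<subseteq> {..<n}" and K: "K \<subseteq> {..<n}" and f: "admissible z J K f"
  shows "admissible z (insert i J) K (\<lambda>(x, t). f (e i x, t))"
  unfolding admissible_def
proof (intro ballI conjI impI)
  fix x assume x: "x \<in> topspace X"
  note f' = f [unfolded admissible_def, rule_format]
  have ex: "e i x \<in> topspace X" using x i by simp
  have c: "e k (e i x) = e i (e k x)" if "k < n" for k
    using e_comm [OF that i x] .
  have cJ: "e k (e i x) = e i (e k x)" if "k \<in> J \<or> k \<in> K" for k
    using that J K c by blast
  show "(\<lambda>(x, t). f (e i x, t)) (x, 0) = z" "(\<lambda>(x, t). f (e i x, t)) (x, 1) = z"
    using f' ex by auto
  fix t :: real assume t: "t \<in> {0..1}"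
  show "(\<lambda>(x, t). f (e i x, t)) (x, t) = z" if "\<forall>i<n. e i x = x"
    using admissible_base [OF f ex t] that c by simp
  show "(\<lambda>(x, t). f (e i x, t)) (e j x, t) = (\<lambda>(x, t). f (e i x, t)) (x, t)" if "j \<in> insert i J" for j
  proof (cases "j = i")
    case True then show ?thesis using e_idem [OF i x] by simp
  next
    case False then have "j \<in> J" using that by simp
    then show ?thesis using admissible_invariant [OF f _ ex t, of j] cJ [of j] by simp
  qed
  show "(\<lambda>(x, t). f (e i x, t)) (x, t) = z" if "k \<in> K" "e k x = x" for k
    using admissible_vanish [OF f that(1) _ ex t] cJ [of k] that by simp
qed

lemma continuous_map_retract:
  assumes i: "i < n" and f: "continuous_map (prod_topology X II) Z f"
  shows "continuous_map (prod_topology X II) Z (\<lambda>(x, t). f (e i x, t))"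
proof -
  have "continuous_map (prod_topology X II) Z (\<lambda>y. f (e i (fst y), snd y))"
    by (intro continuous_map_reparam [OF f] continuous_map_comp [OF e_cont [OF i]] continuous_map_projections)
  then show ?thesis by (simp add: case_prod_unfold)
qed

lemma compress_homotopic:
  assumes i: "i < n" and J: "J \<subseteq> {..<n} - {i}" and K: "K \<subseteq> {..<n}"
    and c: "continuous_map (prod_topology X II) Z f" and a: "admissible z J K f"
  shows "loop_homotopic Z z J K (loop_join (rev_loop (\<lambda>(x, t). f (e i x, t))) f) (compress i 1 f)"
proof (rule loop_homotopicI [where h = "\<lambda>w. compress i (fst w) f (snd w)"])
  define F where "F = (\<lambda>w::real \<times> 'x \<times> real. f (snd w))"
  have F: "continuous_map (prod_topology II (prod_topology X II)) Z F"
    unfolding F_def by (rule continuous_map_comp [OF c continuous_map_projections(2)])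
  have 1: "continuous_map (prod_topology II (prod_topology II (prod_topology X II))) Z
     (\<lambda>(\<tau>, s, y). compress i \<tau> (\<lambda>y. F (s, y)) y)"
    by (rule continuous_map_compress [OF i F, where z = z]) (simp add: F_def admissible_ends(1) [OF a])
  \<comment> \<open>The loop is the same at every \<open>s\<close>, so \<open>s\<close> is frozen at
    0 and only \<open>\<tau>\<close> moves.\<close>
  have 2: "continuous_map (prod_topology II (prod_topology X II)) (prod_topology II (prod_topology II (prod_topology X II)))
      (\<lambda>w. (fst w, 0, snd w))"
    by (intro continuous_map_pairedI continuous_map_projections) auto
  show "continuous_map (prod_topology II (prod_topology X II)) Z (\<lambda>w. compress i (fst w) f (snd w))"
    using continuous_map_comp [OF 1 2] by (simp add: F_def)
  show "J \<subseteq> {..<n}" using J by auto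
  show "compress i (fst (0, x, t)) f (snd (0, x, t)) = loop_join (rev_loop (\<lambda>(x, t). f (e i x, t))) f (x, t)"
    if "x \<in> topspace X" "t \<in> {0..1}" for x t
    using compress_0 [OF i a that] by simp
  show "admissible z J K (\<lambda>x. compress i (fst (s, x)) f (snd (s, x)))" if "s \<in> {0..1}" for s
    using admissible_compress [OF i J K that a] by simp
  show "compress i (fst (1, x, t)) f (snd (1, x, t)) = compress i 1 f (x, t)" for x t
    unfolding fst_conv snd_conv by (rule refl)
qed

text \<open>Compressing every stage of a homotopy moves all of it from the class of \<open>K\<close>
  into the smaller class of \<open>insert i K\<close>.\<close>

lemma homotopic_compress:
  assumes i: "i < n" and J: "J \<subseteq> {..<n} - {i}" and K: "K \<subseteq> {..<n}"
    and h: "loop_homotopic Z z J K f g"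
  shows "loop_homotopic Z z J (insert i K) (compress i 1 f) (compress i 1 g)"
proof -
  obtain h where h: "continuous_map (prod_topology II (prod_topology X II)) Z h"
     "\<And>x. h (0, x) = f x" "\<And>x. h (1, x) = g x" "\<And>s. s \<in> {0..1} \<Longrightarrow> admissible z J K (\<lambda>x. h (s, x))"
    using h unfolding homotopic_with_def by auto
  have 1: "continuous_map (prod_topology II (prod_topology II (prod_topology X II))) Z
     (\<lambda>(\<tau>, s, y). compress i \<tau> (\<lambda>y. h (s, y)) y)"
    by (rule continuous_map_compress [OF i h(1), where z = z]) (rule admissible_ends(1) [OF h(4)])
  have 2: "continuous_map (prod_topology II (prod_topology X II)) (prod_topology II (prod_topology II (prod_topology X II)))
      (\<lambda>w. (1, fst w, snd w))"
    by (intro continuous_map_pairedI continuous_map_projections) auto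
  show ?thesis
  proof (rule loop_homotopicI [where h = "\<lambda>w. compress i 1 (\<lambda>y. h (fst w, y)) (snd w)"])
    show "continuous_map (prod_topology II (prod_topology X II)) Z (\<lambda>w. compress i 1 (\<lambda>y. h (fst w, y)) (snd w))"
      using continuous_map_comp [OF 1 2] by (simp add: case_prod_unfold)
    show "J \<subseteq> {..<n}" using J by auto
    show "admissible z J (insert i K) (\<lambda>x. compress i 1 (\<lambda>y. h (fst (s, x), y)) (snd (s, x)))" if "s \<in> {0..1}" for s
      using admissible_compress_1 [OF i J K h(4) [OF that]] by simp
  qed (simp_all add: h(2,3))
qed

lemma loop_homotopic_mono:
  assumes "loop_homotopic Z z J K f g" "J' \<subseteq> J" "K' \<subseteq> K"
  shows "loop_homotopic Z z J' K' f g"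
  by (rule homotopic_with_mono [OF assms(1)]) (rule admissible_mono [OF _ assms(2,3)])

text \<open>Insert \<open>f \<circ> e i\<close> and its inverse in front of \<open>f\<close>, then
  replace the inverse followed by \<open>f\<close> by \<open>compress i 1 f\<close>. One factor is
  invariant under \<open>e i\<close>, the other is trivial on the image of
  \<open>e i\<close>.\<close>

lemma split_loop:
  assumes i: "i < n" and J: "J \<subseteq> {..<n} - {i}" and K: "K \<subseteq> {..<n}"
    and c: "continuous_map (prod_topology X II) Z f" and a: "admissible z J K f"
  shows "loop_homotopic Z z J K f (loop_join (\<lambda>(x, t). f (e i x, t)) (compress i 1 f))"
proof -
  let ?r = "\<lambda>(x, t). f (e i x, t)"
  have J': "J \<subseteq> {..<n}" using J by auto
  have rc: "continuous_map (prod_topology X II) Z ?r" by (rule continuous_map_retract [OF i c])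
  have ra: "admissible z J K ?r" by (rule admissible_mono [OF admissible_retract [OF i J' K a]]) auto
  have "loop_homotopic Z z J K (loop_join (rev_loop (rev_loop ?r)) (loop_join (rev_loop ?r) f)) f"
    by (intro loop_homotopic_cancel J' continuous_map_rev_loop rc c admissible_rev_loop ra a)
  then have 1: "loop_homotopic Z z J K f (loop_join ?r (loop_join (rev_loop ?r) f))"
    by (simp add: homotopic_with_symD)
  have "loop_homotopic Z z J K (loop_join ?r (loop_join (rev_loop ?r) f)) (loop_join ?r (compress i 1 f))"
    by (rule loop_homotopic_join [OF J' _ compress_homotopic [OF i J K c a]]) (simp add: rc ra)
  then show ?thesis by (rule homotopic_with_trans [OF 1])
qed

text \<open>A homotopy between two loops that are trivial on the image of \<open>e i\<close> may
  leave this class on the way. Compressing it repairs the intermediate stages, and on such loops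
  \<open>compress i 1\<close> is homotopic to the identity within the class.\<close>

lemma loop_homotopic_insert:
  assumes i: "i < n" and J: "J \<subseteq> {..<n} - {i}" and K: "K \<subseteq> {..<n}"
    and a: "admissible z J (insert i K) f" "admissible z J (insert i K) g"
    and h: "loop_homotopic Z z J K f g"
  shows "loop_homotopic Z z J (insert i K) f g"
proof -
  have J': "J \<subseteq> {..<n}" and K': "insert i K \<subseteq> {..<n}" using J K i by auto
  have *: "loop_homotopic Z z J (insert i K) f (compress i 1 f)"
    if c: "continuous_map (prod_topology X II) Z f" and a: "admissible z J (insert i K) f" for f
  proof -
    let ?r = "\<lambda>(x, t). f (e i x, t)"
    \<comment> \<open>Since \<open>f\<close> is trivial on the image of \<open>e i\<close>, the
      inverse of \<open>f \<circ> e i\<close> followed by \<open>f\<close> is just \<open>f\<close>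
      after a waiting time.\<close>
    have rz: "?r (x, t) = z" if "x \<in> topspace X" "t \<in> {0..1}" for x t
      using a that e_idem [OF i that(1)] i by (auto simp: admissible_def)
    have ra: "admissible z J (insert i K) ?r"
      using admissible_cong [OF J', of ?r "\<lambda>_. z"] rz admissible_const by force
    have "loop_homotopic Z z J (insert i K) (loop_join (\<lambda>_. z) f) (loop_join (rev_loop ?r) f)"
    proof (rule homotopic_with_equal)
      show "admissible z J (insert i K) (loop_join (\<lambda>_. z) f)"
        "admissible z J (insert i K) (loop_join (rev_loop ?r) f)"
        by (intro admissible_join admissible_const admissible_rev_loop ra a)+
      show "continuous_map (prod_topology X II) Z (loop_join (\<lambda>_. z) f)"
        by (rule loop_homotopicD(1) [OF loop_homotopic_const_join [OF J' c a]])
      show "loop_join (\<lambda>_. z) f y = loop_join (rev_loop ?r) f y" if "y \<in> topspace (prod_topology X II)" for y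
        using that rz by (cases y) (auto simp: loop_join_def rev_loop_def)
    qed
    then show ?thesis
      by (rule homotopic_with_trans [OF homotopic_with_symD [OF loop_homotopic_const_join [OF J' c a]]
        homotopic_with_trans [OF _ compress_homotopic [OF i J K' c a]]])
  qed
  show ?thesis
    by (rule homotopic_with_trans [OF * [OF loop_homotopicD(1) [OF h] a(1)]
        homotopic_with_trans [OF homotopic_compress [OF i J K h]
          homotopic_with_symD [OF * [OF loop_homotopicD(2) [OF h] a(2)]]]])
qed

text \<open>Precomposition with \<open>e i\<close> makes \<open>b\<close> constant and leaves
  \<open>a\<close> unchanged, so it recovers \<open>a\<close> from the concatenation. Cancelling
  \<open>a\<close> on the left then recovers \<open>b\<close>, at first only in the class of
  \<open>K\<close>; \<open>loop_homotopic_insert\<close> improves this to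
  \<open>insert i K\<close>.\<close>

lemma loop_join_injective:
  assumes i: "i < n" and J: "J \<subseteq> {..<n} - {i}" and K: "K \<subseteq> {..<n}"
    and c: "continuous_map (prod_topology X II) Z b" "continuous_map (prod_topology X II) Z b'"
    and a: "admissible z (insert i J) K a" "admissible z (insert i J) K a'"
      "admissible z J (insert i K) b" "admissible z J (insert i K) b'"
    and h: "loop_homotopic Z z J K (loop_join a b) (loop_join a' b')"
    and ca: "continuous_map (prod_topology X II) Z a" "continuous_map (prod_topology X II) Z a'"
  shows "loop_homotopic Z z (insert i J) K a a'" "loop_homotopic Z z J (insert i K) b b'"
proof -
  have J': "J \<subseteq> {..<n}" "insert i J \<subseteq> {..<n}" using J i by auto
  have weak: "admissible z J K a" "admissible z J K a'" "admissible z J K b" "admissible z J K b'"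
    by (auto intro: admissible_mono [OF a(1)] admissible_mono [OF a(2)] admissible_mono [OF a(3)] admissible_mono [OF a(4)])
  have bz: "b (e i x, t) = z" "b' (e i x, t) = z" if "x \<in> topspace X" "t \<in> {0..1}" for x t
    using a(3,4) that e_idem [OF i that(1)] i by (auto simp: admissible_def)
  let ?R = "\<lambda>f. f \<circ> (\<lambda>(x, t). (e i x, t))"
  have 1: "loop_homotopic Z z (insert i J) K (?R (loop_join a b)) (?R (loop_join a' b'))"
  proof (rule homotopic_with_compose_continuous_map_right [OF h])
    show "continuous_map (prod_topology X II) (prod_topology X II) (\<lambda>(x, t). (e i x, t))"
      using continuous_map_retract [OF i continuous_map_id] by (simp add: id_def)
    show "admissible z (insert i J) K (?R f)" if "admissible z J K f" for f
      using admissible_retract [OF i J'(1) K that] by (simp add: o_def case_prod_unfold)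
  qed
  \<comment> \<open>After composition with \<open>e i\<close> the loop is \<open>f\<close> at double
    speed followed by rest.\<close>
  have 2: "loop_homotopic Z z (insert i J) K (?R (loop_join f g)) f"
    if f: "admissible z (insert i J) K f" "continuous_map (prod_topology X II) Z f"
      and g: "\<And>x t. x \<in> topspace X \<Longrightarrow> t \<in> {0..1} \<Longrightarrow> g (e i x, t) = z"
      and p: "admissible z (insert i J) K (?R (loop_join f g))"
      and pc: "continuous_map (prod_topology X II) Z (?R (loop_join f g))" for f g
  proof -
    let ?p = "\<lambda>t::real. min 1 (2 * t)"
    have p: "continuous_on {0..1} ?p" "?p ` {0..1} \<subseteq> {0..1}"
      by (intro continuous_intros) auto
    have r: "loop_homotopic Z z (insert i J) K (\<lambda>(x, t). f (x, ?p t)) (\<lambda>(x, t). f (x, t))"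
      by (rule loop_homotopic_reparam [OF J'(2) f(2,1) p]) auto
    have "loop_homotopic Z z (insert i J) K (?R (loop_join f g)) (\<lambda>(x, t). f (x, ?p t))"
    proof (rule homotopic_with_equal)
      show "admissible z (insert i J) K (\<lambda>(x, t). f (x, ?p t))" using loop_homotopicD [OF r] by simp
      show "?R (loop_join f g) y = (case y of (x, t) \<Rightarrow> f (x, ?p t))" if yP: "y \<in> topspace (prod_topology X II)" for y
      proof -
        obtain x t where y: "y = (x, t)" "x \<in> topspace X" "t \<in> {0..1}" using yP by auto
        have "f (e i x, 2 * t) = f (x, 2 * t)" if "t \<le> 1/2"
          using f(1) y that by (auto simp: admissible_def)
        moreover have "f (x, 1) = z" using f(1) y by (auto simp: admissible_def)
        ultimately show ?thesis
          using y g [of x "2 * t - 1"] by (cases "t = 1/2") (auto simp: loop_join_def min_def)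
      qed
    qed (use that in auto)
    from homotopic_with_trans [OF this r] show ?thesis unfolding case_prod_eta .
  qed
  show A: "loop_homotopic Z z (insert i J) K a a'"
    by (rule homotopic_with_trans [OF homotopic_with_symD [OF 2 [OF a(1) ca(1) bz(1) loop_homotopicD(3,1) [OF 1]]]
        homotopic_with_trans [OF 1 2 [OF a(2) ca(2) bz(2) loop_homotopicD(4,2) [OF 1]]]])
  have A': "loop_homotopic Z z J K a a'" by (rule loop_homotopic_mono [OF A]) auto
  have 3: "loop_homotopic Z z J K (loop_join (rev_loop a) (loop_join a b)) (loop_join (rev_loop a') (loop_join a' b'))"
    by (rule loop_homotopic_join [OF J'(1) loop_homotopic_rev_loop [OF J'(1) A'] h])
  have "loop_homotopic Z z J K b b'"
    by (rule homotopic_with_trans [OF homotopic_with_symD [OF loop_homotopic_cancel [OF J'(1) ca(1) c(1) weak(1,3)]]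
        homotopic_with_trans [OF 3 loop_homotopic_cancel [OF J'(1) ca(2) c(2) weak(2,4)]]])
  then show "loop_homotopic Z z J (insert i K) b b'"
    by (rule loop_homotopic_insert [OF i J K a(3,4)])
qed

section \<open>Iteration over all coordinates\<close>

text \<open>The concatenation of all \<open>b I\<close> with \<open>K \<subseteq> I \<subseteq> K \<union> {n - m..<n}\<close>.\<close>

fun multi_join :: "nat \<Rightarrow> nat set \<Rightarrow> (nat set \<Rightarrow> 'x \<times> real \<Rightarrow> 'z) \<Rightarrow> 'x \<times> real \<Rightarrow> 'z" where
  "multi_join 0 K b = b K"
| "multi_join (Suc m) K b = loop_join (multi_join m K b) (multi_join m (insert (n - Suc m) K) b)"

lemma multi_join_cong:
  assumes "\<And>I. K \<subseteq> I \<Longrightarrow> I - K \<subseteq> {n - m..<n} \<Longrightarrow> b I = b' I" "m \<le> n"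
  shows "multi_join m K b = multi_join m K b'"
  using assms
proof (induction m arbitrary: K)
  case (Suc m)
  have "b I = b' I" if "K \<subseteq> I" "I - K \<subseteq> {n - m..<n}" for I
    by (rule Suc.prems) (use that Suc.prems(2) in \<open>auto simp: subset_iff\<close>)
  moreover have "b I = b' I" if "insert (n - Suc m) K \<subseteq> I" "I - insert (n - Suc m) K \<subseteq> {n - m..<n}" for I
  proof (rule Suc.prems)
    show "I - K \<subseteq> {n - Suc m..<n}"
      using that Suc.prems(2) by (force simp: subset_iff)
  qed (use that in auto)
  ultimately show ?case
    using Suc.IH [of K] Suc.IH [of "insert (n - Suc m) K"] Suc.prems(2) by simp
qed simp

lemma multi_join_comp: "multi_join m K (\<lambda>I. g \<circ> b I) = g \<circ> multi_join m K b"
  by (induction m arbitrary: K) (auto simp: loop_join_def fun_eq_iff)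

text \<open>Invariant of the recursion: the coordinates below \<open>n - m\<close> are decided,
  those in \<open>K\<close> by vanishing and the others by invariance. At \<open>m = 0\<close> this
  is the class belonging to the subset \<open>K\<close>; at \<open>m = n\<close> and
  \<open>K = {}\<close> it is the class of all pointed loops.\<close>

lemma admissible_multi_join:
  assumes "\<And>I. K \<subseteq> I \<Longrightarrow> I - K \<subseteq> {n - m..<n} \<Longrightarrow> continuous_map (prod_topology X II) Z (b I) \<and> admissible z ({..<n} - I) I (b I)"
    "m \<le> n" "K \<subseteq> {..<n - m}"
  shows "continuous_map (prod_topology X II) Z (multi_join m K b) \<and> admissible z ({..<n - m} - K) K (multi_join m K b)"
  using assms
proof (induction m arbitrary: K)
  case 0 then show ?case by simp
next
  case (Suc m)
  let ?i = "n - Suc m"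
  have i: "{..<n - m} = insert ?i {..<?i}" using Suc.prems(2) by auto
  have "continuous_map (prod_topology X II) Z (multi_join m K b) \<and> admissible z ({..<n - m} - K) K (multi_join m K b)"
    by (rule Suc.IH [OF Suc.prems(1)]) (use Suc.prems(2,3) i in \<open>auto simp: subset_iff\<close>)
  moreover have "continuous_map (prod_topology X II) Z (multi_join m (insert ?i K) b)
      \<and> admissible z ({..<n - m} - insert ?i K) (insert ?i K) (multi_join m (insert ?i K) b)"
  proof (rule Suc.IH [OF Suc.prems(1)])
    show "insert ?i K \<subseteq> I \<Longrightarrow> I - insert ?i K \<subseteq> {n - m..<n} \<Longrightarrow> I - K \<subseteq> {n - Suc m..<n}" for I
      using Suc.prems(2) by (force simp: subset_iff)
  qed (use Suc.prems(2,3) i in auto)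
  moreover have "admissible z ({..<?i} - K) K f" if "admissible z ({..<n - m} - K) K f" for f
    by (rule admissible_mono [OF that]) (use i in auto)
  moreover have "admissible z ({..<?i} - K) K f" if "admissible z ({..<n - m} - insert ?i K) (insert ?i K) f" for f
    by (rule admissible_mono [OF that]) (use i in auto)
  ultimately show ?case
    by (auto intro: admissible_join continuous_map_join_admissible)
qed

text \<open>Each step applies \<open>split_loop\<close> at the coordinate \<open>n - Suc m\<close>:
  the retracted factor leaves this coordinate out of \<open>K\<close>, the compressed factor puts it
  into \<open>K\<close>.\<close>

lemma multi_join_surjective:
  assumes "continuous_map (prod_topology X II) Z f" "admissible z ({..<n - m} - K) K f" "m \<le> n" "K \<subseteq> {..<n - m}"
  shows "\<exists>b. (\<forall>I. K \<subseteq> I \<longrightarrow> I - K \<subseteq> {n - m..<n} \<longrightarrow> continuous_map (prod_topology X II) Z (b I) \<and> admissible z ({..<n} - I) I (b I))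
     \<and> loop_homotopic Z z ({..<n - m} - K) K f (multi_join m K b)"
  using assms
proof (induction m arbitrary: K f)
  case 0
  then have "loop_homotopic Z z ({..<n} - K) K f f" by simp
  with 0 show ?case by (intro exI [of _ "\<lambda>_. f"]) (auto dest: subset_antisym)
next
  case (Suc m)
  let ?i = "n - Suc m"
  let ?J = "{..<?i} - K" and ?K' = "insert (n - Suc m) K"
  have i: "{..<n - m} = insert ?i {..<?i}" "?i < n" using Suc.prems(3) by auto
  have iK: "?i \<notin> K" using Suc.prems(4) by auto
  have J: "?J \<subseteq> {..<n} - {?i}" "?J \<subseteq> {..<n}" and K: "K \<subseteq> {..<n}" using i Suc.prems(4) by auto
  define a where "a = (\<lambda>(x, t). f (e ?i x, t))"
  define c where "c = compress ?i 1 f"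
  have h: "loop_homotopic Z z ?J K f (loop_join a c)"
    unfolding a_def c_def by (rule split_loop [OF i(2) J(1) K Suc.prems(1,2)])
  have a: "continuous_map (prod_topology X II) Z a" "admissible z ({..<n - m} - K) K a"
  proof -
    show "continuous_map (prod_topology X II) Z a"
      unfolding a_def by (rule continuous_map_retract [OF i(2) Suc.prems(1)])
    have "insert ?i ?J = {..<n - m} - K" using i iK by auto
    then show "admissible z ({..<n - m} - K) K a"
      unfolding a_def using admissible_retract [OF i(2) J(2) K Suc.prems(2)] by simp
  qed
  have c: "continuous_map (prod_topology X II) Z c" "admissible z ({..<n - m} - ?K') ?K' c"
  proof -
    show "continuous_map (prod_topology X II) Z c"
      unfolding c_def by (rule loop_homotopicD(2) [OF compress_homotopic [OF i(2) J(1) K Suc.prems(1,2)]])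
    have "?J = {..<n - m} - ?K'" using i iK by auto
    then show "admissible z ({..<n - m} - ?K') ?K' c"
      unfolding c_def using admissible_compress_1 [OF i(2) J(1) K Suc.prems(2)] by simp
  qed
  obtain b1 where b1: "\<And>I. K \<subseteq> I \<Longrightarrow> I - K \<subseteq> {n - m..<n} \<Longrightarrow> continuous_map (prod_topology X II) Z (b1 I) \<and> admissible z ({..<n} - I) I (b1 I)"
     "loop_homotopic Z z ({..<n - m} - K) K a (multi_join m K b1)"
    using Suc.IH [OF a] Suc.prems(3,4) i by auto
  obtain b2 where b2: "\<And>I. ?K' \<subseteq> I \<Longrightarrow> I - ?K' \<subseteq> {n - m..<n} \<Longrightarrow> continuous_map (prod_topology X II) Z (b2 I) \<and> admissible z ({..<n} - I) I (b2 I)"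
     "loop_homotopic Z z ({..<n - m} - ?K') ?K' c (multi_join m ?K' b2)"
    using Suc.IH [OF c] Suc.prems(3,4) i by auto
  \<comment> \<open>The two recursive families concern disjoint sets of indices, told apart by
    membership of \<open>?i\<close>.\<close>
  define b where "b I = (if ?i \<in> I then b2 I else b1 I)" for I
  have "multi_join m K b = multi_join m K b1"
    by (rule multi_join_cong) (use Suc.prems(3) iK in \<open>auto simp: b_def subset_iff\<close>)
  moreover have "multi_join m ?K' b = multi_join m ?K' b2"
    by (rule multi_join_cong) (use Suc.prems(3) in \<open>auto simp: b_def subset_iff\<close>)
  moreover have "loop_homotopic Z z ?J K a (multi_join m K b1)"
    by (rule loop_homotopic_mono [OF b1(2)]) (use i in auto)
  moreover have "loop_homotopic Z z ?J K c (multi_join m ?K' b2)"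
    by (rule loop_homotopic_mono [OF b2(2)]) (use i iK in auto)
  ultimately have "loop_homotopic Z z ?J K (loop_join a c) (multi_join (Suc m) K b)"
    using loop_homotopic_join [OF J(2)] by simp
  from homotopic_with_trans [OF h this]
  have "loop_homotopic Z z ?J K f (multi_join (Suc m) K b)" .
  moreover have "continuous_map (prod_topology X II) Z (b I) \<and> admissible z ({..<n} - I) I (b I)"
    if "K \<subseteq> I" "I - K \<subseteq> {n - Suc m..<n}" for I
  proof (cases "?i \<in> I")
    case True
    have "I - ?K' \<subseteq> {n - m..<n}"
    proof
      fix x assume "x \<in> I - ?K'"
      then have "n - Suc m \<le> x" "x < n" "x \<noteq> n - Suc m" using that(2) by auto
      then show "x \<in> {n - m..<n}" by auto
    qed
    with b2(1) [of I] True that show ?thesis by (simp add: b_def)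
  next
    case False
    have "I - K \<subseteq> {n - m..<n}"
    proof
      fix x assume "x \<in> I - K"
      then have "n - Suc m \<le> x" "x < n" "x \<noteq> n - Suc m" using that(2) False by auto
      then show "x \<in> {n - m..<n}" by auto
    qed
    with b1(1) [of I] False that show ?thesis by (simp add: b_def)
  qed
  ultimately show ?case by blast
qed

text \<open>Each use of \<open>loop_join_injective\<close> separates the subsets that contain
  \<open>n - Suc m\<close> from those that do not.\<close>

lemma multi_join_injective:
  assumes "\<And>I. K \<subseteq> I \<Longrightarrow> I - K \<subseteq> {n - m..<n} \<Longrightarrow> continuous_map (prod_topology X II) Z (b I) \<and> admissible z ({..<n} - I) I (b I)"
    "\<And>I. K \<subseteq> I \<Longrightarrow> I - K \<subseteq> {n - m..<n} \<Longrightarrow> continuous_map (prod_topology X II) Z (b' I) \<and> admissible z ({..<n} - I) I (b' I)"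
    "m \<le> n" "K \<subseteq> {..<n - m}"
    and "loop_homotopic Z z ({..<n - m} - K) K (multi_join m K b) (multi_join m K b')"
    and "K \<subseteq> I" "I - K \<subseteq> {n - m..<n}"
  shows "loop_homotopic Z z ({..<n} - I) I (b I) (b' I)"
  using assms
proof (induction m arbitrary: K)
  case 0 then have "I = K" by auto
  with 0 show ?case by simp
next
  case (Suc m)
  let ?i = "n - Suc m"
  let ?J = "{..<?i} - K" and ?K' = "insert (n - Suc m) K"
  have i: "{..<n - m} = insert ?i {..<?i}" "?i < n" using Suc.prems(3) by auto
  have iK: "?i \<notin> K" using Suc.prems(4) by auto
  have J: "?J \<subseteq> {..<n} - {?i}" "?J \<subseteq> {..<n}" and K: "K \<subseteq> {..<n}" using i Suc.prems(4) by auto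
  have J1: "insert ?i ?J = {..<n - m} - K" and J2: "?J = {..<n - m} - ?K'" using i iK by auto
  have s1: "I - K \<subseteq> {n - Suc m..<n}" if "K \<subseteq> I" "I - K \<subseteq> {n - m..<n}" for I
    using that Suc.prems(3) by (auto simp: subset_iff)
  have s2: "K \<subseteq> I" "I - K \<subseteq> {n - Suc m..<n}" if "?K' \<subseteq> I" "I - ?K' \<subseteq> {n - m..<n}" for I
    using that Suc.prems(3) by (force simp: subset_iff)+
  note n1 = Suc.prems(1) [OF _ s1] note n1' = Suc.prems(2) [OF _ s1]
  note n2 = Suc.prems(1) [OF s2] note n2' = Suc.prems(2) [OF s2]
  have KK: "K \<subseteq> {..<n - m}" "?K' \<subseteq> {..<n - m}" and m: "m \<le> n" using i Suc.prems(3,4) by auto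
  note A = admissible_multi_join [OF n1 m KK(1)] and A' = admissible_multi_join [OF n1' m KK(1)]
  note B = admissible_multi_join [OF n2 m KK(2)] and B' = admissible_multi_join [OF n2' m KK(2)]
  have h: "loop_homotopic Z z ({..<n - m} - K) K (multi_join m K b) (multi_join m K b')"
      "loop_homotopic Z z ({..<n - m} - ?K') ?K' (multi_join m ?K' b) (multi_join m ?K' b')"
    using loop_join_injective [OF i(2) J(1) K B [THEN conjunct1] B' [THEN conjunct1]
      A [THEN conjunct2, folded J1] A' [THEN conjunct2, folded J1]
      B [THEN conjunct2, folded J2] B' [THEN conjunct2, folded J2] Suc.prems(5) [unfolded multi_join.simps]
      A [THEN conjunct1] A' [THEN conjunct1]] J1 J2 by auto
  show ?case
  proof (cases "?i \<in> I")
    case True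
    have "I - ?K' \<subseteq> {n - m..<n}"
    proof
      fix x assume "x \<in> I - ?K'"
      then have "n - Suc m \<le> x" "x < n" "x \<noteq> n - Suc m" using Suc.prems(7) by auto
      then show "x \<in> {n - m..<n}" by auto
    qed
    then show ?thesis
      using Suc.IH [OF n2 n2' m KK(2) h(2)] True Suc.prems(6) by auto
  next
    case False
    have "I - K \<subseteq> {n - m..<n}"
    proof
      fix x assume "x \<in> I - K"
      then have "n - Suc m \<le> x" "x < n" "x \<noteq> n - Suc m" using Suc.prems(7) False by auto
      then show "x \<in> {n - m..<n}" by auto
    qed
    then show ?thesis
      using Suc.IH [OF n1 n1' m KK(1) h(1)] Suc.prems(6) by auto
  qed
qed

section \<open>The Yoneda argument\<close>

lemma multi_join_cong_pointwise:
  assumes "\<And>I y. \<lbrakk>K \<subseteq> I; I - K \<subseteq> {n - m..<n}; y \<in> topspace (prod_topology X II)\<rbrakk> \<Longrightarrow> b I y = b' I y"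
    and "m \<le> n" "y \<in> topspace (prod_topology X II)"
  shows "multi_join m K b y = multi_join m K b' y"
  using assms
proof (induction m arbitrary: K y)
  case (Suc m)
  let ?i = "n - Suc m"
  obtain x t where y: "y = (x, t)" "x \<in> topspace X" "t \<in> {0..1}" using Suc.prems(3) by auto
  have 1: "multi_join m K b u = multi_join m K b' u" if u: "u \<in> topspace (prod_topology X II)" for u
  proof (rule Suc.IH [OF Suc.prems(1) _ u])
    show "K \<subseteq> I \<Longrightarrow> I - K \<subseteq> {n - m..<n} \<Longrightarrow> I - K \<subseteq> {n - Suc m..<n}" for I
      using Suc.prems(2) by (auto simp: subset_iff)
  qed (use Suc.prems(2) in auto)
  have 2: "multi_join m (insert ?i K) b u = multi_join m (insert ?i K) b' u" if u: "u \<in> topspace (prod_topology X II)" for u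
  proof (rule Suc.IH [OF Suc.prems(1) _ u])
    show "insert ?i K \<subseteq> I \<Longrightarrow> I - insert ?i K \<subseteq> {n - m..<n} \<Longrightarrow> I - K \<subseteq> {n - Suc m..<n}" for I
      using Suc.prems(2) by (force simp: subset_iff)
  qed (use Suc.prems(2) in auto)
  show ?case
    using 1 [of "(x, 2 * t)"] 2 [of "(x, 2 * t - 1)"] y by (auto simp: loop_join_def)
qed simp

text \<open>The loop \<open>q\<close> is universal among pointed loops on \<open>X\<close>, and the
  family \<open>\<omega>\<close> among families of loops indexed by subsets. \<open>F\<close>
  classifies the join of \<open>\<omega>\<close>, and \<open>g\<close> classifies the components of
  \<open>q\<close>. One composite is homotopic to the identity by surjectivity of
  \<open>multi_join\<close>, the other by injectivity. Lifting is assumed for the two targets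
  separately because a hypothesis cannot range over types.\<close>

theorem suspension_homotopy_equivalent:
  fixes W :: "'w topology"
  assumes base: "x0 \<in> topspace X" "\<And>x. x \<in> topspace X \<Longrightarrow> (\<forall>i<n. e i x = x) \<longleftrightarrow> x = x0"
    and \<omega>: "\<And>I. I \<subseteq> {..<n} \<Longrightarrow> continuous_map (prod_topology X II) W (\<omega> I)"
      "\<And>I. I \<subseteq> {..<n} \<Longrightarrow> admissible w0 ({..<n} - I) I (\<omega> I)"
    and surj: "\<And>w. w \<in> topspace W \<Longrightarrow> \<exists>I\<subseteq>{..<n}. \<exists>y\<in>topspace (prod_topology X II). w = \<omega> I y"
    and lift_W: "\<And>h. \<lbrakk>\<And>I. I \<subseteq> {..<n} \<Longrightarrow> continuous_map (prod_topology II (prod_topology X II)) W (h I);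
        \<And>I s. I \<subseteq> {..<n} \<Longrightarrow> s \<in> {0..1} \<Longrightarrow> admissible w0 ({..<n} - I) I (\<lambda>y. h I (s, y))\<rbrakk>
      \<Longrightarrow> \<exists>g. continuous_map (prod_topology II W) W g \<and>
        (\<forall>I\<subseteq>{..<n}. \<forall>s\<in>{0..1}. \<forall>y\<in>topspace (prod_topology X II). g (s, \<omega> I y) = h I (s, y))"
    and lift_suspension: "\<And>h. \<lbrakk>\<And>I. I \<subseteq> {..<n} \<Longrightarrow> continuous_map (prod_topology II (prod_topology X II)) (fst (suspension (X, x0))) (h I);
        \<And>I s. I \<subseteq> {..<n} \<Longrightarrow> s \<in> {0..1} \<Longrightarrow> admissible (snd (suspension (X, x0))) ({..<n} - I) I (\<lambda>y. h I (s, y))\<rbrakk>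
      \<Longrightarrow> \<exists>g. continuous_map (prod_topology II W) (fst (suspension (X, x0))) g \<and>
        (\<forall>I\<subseteq>{..<n}. \<forall>s\<in>{0..1}. \<forall>y\<in>topspace (prod_topology X II). g (s, \<omega> I y) = h I (s, y))"
  shows "fst (suspension (X, x0)) homotopy_equivalent_space W"
proof -
  let ?P = "prod_topology X II"
  define Y where "Y = fst (suspension (X, x0))"
  define y0 where "y0 = snd (suspension (X, x0))"
  define q where "q = suspension_in (X, x0)"
  have qc: "continuous_map ?P Y q"
    using continuous_map_suspension_in [of "(X, x0)"] by (simp add: Y_def q_def)
  have q0: "q (x, t) = y0" if "x \<in> topspace X" "t \<in> {0..1}" "t \<in> {0, 1} \<or> x = x0" for x t
    unfolding q_def y0_def by (rule suspension_in_base) (use that in auto)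
  have qa: "admissible y0 {} {} q"
    unfolding admissible_def using q0 base(2) by auto
  have qsurj: "\<exists>z\<in>topspace ?P. y = q z" if "y \<in> topspace Y" for y
    using that unfolding Y_def topspace_suspension q_def by auto
  have e0: "e i x0 = x0" if "i < n" for i using base(2) [OF base(1)] that by blast
  have liftY: "\<exists>k. continuous_map (prod_topology II Y) Z k \<and> (\<forall>s\<in>{0..1}. \<forall>y\<in>topspace ?P. k (s, q y) = h (s, y))"
    if hc: "continuous_map (prod_topology II ?P) Z h" and ha: "\<And>s. s \<in> {0..1} \<Longrightarrow> admissible z {} {} (\<lambda>y. h (s, y))" for Z :: "'z topology" and h z
  proof -
    have "continuous_map (prod_topology II (prod_topology (fst (X, x0)) II)) Z h" using hc by simp
    moreover have "h (s, x, t) = z" if "s \<in> topspace II" "x \<in> topspace (fst (X, x0))" "t \<in> {0..1}" "t \<in> {0, 1} \<or> x = snd (X, x0)" for s x t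
    proof -
      have a: "admissible z {} {} (\<lambda>y. h (s, y))" using ha that by simp
      show ?thesis
      proof (cases "t \<in> {0, 1}")
        case True then show ?thesis using admissible_ends [OF a] that(2) by auto
      next
        case False
        then have "x = x0" using that(4) by simp
        then show ?thesis using admissible_base [OF a base(1) that(3)] e0 by simp
      qed
    qed
    ultimately obtain k where "continuous_map (prod_topology II (fst (suspension (X, x0)))) Z k"
      "\<And>s x t. s \<in> topspace II \<Longrightarrow> x \<in> topspace (fst (X, x0)) \<Longrightarrow> t \<in> {0..1} \<Longrightarrow> k (s, suspension_in (X, x0) (x, t)) = h (s, x, t)"
      using suspension_lift [OF locally_compact_II] by metis
    then show ?thesis by (intro exI [of _ k]) (auto simp: Y_def q_def)
  qed
  \<comment> \<open>The components of the tautological loop \<open>q\<close>, which stands for the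
    identity of the suspension.\<close>
  obtain b where b: "\<And>I. I \<subseteq> {..<n} \<Longrightarrow> continuous_map ?P Y (b I)"
      "\<And>I. I \<subseteq> {..<n} \<Longrightarrow> admissible y0 ({..<n} - I) I (b I)"
    and qb: "loop_homotopic Y y0 {} {} q (multi_join n {} b)"
    using multi_join_surjective [OF qc, of y0 n "{}"] qa by (auto simp: lessThan_atLeast0)
  define f where "f = multi_join n {} \<omega>"
  have f: "continuous_map ?P W f" "admissible w0 {} {} f"
    using admissible_multi_join [of "{}" n W \<omega> w0] \<omega> unfolding f_def by (auto simp: lessThan_atLeast0)
  \<comment> \<open>\<open>liftY\<close> is about homotopies: a single map is lifted as a constant
    homotopy and read off at time 0.\<close>
  have "continuous_map (prod_topology II ?P) W (\<lambda>w. f (snd w))"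
    by (rule continuous_map_comp [OF f(1) continuous_map_snd])
  from liftY [OF this, of w0] f(2) obtain F' where F': "continuous_map (prod_topology II Y) W F'"
    "\<And>s y. s \<in> {0..1} \<Longrightarrow> y \<in> topspace ?P \<Longrightarrow> F' (s, q y) = f y" by force
  define F where "F y = F' (0, y)" for y
  have Fc: "continuous_map Y W F"
    unfolding F_def by (rule continuous_map_comp [OF F'(1)]) (intro continuous_map_pairedI, auto)
  have Fq: "F (q y) = f y" if "y \<in> topspace ?P" for y using F'(2) [of 0 y] that by (simp add: F_def)
  have F0: "F y0 = w0"
    using q0 [of x0 0] Fq [of "(x0, 0)"] base(1) admissible_ends [OF f(2) base(1)] by simp
  have "\<exists>g. continuous_map (prod_topology II W) Y g \<and>
        (\<forall>I\<subseteq>{..<n}. \<forall>s\<in>{0..1}. \<forall>y\<in>topspace ?P. g (s, \<omega> I y) = (\<lambda>w. b I (snd w)) (s, y))"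
    unfolding Y_def
  proof (rule lift_suspension)
    show "continuous_map (prod_topology II ?P) (fst (suspension (X, x0))) (\<lambda>w. b I (snd w))" if "I \<subseteq> {..<n}" for I
      by (rule continuous_map_comp [OF b(1) [OF that, unfolded Y_def] continuous_map_snd])
  qed (use b(2) in \<open>simp add: y0_def\<close>)
  then obtain g' where g': "continuous_map (prod_topology II W) Y g'"
    "\<And>I s y. I \<subseteq> {..<n} \<Longrightarrow> s \<in> {0..1} \<Longrightarrow> y \<in> topspace ?P \<Longrightarrow> g' (s, \<omega> I y) = b I y" by force
  define g where "g w = g' (0, w)" for w
  have gc: "continuous_map W Y g"
    unfolding g_def by (rule continuous_map_comp [OF g'(1)]) (intro continuous_map_pairedI, auto)
  have g\<omega>: "g (\<omega> I y) = b I y" if "I \<subseteq> {..<n}" "y \<in> topspace ?P" for I y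
    using g'(2) [of I 0 y] that by (simp add: g_def)
  have gf: "g (f y) = multi_join n {} b y" if y: "y \<in> topspace ?P" for y
  proof -
    have "g (f y) = multi_join n {} (\<lambda>I. g \<circ> \<omega> I) y" unfolding f_def multi_join_comp by simp
    also have "\<dots> = multi_join n {} b y"
      by (rule multi_join_cong_pointwise) (use g\<omega> y in \<open>auto simp: lessThan_atLeast0\<close>)
    finally show ?thesis .
  qed
  have 1: "homotopic_with (\<lambda>_. True) Y Y (g \<circ> F) id"
  proof -
    obtain H where H: "continuous_map (prod_topology II ?P) Y H" "\<And>z. H (0, z) = q z" "\<And>z. H (1, z) = multi_join n {} b z"
      "\<And>s. s \<in> {0..1} \<Longrightarrow> admissible y0 {} {} (\<lambda>z. H (s, z))"
      using qb unfolding homotopic_with_def by auto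
    obtain k where k: "continuous_map (prod_topology II Y) Y k"
      "\<And>s y. s \<in> {0..1} \<Longrightarrow> y \<in> topspace ?P \<Longrightarrow> k (s, q y) = H (s, y)"
      using liftY [OF H(1,4)] by blast
    have "homotopic_with (\<lambda>_. True) Y Y id (g \<circ> F)"
    proof (rule homotopic_withI [OF _ k(1)])
      show "k (0, y) = id y" if "y \<in> topspace Y" for y
        using qsurj [OF that] k(2) [of 0] H(2) by auto
      show "k (1, y) = (g \<circ> F) y" if "y \<in> topspace Y" for y
        using qsurj [OF that] k(2) [of 1] H(3) gf Fq by auto
    qed auto
    then show ?thesis by (rule homotopic_with_symD)
  qed
  have 2: "homotopic_with (\<lambda>_. True) W W (F \<circ> g) id"
  proof -
    have FA: "admissible w0 J K (F \<circ> j)" if "admissible y0 J K j" for J K j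
      using that F0 unfolding admissible_def by auto
    \<comment> \<open>Naturality: composition with \<open>F\<close> commutes with
      \<open>multi_join\<close>, so the families \<open>F \<circ> b I\<close> and
      \<open>\<omega> I\<close> have homotopic joins. Injectivity then compares them at each
      \<open>I\<close>.\<close>
    have "loop_homotopic W w0 {} {} (F \<circ> q) (F \<circ> multi_join n {} b)"
      by (rule homotopic_with_compose_continuous_map_left [OF qb Fc]) (rule FA)
    moreover have "loop_homotopic W w0 {} {} (F \<circ> q) f"
      by (rule homotopic_with_equal) (use FA [OF qa] f Fq continuous_map_compose [OF qc Fc] in auto)
    ultimately have "loop_homotopic W w0 {} {} (F \<circ> multi_join n {} b) f"
      using homotopic_with_trans [OF homotopic_with_symD] by blast
    then have h: "loop_homotopic W w0 ({..<n - n} - {}) {} (multi_join n {} (\<lambda>I. F \<circ> b I)) (multi_join n {} \<omega>)"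
      unfolding multi_join_comp f_def by simp
    have "loop_homotopic W w0 ({..<n} - I) I (F \<circ> b I) (\<omega> I)" if I: "I \<subseteq> {..<n}" for I
    proof (rule multi_join_injective [OF _ _ le_refl _ h])
      show "continuous_map ?P W (F \<circ> b I) \<and> admissible w0 ({..<n} - I) I (F \<circ> b I)"
        if "I - {} \<subseteq> {n - n..<n}" for I
        using that continuous_map_compose [OF b(1) Fc] FA b(2) by (auto simp: lessThan_atLeast0)
      show "continuous_map ?P W (\<omega> I) \<and> admissible w0 ({..<n} - I) I (\<omega> I)"
        if "I - {} \<subseteq> {n - n..<n}" for I
        using that \<omega> by (auto simp: lessThan_atLeast0)
    qed (use I in \<open>auto simp: lessThan_atLeast0\<close>)
    then have "\<exists>h. I \<subseteq> {..<n} \<longrightarrow> continuous_map (prod_topology II ?P) W h \<and> (\<forall>y. h (0, y) = F (b I y)) \<and> (\<forall>y. h (1, y) = \<omega> I y)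
       \<and> (\<forall>s\<in>{0..1}. admissible w0 ({..<n} - I) I (\<lambda>y. h (s, y)))" for I
      unfolding homotopic_with_def by auto
    then obtain h where h: "\<And>I. I \<subseteq> {..<n} \<Longrightarrow> continuous_map (prod_topology II ?P) W (h I) \<and> (\<forall>y. h I (0, y) = F (b I y)) \<and> (\<forall>y. h I (1, y) = \<omega> I y)
       \<and> (\<forall>s\<in>{0..1}. admissible w0 ({..<n} - I) I (\<lambda>y. h I (s, y)))"
      by metis
    have "\<exists>k. continuous_map (prod_topology II W) W k \<and>
        (\<forall>I\<subseteq>{..<n}. \<forall>s\<in>{0..1}. \<forall>y\<in>topspace ?P. k (s, \<omega> I y) = h I (s, y))"
    proof (rule lift_W)
      show "continuous_map (prod_topology II ?P) W (h I)" if "I \<subseteq> {..<n}" for I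
        using h [OF that] by blast
      show "admissible w0 ({..<n} - I) I (\<lambda>y. h I (s, y))" if "I \<subseteq> {..<n}" "s \<in> {0..1}" for I s
        using h [OF that(1)] that(2) by blast
    qed
    then obtain k where k: "continuous_map (prod_topology II W) W k"
      and k2: "\<forall>I\<subseteq>{..<n}. \<forall>s\<in>{0..1}. \<forall>y\<in>topspace ?P. k (s, \<omega> I y) = h I (s, y)"
      by (elim exE conjE)
    show ?thesis
    proof (rule homotopic_withI [OF _ k])
      fix w assume "w \<in> topspace W"
      then obtain I y where I: "I \<subseteq> {..<n}" "y \<in> topspace ?P" "w = \<omega> I y" using surj by blast
      show "k (0, w) = (F \<circ> g) w" using k2 [rule_format, OF I(1) _ I(2), of 0] h [OF I(1)] g\<omega> [OF I(1,2)] I(3) by simp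
      show "k (1, w) = id w" using k2 [rule_format, OF I(1) _ I(2), of 1] h [OF I(1)] I(3) by simp
    qed auto
  qed
  show ?thesis
    unfolding homotopy_equivalent_space_def Y_def [symmetric] using Fc gc 1 2 by blast
qed

end

section \<open>The multiplication of a Lie group in a chart at the unit\<close>

lemma Euclidean_space_cube_nhd:
  assumes U: "openin (Euclidean_space N) U" and p: "p \<in> U"
  obtains \<delta> where "\<delta> > 0" "{x \<in> topspace (Euclidean_space N). \<forall>i<N. \<bar>x i - p i\<bar> \<le> \<delta>} \<subseteq> U"
proof -
  obtain V where V: "openin (product_topology (\<lambda>_. euclideanreal) UNIV) V" "U = V \<inter> {x. \<forall>i\<ge>N. x i = 0}"
    using U unfolding Euclidean_space_def openin_subtopology by auto
  obtain W where W: "\<And>i. open (W i)" "p \<in> PiE UNIV W" "PiE UNIV W \<subseteq> V"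
    using V p by (force simp: openin_product_topology_alt)
  have "\<exists>r>0. \<forall>t. \<bar>t - p i\<bar> \<le> r \<longrightarrow> t \<in> W i" for i
  proof -
    have "p i \<in> W i" using W(2) by auto
    then obtain r where "r > 0" "cball (p i) r \<subseteq> W i"
      using W(1) open_contains_cball by metis
    then show ?thesis by (intro exI [of _ r]) (auto simp: dist_real_def subset_iff abs_minus_commute)
  qed
  then obtain r where r: "\<And>i. r i > 0" "\<And>i t. \<bar>t - p i\<bar> \<le> r i \<Longrightarrow> t \<in> W i"
    by metis
  \<comment> \<open>The element 1 keeps the set nonempty when \<open>N = 0\<close>.\<close>
  define \<delta> where "\<delta> = Min (insert 1 (r ` {..<N}))"
  show thesis
  proof
    show "\<delta> > 0" using r by (simp add: \<delta>_def)
    have \<delta>: "\<delta> \<le> r i" if "i < N" for i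
      using that by (auto simp: \<delta>_def intro: Min_le)
    show "{x \<in> topspace (Euclidean_space N). \<forall>i<N. \<bar>x i - p i\<bar> \<le> \<delta>} \<subseteq> U"
    proof clarify
      fix x assume x: "x \<in> topspace (Euclidean_space N)" "\<forall>i<N. \<bar>x i - p i\<bar> \<le> \<delta>"
      have "x i \<in> W i" for i
      proof (cases "i < N")
        case True then show ?thesis using x(2) \<delta> r(2) by (meson order_trans)
      next
        case False
        then have "x i = p i" using x(1) p V by (simp add: topspace_Euclidean_space)
        then show ?thesis using W(2) by auto
      qed
      then have "x \<in> V" using W(3) by auto
      then show "x \<in> U" using V x(1) by (simp add: topspace_Euclidean_space)
    qed
  qed
qed

text \<open>Continuous partial derivatives give strict differentiability: telescope along the
  coordinates and apply the mean value inequality to each of them.\<close>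

lemma C_1_strict_derivative:
  assumes S: "openin (Euclidean_space N) S" and p: "p \<in> S" and \<epsilon>: "\<epsilon> > 0"
    and g: "\<And>i. i < N \<Longrightarrow> continuous_map (subtopology (Euclidean_space N) S) euclideanreal (g i)"
    and deriv: "\<And>i x. i < N \<Longrightarrow> x \<in> S \<Longrightarrow> ((\<lambda>t. f (x(i := t))) has_real_derivative g i x) (at (x i))"
  obtains \<delta> where "\<delta> > 0"
    "\<And>x y. \<lbrakk>x \<in> topspace (Euclidean_space N); y \<in> topspace (Euclidean_space N);
        \<forall>i<N. \<bar>x i - p i\<bar> \<le> \<delta>; \<forall>i<N. \<bar>y i - p i\<bar> \<le> \<delta>\<rbrakk>
      \<Longrightarrow> x \<in> S \<and> \<bar>f x - f y - (\<Sum>i<N. g i p * (x i - y i))\<bar> \<le> \<epsilon> * (\<Sum>i<N. \<bar>x i - y i\<bar>)"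
proof -
  let ?E = "Euclidean_space N"
  \<comment> \<open>The region where every partial derivative is within \<open>\<epsilon>\<close> of
    its value at \<open>p\<close>.\<close>
  define U where "U = S \<inter> (\<Inter>i<N. {x \<in> S. g i x \<in> ball (g i p) \<epsilon>})"
  have "openin ?E {x \<in> S. g i x \<in> ball (g i p) \<epsilon>}" if "i < N" for i
  proof -
    have "openin (subtopology ?E S) {x \<in> topspace (subtopology ?E S). g i x \<in> ball (g i p) \<epsilon>}"
      by (rule openin_continuous_map_preimage [OF g [OF that]]) auto
    moreover have "topspace (subtopology ?E S) = S" using openin_subset [OF S] by auto
    ultimately show ?thesis using S openin_trans_full by metis
  qed
  then have "openin ?E U"
    unfolding U_def
    \<comment> \<open>For \<open>N = 0\<close> the inner intersection is the whole type and not an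
      open set, hence the separate case.\<close>
    by (cases "N = 0") (use S in \<open>auto intro!: openin_Int openin_Inter\<close>)
  moreover have "p \<in> U" using p \<epsilon> by (auto simp: U_def)
  ultimately obtain \<delta> where \<delta>: "\<delta> > 0" and sub: "{x \<in> topspace ?E. \<forall>i<N. \<bar>x i - p i\<bar> \<le> \<delta>} \<subseteq> U"
    using Euclidean_space_cube_nhd by blast
  show thesis
  proof (rule that [OF \<delta>])
    fix x y assume x: "x \<in> topspace ?E" and y: "y \<in> topspace ?E"
      and xp: "\<forall>i<N. \<bar>x i - p i\<bar> \<le> \<delta>" and yp: "\<forall>i<N. \<bar>y i - p i\<bar> \<le> \<delta>"
    \<comment> \<open>Stations of the telescope: \<open>z k\<close> has traded the first
      \<open>k\<close> coordinates of \<open>y\<close> for those of \<open>x\<close>.\<close>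
    define z where "z k = (\<lambda>i. if i < k then x i else y i)" for k
    have zC: "(z k)(k := t) \<in> U" if "k < N" "t \<in> {p k - \<delta>..p k + \<delta>}" for k t
    proof -
      have "(z k)(k := t) \<in> topspace ?E" using x y that by (auto simp: z_def topspace_Euclidean_space)
      moreover have "\<forall>i<N. \<bar>((z k)(k := t)) i - p i\<bar> \<le> \<delta>" using xp yp that by (auto simp: z_def abs_le_iff)
      ultimately show ?thesis using sub by auto
    qed
    have step: "\<bar>f (z (Suc k)) - f (z k) - g k p * (x k - y k)\<bar> \<le> \<epsilon> * \<bar>x k - y k\<bar>" if k: "k < N" for k
    proof -
      let ?I = "{p k - \<delta>..p k + \<delta>}"
      \<comment> \<open>With the linear term removed, the derivative is bounded by
        \<open>\<epsilon>\<close> on the whole interval.\<close>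
      let ?h = "\<lambda>t. f ((z k)(k := t)) - g k p * t"
      have xy: "x k \<in> ?I" "y k \<in> ?I" using xp yp k by (auto simp: abs_le_iff algebra_simps)
      have d: "(?h has_field_derivative (g k ((z k)(k := t)) - g k p)) (at t within ?I)" if "t \<in> ?I" for t
      proof -
        have "(z k)(k := t) \<in> S" using zC [OF k that] by (simp add: U_def)
        from deriv [OF k this] have "((\<lambda>u. f ((z k)(k := u))) has_real_derivative g k ((z k)(k := t))) (at t)"
          by simp
        then have "(?h has_real_derivative (g k ((z k)(k := t)) - g k p)) (at t)"
          by (auto intro!: derivative_eq_intros)
        then show ?thesis using has_field_derivative_at_within by blast
      qed
      have b: "norm (g k ((z k)(k := t)) - g k p) \<le> \<epsilon>" if "t \<in> ?I" for t
        using zC [OF k that] k by (force simp: U_def dist_real_def abs_minus_commute)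
      have "norm (?h (x k) - ?h (y k)) \<le> \<epsilon> * norm (x k - y k)"
        by (rule field_differentiable_bound [OF _ d b xy]) auto
      moreover have "(z k)(k := x k) = z (Suc k)" "(z k)(k := y k) = z k"
        by (auto simp: z_def fun_eq_iff less_Suc_eq)
      ultimately show ?thesis by (simp add: algebra_simps)
    qed
    have tele: "\<bar>f (z k) - f (z 0) - (\<Sum>i<k. g i p * (x i - y i))\<bar> \<le> \<epsilon> * (\<Sum>i<k. \<bar>x i - y i\<bar>)" if "k \<le> N" for k
      using that
    proof (induction k)
      case (Suc k)
      then show ?case using step [of k] by (simp add: distrib_left abs_le_iff)
    qed simp
    have "z 0 = y" "z N = x" using x y by (auto simp: z_def topspace_Euclidean_space fun_eq_iff)
    moreover have "x \<in> S" using sub x xp by (auto simp: U_def)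
    ultimately show "x \<in> S \<and> \<bar>f x - f y - (\<Sum>i<N. g i p * (x i - y i))\<bar> \<le> \<epsilon> * (\<Sum>i<N. \<bar>x i - y i\<bar>)"
      using tele [of N] by simp
  qed
qed

section \<open>The product in a chart at the unit\<close>

lemma sum_lessThan_add:
  fixes h :: "nat \<Rightarrow> 'm::comm_monoid_add"
  shows "(\<Sum>i<a + b. h i) = (\<Sum>i<a. h i) + (\<Sum>i<b. h (a + i))"
  by (induction b) (auto simp: add.assoc)

text \<open>The inverse is put in the form \<open>inv_into U \<phi>\<close> because
  \<open>smooth_map\<close> expresses coordinates through it.\<close>

lemma is_chartD:
  assumes "is_chart X d (U, \<phi>)"
  shows "openin X U" "openin (Euclidean_space d) (\<phi> ` U)" "inj_on \<phi> U"
    "continuous_map (subtopology X U) (subtopology (Euclidean_space d) (\<phi> ` U)) \<phi>"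
    "continuous_map (subtopology (Euclidean_space d) (\<phi> ` U)) (subtopology X U) (inv_into U \<phi>)"
proof -
  let ?X = "subtopology X U" and ?Y = "subtopology (Euclidean_space d) (\<phi> ` U)"
  show U: "openin X U" and V: "openin (Euclidean_space d) (\<phi> ` U)"
    using assms by (auto simp: is_chart_def)
  have h: "homeomorphic_map ?X ?Y \<phi>"
    using assms by (auto simp: is_chart_def)
  have tX: "topspace ?X = U" and tY: "topspace ?Y = \<phi> ` U"
    using openin_subset [OF U] openin_subset [OF V] by auto
  show inj: "inj_on \<phi> U"
    using homeomorphic_imp_injective_map [OF h] tX by simp
  obtain g where g: "homeomorphic_maps ?X ?Y \<phi> g"
    using h unfolding homeomorphic_map_maps by blast
  show "continuous_map ?X ?Y \<phi>"
    using g by (simp add: homeomorphic_maps_def)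
  show "continuous_map ?Y ?X (inv_into U \<phi>)"
  proof (rule continuous_map_eq)
    show "continuous_map ?Y ?X g" using g by (simp add: homeomorphic_maps_def)
    show "g y = inv_into U \<phi> y" if y: "y \<in> topspace ?Y" for y
    proof -
      obtain x where "x \<in> U" "y = \<phi> x" using y tY by auto
      then show ?thesis using g tX inj by (simp add: homeomorphic_maps_def)
    qed
  qed
qed

context lie_group
begin

lemma continuous_map_mult: "continuous_map (prod_topology T T) T (\<lambda>z. fst z \<otimes> snd z)"
  using smooth_mult by (simp add: smooth_map_def case_prod_unfold)

lemma continuous_map_inv: "continuous_map T T (\<lambda>x. inv x)"
  using smooth_inv by (simp add: smooth_map_def)

text \<open>Since \<open>x \<otimes> \<one> = x\<close> and \<open>\<one> \<otimes> y = y\<close>,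
  the derivative of the product at the unit is addition. Strictness means that any two pairs near
  the unit are compared with each other, not just with \<open>(\<one>, \<one>)\<close>; the
  expansion of squaring depends on this.\<close>

lemma chart_strict_mult:
  assumes c: "(U, \<phi>) \<in> A" and one: "\<one> \<in> U" and \<eta>: "\<eta> > 0"
  obtains \<delta> where "\<delta> > 0"
    "\<And>x y x' y'. \<lbrakk>x \<in> U; y \<in> U; x' \<in> U; y' \<in> U;
        \<forall>i<d. \<bar>\<phi> x i - \<phi> \<one> i\<bar> \<le> \<delta>; \<forall>i<d. \<bar>\<phi> y i - \<phi> \<one> i\<bar> \<le> \<delta>;
        \<forall>i<d. \<bar>\<phi> x' i - \<phi> \<one> i\<bar> \<le> \<delta>; \<forall>i<d. \<bar>\<phi> y' i - \<phi> \<one> i\<bar> \<le> \<delta>\<rbrakk>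
      \<Longrightarrow> x \<otimes> y \<in> U \<and> (\<forall>j<d. \<bar>\<phi> (x \<otimes> y) j - \<phi> (x' \<otimes> y') j - (\<phi> x j - \<phi> x' j) - (\<phi> y j - \<phi> y' j)\<bar>
          \<le> \<eta> * ((\<Sum>i<d. \<bar>\<phi> x i - \<phi> x' i\<bar>) + (\<Sum>i<d. \<bar>\<phi> y i - \<phi> y' i\<bar>)))"
proof -
  let ?E = "Euclidean_space d" and ?E2 = "Euclidean_space (d + d)"
  have chart: "is_chart T d (U, \<phi>)" using atlas c by (auto simp: smooth_atlas_def)
  note ch = is_chartD [OF chart]
  define \<psi> where "\<psi> = inv_into U \<phi>"
  have UG: "U \<subseteq> carrier G" using openin_subset [OF ch(1)] topspace_eq by simp
  have \<psi>U: "\<psi> u \<in> U" "\<phi> (\<psi> u) = u" if "u \<in> \<phi> ` U" for u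
    using that by (auto simp: \<psi>_def inv_into_into f_inv_into_f)
  have \<psi>\<phi>: "\<psi> (\<phi> x) = x" if "x \<in> U" for x using ch(3) that by (simp add: \<psi>_def)
  have \<phi>0: "\<phi> x i = 0" if "x \<in> U" "i \<ge> d" for x i
    using openin_subset [OF ch(2)] that by (auto simp: topspace_Euclidean_space)
  define \<Phi> where "\<Phi> = (\<lambda>(x, y) i. if i < d then \<phi> x i else \<phi> y (i - d))"
  \<comment> \<open>\<open>l\<close> and \<open>r\<close> recover the two factors from coordinates
    in the product chart, padded by 0 to lie in the model space.\<close>
  define l where "l z = (\<lambda>i. if i < d then z i else 0)" for z :: "nat \<Rightarrow> real"
  define r where "r z = (\<lambda>i. if i < d then z (d + i) else 0)" for z :: "nat \<Rightarrow> real"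
  have l\<Phi>: "l (\<Phi> (x, y)) = \<phi> x" if "x \<in> U" for x y
    using \<phi>0 [OF that] by (auto simp: l_def \<Phi>_def fun_eq_iff)
  have r\<Phi>: "r (\<Phi> (x, y)) = \<phi> y" if "y \<in> U" for x y
    using \<phi>0 [OF that] by (auto simp: r_def \<Phi>_def fun_eq_iff)
  have \<Phi>inj: "inj_on \<Phi> (U \<times> U)"
    by (rule inj_onI) (metis SigmaE l\<Phi> r\<Phi> \<psi>\<phi>)
  have \<Phi>E: "\<Phi> (x, y) \<in> topspace ?E2" if "y \<in> U" for x y
    using \<phi>0 [OF that] by (auto simp: \<Phi>_def topspace_Euclidean_space)
  define V where "V = {z \<in> topspace ?E2. l z \<in> \<phi> ` U} \<inter> {z \<in> topspace ?E2. r z \<in> \<phi> ` U}"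
  have proj: "continuous_map ?E2 euclideanreal (\<lambda>z. z i)" for i
    unfolding Euclidean_space_def
    by (rule continuous_map_from_subtopology [OF continuous_map_product_projection]) simp
  have lc: "continuous_map ?E2 ?E l" and rc: "continuous_map ?E2 ?E r"
    unfolding l_def r_def continuous_map_componentwise_Euclidean_space using proj by auto
  have V: "openin ?E2 V"
    unfolding V_def by (intro openin_Int openin_continuous_map_preimage [OF lc ch(2)] openin_continuous_map_preimage [OF rc ch(2)])
  define m where "m z = \<psi> (l z) \<otimes> \<psi> (r z)" for z
  have mc: "continuous_map (subtopology ?E2 V) T m"
  proof -
    have 1: "continuous_map (subtopology ?E2 V) (subtopology ?E (\<phi> ` U)) l" "continuous_map (subtopology ?E2 V) (subtopology ?E (\<phi> ` U)) r"
      unfolding continuous_map_in_subtopology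
      using continuous_map_from_subtopology [OF lc] continuous_map_from_subtopology [OF rc] by (auto simp: V_def)
    have 2: "continuous_map (subtopology ?E (\<phi> ` U)) T \<psi>"
      using ch(5) continuous_map_into_fulltopology by (auto simp: \<psi>_def)
    have "continuous_map (subtopology ?E2 V) (prod_topology T T) (\<lambda>z. (\<psi> (l z), \<psi> (r z)))"
      using continuous_map_compose [OF 1(1) 2] continuous_map_compose [OF 1(2) 2] by (simp add: continuous_map_pairedI o_def)
    from continuous_map_compose [OF this continuous_map_mult]
    show ?thesis by (simp add: o_def m_def [abs_def])
  qed
  \<comment> \<open>The product has coordinates only while it stays in \<open>U\<close>; on this
    open set the smoothness hypothesis applies.\<close>
  define S where "S = {z \<in> V. m z \<in> U}"
  have "openin (subtopology ?E2 V) {z \<in> topspace (subtopology ?E2 V). m z \<in> U}"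
    by (rule openin_continuous_map_preimage [OF mc ch(1)])
  moreover have "topspace (subtopology ?E2 V) = V" using openin_subset [OF V] by auto
  ultimately have S: "openin ?E2 S" unfolding S_def using V openin_trans_full by metis
  have V\<Phi>: "V = \<Phi> ` (U \<times> U)"
  proof (intro equalityI subsetI)
    fix z assume z: "z \<in> V"
    have "z = \<Phi> (\<psi> (l z), \<psi> (r z))"
    proof
      fix i show "z i = \<Phi> (\<psi> (l z), \<psi> (r z)) i"
      proof (cases "i < d")
        case True then show ?thesis using z \<psi>U(2) [of "l z"] by (simp add: V_def \<Phi>_def l_def)
      next
        case False
        have *: "\<phi> (\<psi> (r z)) = r z" using z \<psi>U(2) [of "r z"] by (simp add: V_def)
        show ?thesis
        proof (cases "i < d + d")
          case True with False show ?thesis by (simp add: \<Phi>_def * ) (simp add: r_def)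
        next
          case 2: False
          then have "z i = 0" using z by (simp add: V_def topspace_Euclidean_space)
          then show ?thesis using False 2 by (simp add: \<Phi>_def * ) (simp add: r_def)
        qed
      qed
    qed
    then show "z \<in> \<Phi> ` (U \<times> U)" using z \<psi>U(1) by (auto simp: V_def)
  next
    fix z assume "z \<in> \<Phi> ` (U \<times> U)"
    then show "z \<in> V" using l\<Phi> r\<Phi> \<Phi>E by (auto simp: V_def)
  qed
  have inv\<Phi>: "inv_into (U \<times> U) \<Phi> (\<Phi> (x, y)) = (x, y)" if "x \<in> U" "y \<in> U" for x y
    using \<Phi>inj that by simp
  have S\<Phi>: "S = \<Phi> ` ((U \<times> U) \<inter> (\<lambda>(x, y). x \<otimes> y) -` U)"
    unfolding S_def V\<Phi> by (auto simp: m_def l\<Phi> r\<Phi> \<psi>\<phi>)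
  define F where "F j z = \<phi> ((\<lambda>(x, y). x \<otimes> y) (inv_into (U \<times> U) \<Phi> z)) j" for j z
  have F: "F j (\<Phi> (x, y)) = \<phi> (x \<otimes> y) j" if "x \<in> U" "y \<in> U" for j x y
    using inv\<Phi> [OF that] by (simp add: F_def)
  have prodc: "(U \<times> U, \<Phi>) \<in> prod_atlas d A A" using c by (auto simp: prod_atlas_def \<Phi>_def)
  have "smooth_on (d + d) S (F j)" if "j < d" for j
    using smooth_mult prodc c that unfolding smooth_map_def S\<Phi> F_def by fast
  then have "C_k (Suc 0) (d + d) S (F j)" if "j < d" for j
    using that unfolding smooth_on_def by blast
  then have "\<forall>j. \<exists>g. j < d \<longrightarrow> (\<forall>i<d + d. continuous_map (subtopology ?E2 S) euclideanreal (g i) \<and>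
      (\<forall>x\<in>S. ((\<lambda>t. F j (x(i := t))) has_real_derivative g i x) (at (x i))))"
    by simp
  then obtain g where g: "\<And>i j. j < d \<Longrightarrow> i < d + d \<Longrightarrow> continuous_map (subtopology ?E2 S) euclideanreal (g j i)"
      "\<And>i j x. j < d \<Longrightarrow> i < d + d \<Longrightarrow> x \<in> S \<Longrightarrow> ((\<lambda>t. F j (x(i := t))) has_real_derivative g j i x) (at (x i))"
    by metis
  define P where "P = \<Phi> (\<one>, \<one>)"
  have PS: "P \<in> S" unfolding S\<Phi> P_def using one UG by auto
  obtain \<rho> where \<rho>: "\<rho> > 0" "{x \<in> topspace ?E. \<forall>i<d. \<bar>x i - \<phi> \<one> i\<bar> \<le> \<rho>} \<subseteq> \<phi> ` U"
    using Euclidean_space_cube_nhd [OF ch(2)] one by blast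
  have near: "(\<phi> \<one>)(i := t) \<in> \<phi> ` U" if "i < d" "\<bar>t - \<phi> \<one> i\<bar> \<le> \<rho>" for i t
    using that \<rho> \<phi>0 [OF one] by (intro subsetD [OF \<rho>(2)]) (auto simp: topspace_Euclidean_space)
  \<comment> \<open>Changing one coordinate of \<open>P\<close> moves one factor and leaves the
    other at the unit, so the product is the moved factor.\<close>
  have partial: "g j i P = (if i = j \<or> i = d + j then 1 else 0)" if j: "j < d" and i: "i < d + d" for i j
  proof -
    define k where "k = (if i < d then i else i - d)"
    have k: "k < d" using i by (auto simp: k_def)
    have Pk: "P i = \<phi> \<one> k" by (simp add: P_def \<Phi>_def k_def)
    have FP: "F j (P(i := t)) = ((\<phi> \<one>)(k := t)) j" if t: "\<bar>t - \<phi> \<one> k\<bar> \<le> \<rho>" for t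
    proof -
      obtain x where x: "x \<in> U" "\<phi> x = (\<phi> \<one>)(k := t)" using near [OF k t] by (metis imageE)
      have "P(i := t) = (if i < d then \<Phi> (x, \<one>) else \<Phi> (\<one>, x))"
        using i by (auto simp: P_def \<Phi>_def k_def x(2) fun_eq_iff)
      then show ?thesis using F x one UG by (auto simp: subset_iff)
    qed
    have "((\<lambda>t. F j (P(i := t))) has_real_derivative g j i P) (at (P i))"
      using g(2) [OF j i PS] .
    moreover have "eventually (\<lambda>t. F j (P(i := t)) = ((\<phi> \<one>)(k := t)) j) (nhds (P i))"
    proof -
      have "eventually (\<lambda>t. t \<in> ball (P i) \<rho>) (nhds (P i))"
        using \<rho>(1) by (intro eventually_nhds_in_open) auto
      then show ?thesis
        by (rule eventually_mono) (rule FP, auto simp: Pk dist_real_def abs_minus_commute)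
    qed
    ultimately have "((\<lambda>t. ((\<phi> \<one>)(k := t)) j) has_real_derivative g j i P) (at (P i))"
      by (rule DERIV_cong_ev [OF refl _ refl, THEN iffD1, rotated])
    moreover have "((\<lambda>t. ((\<phi> \<one>)(k := t)) j) has_real_derivative (if j = k then 1 else 0)) (at (P i))"
      by (cases "j = k") auto
    ultimately have "g j i P = (if j = k then 1 else 0)" by (rule DERIV_unique)
    then show ?thesis using i j by (auto simp: k_def)
  qed
  define Q where "Q j \<delta> \<longleftrightarrow> (\<forall>x y. x \<in> topspace ?E2 \<longrightarrow> y \<in> topspace ?E2 \<longrightarrow>
        (\<forall>i<d+d. \<bar>x i - P i\<bar> \<le> \<delta>) \<longrightarrow> (\<forall>i<d+d. \<bar>y i - P i\<bar> \<le> \<delta>)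
      \<longrightarrow> \<bar>F j x - F j y - (\<Sum>i<d+d. g j i P * (x i - y i))\<bar> \<le> \<eta> * (\<Sum>i<d+d. \<bar>x i - y i\<bar>))" for j \<delta>
  have "\<exists>\<delta>. j < d \<longrightarrow> \<delta> > 0 \<and> Q j \<delta>" for j
  proof (cases "j < d")
    case True
    obtain \<delta> where "\<delta> > 0" "Q j \<delta>"
      unfolding Q_def
      by (rule C_1_strict_derivative [OF S PS \<eta> g(1) [OF True] g(2) [OF True]]) blast+
    then show ?thesis by blast
  qed simp
  then obtain \<delta> where \<delta>: "\<And>j. j < d \<Longrightarrow> \<delta> j > 0" "\<And>j. j < d \<Longrightarrow> Q j (\<delta> j)"
    by metis
  obtain \<delta>' where \<delta>': "\<delta>' > 0" "{x \<in> topspace ?E2. \<forall>i<d+d. \<bar>x i - P i\<bar> \<le> \<delta>'} \<subseteq> S"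
    using Euclidean_space_cube_nhd [OF S PS] by blast
  \<comment> \<open>\<open>\<delta> j\<close> serves the \<open>j\<close>-th coordinate of the
    product; \<open>\<delta>'\<close> keeps the product in \<open>U\<close> and makes the set
    nonempty when \<open>d = 0\<close>.\<close>
  define \<Delta> where "\<Delta> = Min (insert \<delta>' (\<delta> ` {..<d}))"
  have \<Delta>pos: "\<Delta> > 0" using \<delta>(1) \<delta>'(1) by (simp add: \<Delta>_def)
  have \<Delta>le: "\<Delta> \<le> \<delta>'" "\<And>j. j < d \<Longrightarrow> \<Delta> \<le> \<delta> j" by (auto simp: \<Delta>_def intro: Min_le)
  show thesis
  proof (rule that [OF \<Delta>pos])
    fix x y x' y'
    assume U: "x \<in> U" "y \<in> U" "x' \<in> U" "y' \<in> U"
      and small: "\<forall>i<d. \<bar>\<phi> x i - \<phi> \<one> i\<bar> \<le> \<Delta>" "\<forall>i<d. \<bar>\<phi> y i - \<phi> \<one> i\<bar> \<le> \<Delta>"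
        "\<forall>i<d. \<bar>\<phi> x' i - \<phi> \<one> i\<bar> \<le> \<Delta>" "\<forall>i<d. \<bar>\<phi> y' i - \<phi> \<one> i\<bar> \<le> \<Delta>"
    have box: "\<forall>i<d+d. \<bar>\<Phi> (a, b) i - P i\<bar> \<le> \<Delta>"
      if "\<forall>i<d. \<bar>\<phi> a i - \<phi> \<one> i\<bar> \<le> \<Delta>" "\<forall>i<d. \<bar>\<phi> b i - \<phi> \<one> i\<bar> \<le> \<Delta>" for a b
      using that by (auto simp: P_def \<Phi>_def)
    note b1 = box [OF small(1,2)] and b2 = box [OF small(3,4)]
    have "\<Phi> (x, y) \<in> S" using \<delta>'(2) \<Phi>E [OF U(2)] b1 \<Delta>le(1) by force
    then have "x \<otimes> y \<in> U" using l\<Phi> r\<Phi> U \<psi>\<phi> by (simp add: S_def m_def)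
    moreover have "\<bar>\<phi> (x \<otimes> y) j - \<phi> (x' \<otimes> y') j - (\<phi> x j - \<phi> x' j) - (\<phi> y j - \<phi> y' j)\<bar>
          \<le> \<eta> * ((\<Sum>i<d. \<bar>\<phi> x i - \<phi> x' i\<bar>) + (\<Sum>i<d. \<bar>\<phi> y i - \<phi> y' i\<bar>))" if j: "j < d" for j
    proof -
      have "\<bar>F j (\<Phi> (x, y)) - F j (\<Phi> (x', y')) - (\<Sum>i<d+d. g j i P * (\<Phi> (x, y) i - \<Phi> (x', y') i))\<bar>
          \<le> \<eta> * (\<Sum>i<d+d. \<bar>\<Phi> (x, y) i - \<Phi> (x', y') i\<bar>)"
        by (rule \<delta>(2) [OF j, unfolded Q_def, rule_format, OF \<Phi>E [OF U(2)] \<Phi>E [OF U(4)]])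
          (use b1 b2 \<Delta>le(2) [OF j] in \<open>meson order_trans\<close>)+
      moreover have "(\<Sum>i<d+d. g j i P * (\<Phi> (x, y) i - \<Phi> (x', y') i)) = (\<phi> x j - \<phi> x' j) + (\<phi> y j - \<phi> y' j)"
      proof -
        have "(\<Sum>i<d. g j i P * (\<Phi> (x, y) i - \<Phi> (x', y') i)) = (\<Sum>i<d. if i = j then \<phi> x j - \<phi> x' j else 0)"
          by (intro sum.cong) (auto simp: partial j \<Phi>_def)
        moreover have "(\<Sum>i<d. g j (d + i) P * (\<Phi> (x, y) (d + i) - \<Phi> (x', y') (d + i))) = (\<Sum>i<d. if i = j then \<phi> y j - \<phi> y' j else 0)"
          using j by (intro sum.cong) (auto simp: partial \<Phi>_def)
        ultimately show ?thesis using j by (simp add: sum_lessThan_add)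
      qed
      moreover have "(\<Sum>i<d+d. \<bar>\<Phi> (x, y) i - \<Phi> (x', y') i\<bar>) = (\<Sum>i<d. \<bar>\<phi> x i - \<phi> x' i\<bar>) + (\<Sum>i<d. \<bar>\<phi> y i - \<phi> y' i\<bar>)"
        by (simp add: sum_lessThan_add \<Phi>_def)
      ultimately show ?thesis using F U by (simp add: algebra_simps)
    qed
    ultimately show "x \<otimes> y \<in> U \<and> (\<forall>j<d. \<bar>\<phi> (x \<otimes> y) j - \<phi> (x' \<otimes> y') j - (\<phi> x j - \<phi> x' j) - (\<phi> y j - \<phi> y' j)\<bar>
          \<le> \<eta> * ((\<Sum>i<d. \<bar>\<phi> x i - \<phi> x' i\<bar>) + (\<Sum>i<d. \<bar>\<phi> y i - \<phi> y' i\<bar>)))"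
      by blast
  qed
qed

end

section \<open>Equivariant contraction of a neighbourhood of the unit\<close>

locale compact_topological_group = group G for G (structure) +
  fixes T :: "'a topology"
  assumes topspace_T: "topspace T = carrier G"
    and Hausdorff_T: "Hausdorff_space T"
    and compact_T: "compact_space T"
    and mult_cont: "continuous_map (prod_topology T T) T (\<lambda>z. fst z \<otimes> snd z)"
    and inv_cont: "continuous_map T T (\<lambda>x. inv x)"
begin

lemma continuous_map_mult2:
  assumes "continuous_map X T f" "continuous_map X T g"
  shows "continuous_map X T (\<lambda>x. f x \<otimes> g x)"
  using continuous_map_comp [OF mult_cont continuous_map_pairedI [OF assms]] by simp

lemma continuous_map_conj:
  assumes "continuous_map X T f" "continuous_map X T g"
  shows "continuous_map X T (\<lambda>x. f x \<otimes> g x \<otimes> inv (f x))"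
  by (intro continuous_map_mult2 assms continuous_map_comp [OF inv_cont])

lemma conj_conj:
  assumes "g \<in> carrier G" "h \<in> carrier G" "x \<in> carrier G"
  shows "g \<otimes> (h \<otimes> x \<otimes> inv h) \<otimes> inv g = (g \<otimes> h) \<otimes> x \<otimes> inv (g \<otimes> h)"
  using assms by (simp add: inv_mult_group m_assoc)

lemma conj_mult:
  assumes "g \<in> carrier G" "x \<in> carrier G" "y \<in> carrier G"
  shows "g \<otimes> (x \<otimes> y) \<otimes> inv g = (g \<otimes> x \<otimes> inv g) \<otimes> (g \<otimes> y \<otimes> inv g)"
proof -
  have "inv g \<otimes> (g \<otimes> (y \<otimes> inv g)) = y \<otimes> inv g"
    using assms by (simp flip: m_assoc)
  then show ?thesis using assms by (simp add: m_assoc)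
qed

end

text \<open>The paths \<open>\<gamma>\<close> need not be equivariant: they only start the iteration below.\<close>

locale square_expanding_group = compact_topological_group G T + Metric_space M \<delta>
  for G (structure) and T :: "'a topology" and M :: "'a set" and \<delta> :: "'a \<Rightarrow> 'a \<Rightarrow> real" +
  fixes \<gamma> :: "real \<times> 'a \<Rightarrow> 'a"
  assumes M_closed: "closedin T M"
    and M_nhd: "\<exists>O1. openin T O1 \<and> \<one> \<in> O1 \<and> O1 \<subseteq> M"
    and dist_cont: "x \<in> M \<Longrightarrow> continuous_map (subtopology T M) euclideanreal (\<lambda>y. \<delta> x y)"
    and square_expands: "\<lbrakk>x \<in> M; y \<in> M; x \<otimes> x \<in> M; y \<otimes> y \<in> M\<rbrakk> \<Longrightarrow> 3/2 * \<delta> x y \<le> \<delta> (x \<otimes> x) (y \<otimes> y)"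
    and mult_Lipschitz: "\<lbrakk>x \<in> M; y \<in> M; z \<in> M; x \<otimes> y \<in> M; x \<otimes> z \<in> M\<rbrakk> \<Longrightarrow> \<delta> (x \<otimes> y) (x \<otimes> z) \<le> 5/4 * \<delta> y z"
    and square_open: "\<exists>V. openin T V \<and> \<one> \<in> V \<and> (\<forall>x\<in>V. \<exists>y\<in>M. y \<otimes> y = x)"
    and path_cont: "continuous_map (prod_topology II (subtopology T M)) (subtopology T M) \<gamma>"
    and path_0: "x \<in> M \<Longrightarrow> \<gamma> (0, x) = \<one>"
    and path_1: "x \<in> M \<Longrightarrow> \<gamma> (1, x) = x"
    and path_dist: "\<lbrakk>x \<in> M; t \<in> {0..1}\<rbrakk> \<Longrightarrow> \<delta> (\<gamma> (t, x)) \<one> \<le> \<delta> x \<one>"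
begin

section \<open>The metric neighbourhood of the unit and its square roots\<close>

lemma M_carrier: "M \<subseteq> carrier G"
  using closedin_subset [OF M_closed] topspace_T by simp

lemma one_M: "\<one> \<in> M" using M_nhd by blast

text \<open>The identity is continuous from the subspace topology to the metric one, and a
  continuous bijection from a compact onto a Hausdorff space is a homeomorphism. Completeness
  follows, as the limit of the iteration requires.\<close>

lemma mtopology_eq: "mtopology = subtopology T M"
proof -
  have tM: "topspace (subtopology T M) = M" using M_carrier topspace_T by auto
  have "continuous_map (subtopology T M) mtopology id"
    unfolding continuous_map_to_metric
  proof (intro ballI allI impI)
    fix x and \<epsilon> :: real assume x: "x \<in> topspace (subtopology T M)" and \<epsilon>: "0 < \<epsilon>"
    have xM: "x \<in> M" using x tM by simp
    let ?U = "{y \<in> topspace (subtopology T M). \<delta> x y \<in> {..<\<epsilon>}}"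
    have "openin (subtopology T M) ?U"
      by (rule openin_continuous_map_preimage [OF dist_cont [OF xM]]) auto
    moreover have "x \<in> ?U" using x xM \<epsilon> by simp
    moreover have "\<forall>y\<in>?U. id y \<in> mball (id x) \<epsilon>" using xM tM by auto
    ultimately show "\<exists>U. openin (subtopology T M) U \<and> x \<in> U \<and> (\<forall>y\<in>U. id y \<in> mball (id x) \<epsilon>)" by blast
  qed
  moreover have "compact_space (subtopology T M)"
    using M_closed compact_T closedin_compact_space compact_space_subtopology by blast
  ultimately have "homeomorphic_map (subtopology T M) mtopology id"
    by (rule continuous_imp_homeomorphic_map) (use tM Hausdorff_space_mtopology in auto)
  then show ?thesis by simp
qed

lemma mcomplete_M: "mcomplete"
  using M_closed compact_T closedin_compact_space compact_space_subtopology compact_space_imp_mcomplete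
  by (metis mtopology_eq)

definition near :: "real \<Rightarrow> 'a set" where
  "near \<kappa> = {x \<in> M. \<delta> x \<one> \<le> \<kappa>}"

lemma near_subset:
  assumes "openin T V" "\<one> \<in> V"
  obtains \<kappa> where "\<kappa> > 0" "near \<kappa> \<subseteq> V"
proof -
  have "openin mtopology (V \<inter> M)" unfolding mtopology_eq using assms(1) by (simp add: openin_subtopology_Int)
  then obtain r where "r > 0" "mcball \<one> r \<subseteq> V \<inter> M"
    using assms one_M unfolding openin_mtopology_mcball by blast
  then have "near r \<subseteq> V"
    using one_M by (auto simp: near_def commute subset_iff)
  with \<open>r > 0\<close> that show ?thesis by blast
qed

lemma near_nhd:
  assumes "\<kappa> > 0"
  obtains V where "openin T V" "\<one> \<in> V" "V \<subseteq> near \<kappa>"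
proof -
  obtain O1 where O1: "openin T O1" "\<one> \<in> O1" "O1 \<subseteq> M" using M_nhd by blast
  have "openin (subtopology T M) (mball \<one> \<kappa>)" using openin_mball mtopology_eq by metis
  then obtain V where V: "openin T V" "mball \<one> \<kappa> = V \<inter> M" by (auto simp: openin_subtopology)
  show ?thesis
  proof
    show "openin T (V \<inter> O1)" using V O1 by blast
    have "\<one> \<in> mball \<one> \<kappa>" using one_M assms by simp
    then show "\<one> \<in> V \<inter> O1" using V O1 by auto
    have "V \<inter> O1 \<subseteq> mball \<one> \<kappa>" using V O1 by auto
    then show "V \<inter> O1 \<subseteq> near \<kappa>" by (auto simp: near_def commute)
  qed
qed

lemma near_closed: "closedin T (near \<kappa>)"
proof -
  have "closedin (subtopology T M) (mcball \<one> \<kappa>)" using closedin_mcball mtopology_eq by metis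
  moreover have "near \<kappa> = mcball \<one> \<kappa>" using one_M by (auto simp: near_def commute)
  ultimately show ?thesis using M_closed closedin_trans_full by metis
qed

lemma one_near: "\<kappa> \<ge> 0 \<Longrightarrow> \<one> \<in> near \<kappa>"
  using one_M by (simp add: near_def)

text \<open>The pairs \<open>(g, x)\<close> with \<open>g \<otimes> x \<otimes> inv g\<close> in
  \<open>O1\<close> form an open set that contains all \<open>(g, \<one>)\<close>. As the group is
  compact, the set contains a tube around them.\<close>

lemma conj_small:
  assumes "openin T O1" "\<one> \<in> O1"
  obtains V where "openin T V" "\<one> \<in> V" "\<And>g x. g \<in> carrier G \<Longrightarrow> x \<in> V \<Longrightarrow> g \<otimes> x \<otimes> inv g \<in> O1"
proof -
  have c: "continuous_map (prod_topology T T) T (\<lambda>z. fst z \<otimes> snd z \<otimes> inv (fst z))"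
    by (intro continuous_map_conj continuous_map_fst continuous_map_snd)
  have "\<exists>U V. openin T U \<and> openin T V \<and> topspace T \<subseteq> U \<and> \<one> \<in> V \<and> U \<times> V
      \<subseteq> {z \<in> topspace (prod_topology T T). fst z \<otimes> snd z \<otimes> inv (fst z) \<in> O1}"
  proof (rule tube_lemma_left)
    show "openin (prod_topology T T) {z \<in> topspace (prod_topology T T). fst z \<otimes> snd z \<otimes> inv (fst z) \<in> O1}"
      by (rule openin_continuous_map_preimage [OF c assms(1)])
    show "compactin T (topspace T)" using compact_T by (simp add: compact_space_def)
  qed (use topspace_T assms in auto)
  then obtain U V where UV: "openin T V" "topspace T \<subseteq> U" "\<one> \<in> V"
    "U \<times> V \<subseteq> {z \<in> topspace (prod_topology T T). fst z \<otimes> snd z \<otimes> inv (fst z) \<in> O1}"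
    by blast
  have "g \<otimes> x \<otimes> inv g \<in> O1" if "g \<in> carrier G" "x \<in> V" for g x
  proof -
    have "(g, x) \<in> U \<times> V" using that UV(2) topspace_T by auto
    then show ?thesis using UV(4) by auto
  qed
  with UV that show ?thesis by blast
qed

definition root :: "'a \<Rightarrow> 'a" where
  "root x = (THE y. y \<in> M \<and> y \<otimes> y = x)"

lemma root_unique:
  assumes "x \<in> M" "y \<in> M" "y \<otimes> y = x"
  shows "root x = y"
  unfolding root_def
proof (rule the_equality)
  fix z assume z: "z \<in> M \<and> z \<otimes> z = x"
  then have "3/2 * \<delta> z y \<le> \<delta> x x" using square_expands [of z y] assms by auto
  then have "\<delta> z y \<le> 0" using assms by simp
  then show "z = y" using nonneg [of z y] zero [of z y] z assms by auto
qed (use assms in auto)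

text \<open>The functional equation of \<open>t \<mapsto> x\<^sup>t\<close>, iterated from an arbitrary path.\<close>

primrec approx :: "nat \<Rightarrow> real \<times> 'a \<Rightarrow> 'a" where
  "approx 0 = \<gamma>"
| "approx (Suc k) = (\<lambda>(t, x). if t \<le> 1/2 then approx k (2 * t, root x) else root x \<otimes> approx k (2 * t - 1, root x))"

text \<open>The factor 4 anticipates \<open>approx_bound\<close>: the approximate powers of
  \<open>x\<close> stay within four times the distance of \<open>x\<close> from the unit, and their
  products with roots must remain in \<open>M\<close>, where the estimates hold.\<close>

lemma radius_exists:
  obtains \<kappa> where "\<kappa> > 0"
    "\<And>x y. \<lbrakk>x \<in> near (4 * \<kappa>); y \<in> near (4 * \<kappa>)\<rbrakk> \<Longrightarrow> x \<otimes> y \<in> M"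
    "\<And>g x. \<lbrakk>g \<in> carrier G; x \<in> near \<kappa>\<rbrakk> \<Longrightarrow> g \<otimes> x \<otimes> inv g \<in> M"
    "\<And>x. x \<in> near \<kappa> \<Longrightarrow> \<exists>y\<in>M. y \<otimes> y = x"
proof -
  obtain O1 where O1: "openin T O1" "\<one> \<in> O1" "O1 \<subseteq> M" using M_nhd by blast
  define W where "W = {z \<in> topspace (prod_topology T T). fst z \<otimes> snd z \<in> O1}"
  have W: "openin (prod_topology T T) W"
    unfolding W_def by (rule openin_continuous_map_preimage [OF mult_cont O1(1)])
  have "(\<one>, \<one>) \<in> W"
    using O1 topspace_T by (simp add: W_def)
  from W [unfolded openin_prod_topology_alt, rule_format, OF this]
  obtain U V where UV: "openin T U" "openin T V" "\<one> \<in> U" "\<one> \<in> V" "U \<times> V \<subseteq> W"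
    by blast
  obtain V1 where V1: "openin T V1" "\<one> \<in> V1" "\<And>g x. g \<in> carrier G \<Longrightarrow> x \<in> V1 \<Longrightarrow> g \<otimes> x \<otimes> inv g \<in> O1"
    using conj_small [OF O1(1,2)] by blast
  obtain V2 where V2: "openin T V2" "\<one> \<in> V2" "\<And>x. x \<in> V2 \<Longrightarrow> \<exists>y\<in>M. y \<otimes> y = x"
    using square_open by blast
  have "openin T (U \<inter> V \<inter> V1 \<inter> V2)" "\<one> \<in> U \<inter> V \<inter> V1 \<inter> V2" using UV V1 V2 by auto
  then obtain \<rho> where \<rho>: "\<rho> > 0" "near \<rho> \<subseteq> U \<inter> V \<inter> V1 \<inter> V2" using near_subset by blast
  show ?thesis
  proof
    show "\<rho> / 4 > 0" using \<rho> by simp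
    show "x \<otimes> y \<in> M" if "x \<in> near (4 * (\<rho> / 4))" "y \<in> near (4 * (\<rho> / 4))" for x y
    proof -
      have "(x, y) \<in> U \<times> V" using that \<rho>(2) by auto
      then have "(x, y) \<in> W" using UV(5) by blast
      then show ?thesis using O1(3) by (auto simp: W_def)
    qed
    have sub: "near (\<rho> / 4) \<subseteq> near \<rho>" using \<rho>(1) by (auto simp: near_def)
    show "g \<otimes> x \<otimes> inv g \<in> M" if "g \<in> carrier G" "x \<in> near (\<rho> / 4)" for g x
      using V1(3) [of g x] that \<rho>(2) sub O1(3) by blast
    show "\<exists>y\<in>M. y \<otimes> y = x" if "x \<in> near (\<rho> / 4)" for x
      using V2(3) [of x] that \<rho>(2) sub by blast
  qed
qed

text \<open>\<open>h\<close> is the uniform limit of \<open>approx\<close>. The approximations start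
  from an arbitrary path, so equivariance is established for the limit only: the functional
  equations \<open>h_left\<close> and \<open>h_right\<close> propagate it from the exponents 0 and 1
  to the dyadic ones, and continuity in \<open>t\<close> to the whole interval.\<close>

theorem local_equivariant_contraction:
  obtains K h where "closedin T K" "\<exists>V. openin T V \<and> \<one> \<in> V \<and> V \<subseteq> K"
    "\<And>g x. g \<in> carrier G \<Longrightarrow> x \<in> K \<Longrightarrow> g \<otimes> x \<otimes> inv g \<in> K"
    "continuous_map (prod_topology II (subtopology T K)) T h"
    "\<And>x. x \<in> K \<Longrightarrow> h (0, x) = \<one>" "\<And>x. x \<in> K \<Longrightarrow> h (1, x) = x"
    "\<And>t. t \<in> {0..1} \<Longrightarrow> h (t, \<one>) = \<one>"
    "\<And>g t x. g \<in> carrier G \<Longrightarrow> t \<in> {0..1} \<Longrightarrow> x \<in> K \<Longrightarrow> h (t, g \<otimes> x \<otimes> inv g) = g \<otimes> h (t, x) \<otimes> inv g"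
proof -
  obtain \<kappa> where \<kappa>: "\<kappa> > 0"
    and mM: "\<And>x y. \<lbrakk>x \<in> near (4 * \<kappa>); y \<in> near (4 * \<kappa>)\<rbrakk> \<Longrightarrow> x \<otimes> y \<in> M"
    and cM: "\<And>g x. \<lbrakk>g \<in> carrier G; x \<in> near \<kappa>\<rbrakk> \<Longrightarrow> g \<otimes> x \<otimes> inv g \<in> M"
    and sqrt: "\<And>x. x \<in> near \<kappa> \<Longrightarrow> \<exists>y\<in>M. y \<otimes> y = x"
    using radius_exists by blast
  have rootM: "root x \<in> M" "root x \<otimes> root x = x" if "x \<in> near \<kappa>" for x
  proof -
    obtain y where y: "y \<in> M" "y \<otimes> y = x" using sqrt \<open>x \<in> near \<kappa>\<close> by blast
    have "x \<in> M" using \<open>x \<in> near \<kappa>\<close> by (simp add: near_def)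
    from root_unique [OF this y] y show "root x \<in> M" "root x \<otimes> root x = x" by auto
  qed
  have nearM: "x \<in> M" if "x \<in> near a" for x a using that by (simp add: near_def)
  have root_dist: "\<delta> (root x) (root y) \<le> 2/3 * \<delta> x y" if "x \<in> near \<kappa>" "y \<in> near \<kappa>" for x y
    using square_expands [of "root x" "root y"] rootM that nearM by simp
  have one\<kappa>: "\<one> \<in> near \<kappa>" using one_near \<kappa> by simp
  have root_one: "root \<one> = \<one>" by (rule root_unique) (use one_M in auto)
  have root_small: "\<delta> (root x) \<one> \<le> 2/3 * \<delta> x \<one>" if "x \<in> near \<kappa>" for x
    using root_dist [OF that one\<kappa>] root_one by simp
  have root_near: "root x \<in> near \<kappa>" if "x \<in> near \<kappa>" for x
  proof -
    have "\<delta> x \<one> \<le> \<kappa>" using that by (simp add: near_def)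
    then show ?thesis using root_small [OF that] rootM [OF that] \<kappa> by (simp add: near_def)
  qed
  \<comment> \<open>The metric need not be invariant under conjugation. \<open>K\<close> is the
    largest conjugation-invariant subset of \<open>near \<kappa>\<close>; it is closed as an
    intersection of closed sets, and a neighbourhood of the unit by
    \<open>conj_small\<close>.\<close>
  define K where "K = {x \<in> carrier G. \<forall>g\<in>carrier G. g \<otimes> x \<otimes> inv g \<in> near \<kappa>}"
  have K\<kappa>: "x \<in> near \<kappa>" if "x \<in> K" for x
    using that by (force simp: K_def dest: bspec [where x = \<one>])
  have KG: "x \<in> carrier G" if "x \<in> K" for x using that by (simp add: K_def)
  have K_conj: "g \<otimes> x \<otimes> inv g \<in> K" if "g \<in> carrier G" "x \<in> K" for g x
    using that conj_conj by (auto simp: K_def)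
  have root_conj: "root (g \<otimes> x \<otimes> inv g) = g \<otimes> root x \<otimes> inv g" if g: "g \<in> carrier G" and x: "x \<in> K" for g x
  proof (rule root_unique)
    show "g \<otimes> x \<otimes> inv g \<in> M" using K\<kappa> [OF K_conj [OF that]] nearM by blast
    show "g \<otimes> root x \<otimes> inv g \<in> M" by (rule cM [OF g root_near [OF K\<kappa> [OF x]]])
    have "root x \<in> carrier G" using rootM(1) [OF K\<kappa> [OF x]] M_carrier by blast
    then show "g \<otimes> root x \<otimes> inv g \<otimes> (g \<otimes> root x \<otimes> inv g) = g \<otimes> x \<otimes> inv g"
      using conj_mult [OF g, of "root x" "root x"] rootM(2) [OF K\<kappa> [OF x]] by simp
  qed
  have root_K: "root x \<in> K" if x: "x \<in> K" for x
    unfolding K_def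
  proof (intro CollectI conjI ballI)
    show "root x \<in> carrier G" using rootM(1) [OF K\<kappa> [OF x]] M_carrier by blast
    show "g \<otimes> root x \<otimes> inv g \<in> near \<kappa>" if "g \<in> carrier G" for g
      using root_near [OF K\<kappa> [OF K_conj [OF that x]]] root_conj [OF that x] by simp
  qed
  have one_K: "\<one> \<in> K" using one\<kappa> by (simp add: K_def)
  have K_closed: "closedin T K"
  proof -
    have "K = (\<Inter>g\<in>carrier G. {x \<in> topspace T. g \<otimes> x \<otimes> inv g \<in> near \<kappa>})"
      using topspace_T by (auto simp: K_def)
    moreover have "closedin T {x \<in> topspace T. g \<otimes> x \<otimes> inv g \<in> near \<kappa>}" if "g \<in> carrier G" for g
      by (rule closedin_continuous_map_preimage [OF _ near_closed])
        (use that topspace_T in \<open>intro continuous_map_conj; simp\<close>)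
    ultimately show ?thesis using one_closed by (auto intro!: closedin_Inter)
  qed
  have K_nhd: "\<exists>V. openin T V \<and> \<one> \<in> V \<and> V \<subseteq> K"
  proof -
    obtain V where V: "openin T V" "\<one> \<in> V" "V \<subseteq> near \<kappa>" using near_nhd [OF \<kappa>] by blast
    obtain W where "openin T W" "\<one> \<in> W" "\<And>g x. g \<in> carrier G \<Longrightarrow> x \<in> W \<Longrightarrow> g \<otimes> x \<otimes> inv g \<in> V"
      using conj_small [OF V(1,2)] by blast
    then show ?thesis using V(3) openin_subset topspace_T by (intro exI [of _ W]) (fastforce simp: K_def)
  qed
  let ?K = "subtopology T K" and ?P = "prod_topology II (subtopology T K)"
  have tK: "topspace ?K = K" using KG topspace_T by auto
  have KM: "x \<in> M" if "x \<in> K" for x using K\<kappa> [OF that] nearM by blast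
  have root_cont: "continuous_map ?K ?K root"
  proof -
    have "continuous_map ?K mtopology root"
      unfolding continuous_map_to_metric
    proof (intro ballI allI impI)
      fix x and \<epsilon> :: real assume "x \<in> topspace ?K" and \<epsilon>: "0 < \<epsilon>"
      then have x: "x \<in> K" using tK by simp
      let ?U = "{y \<in> topspace ?K. \<delta> x y \<in> {..<\<epsilon>}}"
      have "continuous_map ?K euclideanreal (\<delta> x)"
        by (rule continuous_map_from_subtopology_mono [OF dist_cont [OF KM [OF x]]]) (use KM in blast)
      then have "openin ?K ?U" by (rule openin_continuous_map_preimage) auto
      moreover have "x \<in> ?U" using x tK KM \<epsilon> by simp
      moreover have "root y \<in> mball (root x) \<epsilon>" if "y \<in> ?U" for y
      proof -
        have y: "y \<in> K" "\<delta> x y < \<epsilon>" using that tK by auto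
        have "\<delta> (root x) (root y) \<le> \<delta> x y" using root_dist [OF K\<kappa> [OF x] K\<kappa> [OF y(1)]] nonneg [of x y] by linarith
        then show ?thesis using y rootM(1) K\<kappa> x by auto
      qed
      ultimately show "\<exists>U. openin ?K U \<and> x \<in> U \<and> (\<forall>y\<in>U. root y \<in> mball (root x) \<epsilon>)" by blast
    qed
    then have "continuous_map ?K T root" using mtopology_eq continuous_map_into_fulltopology by metis
    then show ?thesis using root_K tK by (auto simp: continuous_map_in_subtopology)
  qed
  have prodM: "root x \<otimes> y \<in> M" if "x \<in> K" "y \<in> M" "\<delta> y \<one> \<le> 4 * \<delta> (root x) \<one>" for x y
  proof (rule mM)
    have "root x \<in> near \<kappa>" by (rule root_near [OF K\<kappa> [OF that(1)]])
    then have "\<delta> (root x) \<one> \<le> \<kappa>" "root x \<in> M" by (auto simp: near_def)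
    then show "root x \<in> near (4 * \<kappa>)" "y \<in> near (4 * \<kappa>)" using that \<kappa> by (auto simp: near_def)
  qed
  have mult_est: "\<delta> (root x \<otimes> y) (root x \<otimes> z) \<le> 5/4 * \<delta> y z"
    if "x \<in> K" "y \<in> M" "\<delta> y \<one> \<le> 4 * \<delta> (root x) \<one>" "z \<in> M" "\<delta> z \<one> \<le> 4 * \<delta> (root x) \<one>" for x y z
    by (rule mult_Lipschitz) (use that prodM rootM K\<kappa> in auto)
  \<comment> \<open>The constant 4 reproduces itself: multiplication by \<open>root x\<close> turns
    a bound of 4 times \<open>\<delta> (root x) \<one>\<close> into \<open>5/4 * 4 + 1 = 6\<close>
    times, and \<open>6 * 2/3 = 4\<close> in terms of \<open>\<delta> x \<one>\<close>.\<close>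
  have approx_bound: "approx k (t, x) \<in> M \<and> \<delta> (approx k (t, x)) \<one> \<le> 4 * \<delta> x \<one>"
    if "x \<in> K" "t \<in> {0..1}" for k t x
    using that
  proof (induction k arbitrary: t x)
    case 0
    then have "(t, x) \<in> topspace (prod_topology II (subtopology T M))" using KM KG topspace_T by auto
    then have "\<gamma> (t, x) \<in> topspace (subtopology T M)" using path_cont unfolding continuous_map_def by blast
    then have "\<gamma> (t, x) \<in> M" by simp
    moreover have "\<delta> (\<gamma> (t, x)) \<one> \<le> 4 * \<delta> x \<one>" using path_dist [of x t] 0 KM nonneg [of x \<one>] by (smt (verit))
    ultimately show ?case by simp
  next
    case (Suc k)
    note rs = root_small [OF K\<kappa> [OF Suc.prems(1)]]
    have r: "root x \<in> K" "root x \<in> M" using root_K Suc.prems rootM K\<kappa> by auto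
    show ?case
    proof (cases "t \<le> 1/2")
      case True
      have t: "2 * t \<in> {0..1}" using True Suc.prems by auto
      have "4 * \<delta> (root x) \<one> \<le> 4 * \<delta> x \<one>" using rs nonneg [of x \<one>] by linarith
      then show ?thesis using Suc.IH [OF r(1) t] True by auto
    next
      case False
      have t: "2 * t - 1 \<in> {0..1}" using False Suc.prems by auto
      let ?y = "approx k (2 * t - 1, root x)"
      have y: "?y \<in> M" "\<delta> ?y \<one> \<le> 4 * \<delta> (root x) \<one>" using Suc.IH [OF r(1) t] by auto
      have p: "root x \<otimes> ?y \<in> M" by (rule prodM [OF Suc.prems(1) y])
      have rc: "root x \<in> carrier G" using r(2) M_carrier by blast
      have "\<delta> (root x \<otimes> ?y) \<one> \<le> \<delta> (root x \<otimes> ?y) (root x \<otimes> \<one>) + \<delta> (root x) \<one>"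
        using triangle [OF p r(2) one_M] rc by simp
      also have "\<delta> (root x \<otimes> ?y) (root x \<otimes> \<one>) \<le> 5/4 * \<delta> ?y \<one>"
        by (rule mult_est [OF Suc.prems(1) y one_M]) (use one_M in simp)
      finally have "\<delta> (root x \<otimes> ?y) \<one> \<le> 6 * \<delta> (root x) \<one>" using y(2) by linarith
      then have "\<delta> (root x \<otimes> ?y) \<one> \<le> 4 * \<delta> x \<one>" using rs by linarith
      then show ?thesis using p False by simp
    qed
  qed
  have approx_01: "approx k (0, x) = \<one>" "approx k (1, x) = x" if "x \<in> K" for k x
    using that
  proof (induction k arbitrary: x)
    case (Suc k)
    { case 1 then show ?case using Suc.IH(1) [OF root_K] by simp }
    { case 2 then show ?case using Suc.IH(2) [OF root_K] rootM(2) K\<kappa> by simp }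
  qed (use path_0 path_1 KM in auto)
  have pI: "continuous_map ?P euclideanreal fst"
    by (rule continuous_map_II_euclidean [OF continuous_map_fst])
  have pr: "continuous_map ?P ?K (\<lambda>z. root (snd z))"
    by (rule continuous_map_comp [OF root_cont continuous_map_snd])
  have approx_cont: "continuous_map ?P T (approx k)" for k
  proof (induction k)
    case 0
    have "continuous_map ?P (subtopology T M) (\<lambda>z. \<gamma> (fst z, snd z))"
    proof (rule continuous_map_comp [OF path_cont], intro continuous_map_pairedI continuous_map_fst)
      show "continuous_map ?P (subtopology T M) snd"
        using KM tK continuous_map_into_fulltopology [OF continuous_map_snd [of II ?K]]
        by (force simp: continuous_map_in_subtopology)
    qed
    then show ?case using continuous_map_into_fulltopology by fastforce
  next
    case (Suc k)
    let ?L = "subtopology ?P {z \<in> topspace ?P. fst z \<le> 1/2}"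
    let ?R = "subtopology ?P {z \<in> topspace ?P. 1/2 \<le> fst z}"
    have "continuous_map ?P T (\<lambda>z. if fst z \<le> 1/2 then approx k (2 * fst z, root (snd z))
        else root (snd z) \<otimes> approx k (2 * fst z - 1, root (snd z)))"
    proof (rule continuous_map_II_split [OF pI])
      show "continuous_map ?L T (\<lambda>z. approx k (2 * fst z, root (snd z)))"
        by (rule continuous_map_comp [OF Suc.IH], intro continuous_map_pairedI continuous_map_II continuous_map_real_mult
          continuous_map_from_subtopology [OF pI] continuous_map_from_subtopology [OF pr]) auto
      have "continuous_map ?R T (\<lambda>z. approx k (2 * fst z - 1, root (snd z)))"
        by (rule continuous_map_comp [OF Suc.IH], intro continuous_map_pairedI continuous_map_II continuous_map_real_mult
          continuous_map_diff continuous_map_from_subtopology [OF pI] continuous_map_from_subtopology [OF pr]) auto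
      then show "continuous_map ?R T (\<lambda>z. root (snd z) \<otimes> approx k (2 * fst z - 1, root (snd z)))"
        by (intro continuous_map_mult2 continuous_map_into_fulltopology [OF continuous_map_from_subtopology [OF pr]])
      fix z assume z: "z \<in> topspace ?P" "fst z = 1/2"
      have "2 * fst z = 1" "2 * fst z - 1 = 0" using z(2) by simp_all
      moreover have r: "root (snd z) \<in> K" using z(1) tK root_K by auto
      moreover have "root (snd z) \<in> carrier G" using r KG by blast
      ultimately show "approx k (2 * fst z, root (snd z)) = root (snd z) \<otimes> approx k (2 * fst z - 1, root (snd z))"
        using approx_01 [OF r, of k] by (metis r_one)
    qed
    then show ?case by (simp add: case_prod_unfold)
  qed
  \<comment> \<open>The ratio 5/6 is 2/3 from the root times 5/4 from the multiplication; 8 is twice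
    the bound 4 of \<open>approx_bound\<close>.\<close>
  have approx_step: "\<delta> (approx (Suc k) (t, x)) (approx k (t, x)) \<le> 8 * \<delta> x \<one> * (5/6) ^ k"
    if "x \<in> K" "t \<in> {0..1}" for k t x
    using that
  proof (induction k arbitrary: t x)
    case 0
    have "\<delta> (approx (Suc 0) (t, x)) (approx 0 (t, x)) \<le> \<delta> (approx (Suc 0) (t, x)) \<one> + \<delta> (approx 0 (t, x)) \<one>"
      using triangle [of "approx (Suc 0) (t, x)" \<one> "approx 0 (t, x)"] approx_bound [OF 0] one_M commute by metis
    moreover have "\<delta> (approx 0 (t, x)) \<one> \<le> 4 * \<delta> x \<one>" "\<delta> (approx (Suc 0) (t, x)) \<one> \<le> 4 * \<delta> x \<one>"
      using approx_bound [OF 0] by blast+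
    ultimately show ?case unfolding power_0 mult_1_right by linarith
  next
    case (Suc k)
    note rs = root_small [OF K\<kappa> [OF Suc.prems(1)]]
    have r: "root x \<in> K" using root_K Suc.prems by auto
    have q: "(0::real) \<le> (5/6) ^ k" by simp
    have b: "5/4 * (8 * \<delta> (root x) \<one> * (5/6) ^ k) \<le> 8 * \<delta> x \<one> * (5/6) ^ Suc k"
      using mult_right_mono [OF rs q] by (simp add: algebra_simps)
    show ?case
    proof (cases "t \<le> 1/2")
      case True
      have t: "2 * t \<in> {0..1}" using True Suc.prems by auto
      have eq: "approx (Suc (Suc k)) (t, x) = approx (Suc k) (2 * t, root x)" "approx (Suc k) (t, x) = approx k (2 * t, root x)"
        using True by (simp_all del: approx.simps add: approx.simps(2) [of "Suc k"] approx.simps(2) [of k])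
      have "0 \<le> 8 * \<delta> (root x) \<one> * (5/6) ^ k" by simp
      then show ?thesis using Suc.IH [OF r t] b unfolding eq by linarith
    next
      case False
      have t: "2 * t - 1 \<in> {0..1}" using False Suc.prems by auto
      have eq: "approx (Suc (Suc k)) (t, x) = root x \<otimes> approx (Suc k) (2 * t - 1, root x)"
          "approx (Suc k) (t, x) = root x \<otimes> approx k (2 * t - 1, root x)"
        using False by (simp_all del: approx.simps add: approx.simps(2) [of "Suc k"] approx.simps(2) [of k])
      have "\<delta> (root x \<otimes> approx (Suc k) (2 * t - 1, root x)) (root x \<otimes> approx k (2 * t - 1, root x))
          \<le> 5/4 * \<delta> (approx (Suc k) (2 * t - 1, root x)) (approx k (2 * t - 1, root x))"
        using mult_est [OF Suc.prems(1)] approx_bound [OF r t] by blast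
      then show ?thesis using Suc.IH [OF r t] b unfolding eq by linarith
    qed
  qed
  \<comment> \<open>Here \<open>48 = 8 / (1 - 5/6)\<close>. Writing the partial geometric sum as a
    difference of powers makes the induction on \<open>j\<close> exact.\<close>
  have approx_Cauchy: "\<delta> (approx (k + j) z) (approx k z) \<le> 48 * \<kappa> * ((5/6) ^ k - (5/6) ^ (k + j))"
    if z: "z \<in> topspace ?P" for k j z
  proof (induction j)
    case 0
    obtain t x where "z = (t, x)" "x \<in> K" "t \<in> {0..1}" using z tK by (cases z) auto
    then show ?case using approx_bound [of x t k] by simp
  next
    case (Suc j)
    obtain t x where tx: "z = (t, x)" "x \<in> K" "t \<in> {0..1}" using z tK by (cases z) auto
    have "\<delta> x \<one> \<le> \<kappa>" using K\<kappa> [OF tx(2)] by (simp add: near_def)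
    then have "8 * \<delta> x \<one> * (5/6) ^ (k + j) \<le> 8 * \<kappa> * (5/6) ^ (k + j)"
      by (intro mult_right_mono mult_left_mono) auto
    then have "\<delta> (approx (Suc (k + j)) z) (approx (k + j) z) \<le> 8 * \<kappa> * (5/6) ^ (k + j)"
      using approx_step [OF tx(2,3), of "k + j"] unfolding tx(1) by linarith
    moreover have "\<delta> (approx (k + Suc j) z) (approx k z) \<le> \<delta> (approx (Suc (k + j)) z) (approx (k + j) z) + \<delta> (approx (k + j) z) (approx k z)"
      using triangle approx_bound [OF tx(2,3)] tx(1) by (simp del: approx.simps)
    ultimately show ?case using Suc.IH by (simp del: approx.simps add: algebra_simps)
  qed
  obtain h where hc: "continuous_map ?P mtopology h"
    and hlim: "\<And>\<epsilon>. 0 < \<epsilon> \<Longrightarrow> \<forall>\<^sub>F n in sequentially. \<forall>z\<in>topspace ?P. \<delta> (approx n z) (h z) < \<epsilon>"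
  proof (rule continuous_map_uniformly_Cauchy_limit [OF mcomplete_M, of ?P approx])
    have "continuous_map ?P mtopology (approx n)" for n
      unfolding mtopology_eq continuous_map_in_subtopology
      using approx_cont [of n] approx_bound tK by auto
    then show "\<forall>\<^sub>F n in sequentially. continuous_map ?P mtopology (approx n)" by simp
    fix \<epsilon> :: real assume \<epsilon>: "\<epsilon> > 0"
    obtain N where N: "(5/6) ^ N < \<epsilon> / (48 * \<kappa>)"
      using real_arch_pow_inv [of "\<epsilon> / (48 * \<kappa>)" "5/6"] \<epsilon> \<kappa> by auto
    have *: "\<delta> (approx m z) (approx n z) < \<epsilon>" if "N \<le> n" "n \<le> m" "z \<in> topspace ?P" for m n z
    proof -
      obtain j where m: "m = n + j" using \<open>n \<le> m\<close> le_Suc_ex by blast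
      have "\<delta> (approx m z) (approx n z) \<le> 48 * \<kappa> * ((5/6) ^ n - (5/6) ^ (n + j))"
        using approx_Cauchy [OF that(3)] m by blast
      also have "\<dots> \<le> 48 * \<kappa> * (5/6) ^ N"
      proof (intro mult_left_mono)
        have "(5/6::real) ^ n \<le> (5/6) ^ N" by (rule power_decreasing) (use that in auto)
        moreover have "0 \<le> (5/6::real) ^ (n + j)" by simp
        ultimately show "(5/6::real) ^ n - (5/6) ^ (n + j) \<le> (5/6) ^ N" by linarith
      qed (use \<kappa> in auto)
      also have "\<dots> < \<epsilon>" using N \<kappa> by (simp add: field_simps)
      finally show ?thesis .
    qed
    show "\<exists>N. \<forall>m n z. N \<le> m \<longrightarrow> N \<le> n \<longrightarrow> z \<in> topspace ?P \<longrightarrow> \<delta> (approx m z) (approx n z) < \<epsilon>"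
    proof (intro exI [of _ N] allI impI)
      fix m n z assume "N \<le> m" "N \<le> n" "z \<in> topspace ?P"
      then show "\<delta> (approx m z) (approx n z) < \<epsilon>"
        using * [of n m z] * [of m n z] commute by (metis nat_le_linear)
    qed
  qed (rule that, assumption+)
  have hM: "h (t, x) \<in> M" if "x \<in> K" "t \<in> {0..1}" for t x
    using hc that tK by (auto simp: continuous_map_def Pi_iff)
  have h_approx: "\<exists>N. \<forall>n\<ge>N. \<forall>t\<in>{0..1}. \<forall>x\<in>K. \<delta> (approx n (t, x)) (h (t, x)) < \<epsilon>" if "\<epsilon> > 0" for \<epsilon>
    using hlim [OF that] tK by (auto simp: eventually_sequentially)
  \<comment> \<open>The factor 3 leaves room for two approximation errors, one of them enlarged by
    5/4.\<close>
  have eqI: "a = b" if "a \<in> M" "b \<in> M" "\<And>\<epsilon>. \<epsilon> > 0 \<Longrightarrow> \<delta> a b < 3 * \<epsilon>" for a b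
  proof (rule ccontr)
    assume "a \<noteq> b"
    then have "\<delta> a b > 0" using that zero [of a b] nonneg [of a b] by linarith
    from that(3) [of "\<delta> a b / 3"] this show False by simp
  qed
  have h_bound: "\<delta> (h (t, x)) \<one> \<le> 4 * \<delta> x \<one>" if "x \<in> K" "t \<in> {0..1}" for t x
  proof (rule field_le_epsilon)
    fix \<epsilon> :: real assume "\<epsilon> > 0"
    from h_approx [OF this] obtain n where n: "\<forall>t\<in>{0..1}. \<forall>x\<in>K. \<delta> (approx n (t, x)) (h (t, x)) < \<epsilon>" by blast
    have a: "approx n (t, x) \<in> M" "\<delta> (approx n (t, x)) \<one> \<le> 4 * \<delta> x \<one>" using approx_bound [OF that, of n] by blast+
    show "\<delta> (h (t, x)) \<one> \<le> 4 * \<delta> x \<one> + \<epsilon>"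
      using triangle [OF hM [OF that] a(1) one_M] commute [of "h (t, x)" "approx n (t, x)"] n [rule_format, OF that(2,1)] a(2)
      by linarith
  qed
  have h_left: "h (t, x) = h (2 * t, root x)" if x: "x \<in> K" and t: "t \<in> {0..1}" "t \<le> 1/2" for t x
  proof (rule eqI)
    have t2: "2 * t \<in> {0..1}" using t by auto
    show M: "h (t, x) \<in> M" "h (2 * t, root x) \<in> M" using hM x t t2 root_K by auto
    fix \<epsilon> :: real assume "\<epsilon> > 0"
    from h_approx [OF this] obtain N where N: "\<And>n t x. n \<ge> N \<Longrightarrow> t \<in> {0..1} \<Longrightarrow> x \<in> K \<Longrightarrow> \<delta> (approx n (t, x)) (h (t, x)) < \<epsilon>"
      by blast
    have eq: "approx (Suc N) (t, x) = approx N (2 * t, root x)" using t by simp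
    have "\<delta> (h (t, x)) (h (2 * t, root x)) \<le> \<delta> (approx (Suc N) (t, x)) (h (t, x)) + \<delta> (approx N (2 * t, root x)) (h (2 * t, root x))"
      using triangle [OF M(1) _ M(2), of "approx (Suc N) (t, x)"] approx_bound [OF x t(1), of "Suc N"]
        commute [of "h (t, x)" "approx (Suc N) (t, x)"] unfolding eq by linarith
    then show "\<delta> (h (t, x)) (h (2 * t, root x)) < 3 * \<epsilon>"
      using N [OF le_SucI [OF le_refl] t(1) x] N [OF le_refl t2 root_K [OF x]] \<open>\<epsilon> > 0\<close> by linarith
  qed
  have h_right: "h (t, x) = root x \<otimes> h (2 * t - 1, root x)" if x: "x \<in> K" and t: "t \<in> {0..1}" "1/2 < t" for t x
  proof (rule eqI)
    have t2: "2 * t - 1 \<in> {0..1}" using t by auto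
    have r: "root x \<in> K" using root_K x by simp
    show M: "h (t, x) \<in> M" "root x \<otimes> h (2 * t - 1, root x) \<in> M"
      using hM x t t2 r prodM h_bound by auto
    fix \<epsilon> :: real assume \<epsilon>: "\<epsilon> > 0"
    from h_approx [OF this] obtain N where N: "\<And>n t x. n \<ge> N \<Longrightarrow> t \<in> {0..1} \<Longrightarrow> x \<in> K \<Longrightarrow> \<delta> (approx n (t, x)) (h (t, x)) < \<epsilon>"
      by blast
    have eq: "approx (Suc N) (t, x) = root x \<otimes> approx N (2 * t - 1, root x)" using t by simp
    have "\<delta> (root x \<otimes> approx N (2 * t - 1, root x)) (root x \<otimes> h (2 * t - 1, root x)) \<le> 5/4 * \<delta> (approx N (2 * t - 1, root x)) (h (2 * t - 1, root x))"
      using mult_est [OF x] approx_bound [OF r t2] hM [OF r t2] h_bound [OF r t2] by blast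
    moreover have "\<delta> (h (t, x)) (root x \<otimes> h (2 * t - 1, root x)) \<le> \<delta> (approx (Suc N) (t, x)) (h (t, x)) + \<delta> (root x \<otimes> approx N (2 * t - 1, root x)) (root x \<otimes> h (2 * t - 1, root x))"
      using triangle [OF M(1) _ M(2), of "approx (Suc N) (t, x)"] approx_bound [OF x t(1), of "Suc N"]
        commute [of "h (t, x)" "approx (Suc N) (t, x)"] unfolding eq by linarith
    moreover have "\<delta> (approx (Suc N) (t, x)) (h (t, x)) < \<epsilon>" "\<delta> (approx N (2 * t - 1, root x)) (h (2 * t - 1, root x)) < \<epsilon>"
      using N [OF le_SucI [OF le_refl] t(1) x] N [OF le_refl t2 r] by blast+
    ultimately show "\<delta> (h (t, x)) (root x \<otimes> h (2 * t - 1, root x)) < 3 * \<epsilon>" using \<epsilon> by linarith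
  qed
  have h0: "h (0, x) = \<one>" and h1: "h (1, x) = x" if x: "x \<in> K" for x
  proof -
    have *: "h (t, x) = y" if t: "t \<in> {0..1}" and y: "\<And>n. approx n (t, x) = y" for t y
    proof (rule eqI)
      show "h (t, x) \<in> M" "y \<in> M" using hM [OF x t] approx_bound [OF x t] y by metis+
      fix \<epsilon> :: real assume \<epsilon>: "\<epsilon> > 0"
      from h_approx [OF this] obtain n where "\<forall>t\<in>{0..1}. \<forall>x\<in>K. \<delta> (approx n (t, x)) (h (t, x)) < \<epsilon>" by blast
      then show "\<delta> (h (t, x)) y < 3 * \<epsilon>" using y [of n] commute [of "h (t, x)" y] t x \<epsilon> by fastforce
    qed
    show "h (0, x) = \<one>" "h (1, x) = x" using * approx_01 [OF x] by auto
  qed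
  have hT: "continuous_map ?P T h" using hc mtopology_eq continuous_map_into_fulltopology by metis
  have hG: "h (t, x) \<in> carrier G" if "x \<in> K" "t \<in> {0..1}" for t x using hM [OF that] M_carrier by blast
  define E where "E = {t \<in> {0..1}. \<forall>x\<in>K. \<forall>g\<in>carrier G. h (t, g \<otimes> x \<otimes> inv g) = g \<otimes> h (t, x) \<otimes> inv g}"
  have E01: "0 \<in> E" "1 \<in> E" using h0 h1 K_conj by (auto simp: E_def)
  have E_half: "t / 2 \<in> E" if t: "t \<in> E" for t
    using t h_left root_K root_conj K_conj by (auto simp: E_def)
  \<comment> \<open>For \<open>t = 0\<close> the exponent is 1/2, where \<open>h_right\<close> does
    not apply; 1/2 is obtained by halving 1 instead.\<close>
  have E_half': "(t + 1) / 2 \<in> E" if t: "t \<in> E" "t > 0" for t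
    unfolding E_def
  proof (intro CollectI conjI ballI)
    have t': "(t + 1) / 2 \<in> {0..1}" "1/2 < (t + 1) / 2" "2 * ((t + 1) / 2) - 1 = t" "t \<in> {0..1}" using t by (auto simp: E_def field_simps)
    show "(t + 1) / 2 \<in> {0..1}" by (rule t')
    fix x g assume x: "x \<in> K" and g: "g \<in> carrier G"
    have "h ((t + 1) / 2, g \<otimes> x \<otimes> inv g) = root (g \<otimes> x \<otimes> inv g) \<otimes> h (t, root (g \<otimes> x \<otimes> inv g))"
      using h_right [OF K_conj [OF g x] t'(1,2)] unfolding t'(3) .
    also have "\<dots> = (g \<otimes> root x \<otimes> inv g) \<otimes> (g \<otimes> h (t, root x) \<otimes> inv g)"
      using root_conj [OF g x] t root_K [OF x] g by (simp add: E_def)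
    also have "\<dots> = g \<otimes> (root x \<otimes> h (t, root x)) \<otimes> inv g"
      by (rule conj_mult [symmetric]) (use g KG root_K x hG t' in auto)
    also have "root x \<otimes> h (t, root x) = h ((t + 1) / 2, x)"
      using h_right [OF x t'(1,2)] unfolding t'(3) by simp
    finally show "h ((t + 1) / 2, g \<otimes> x \<otimes> inv g) = g \<otimes> h ((t + 1) / 2, x) \<otimes> inv g" .
  qed
  have dyadic: "real j / 2 ^ m \<in> E" if "j \<le> 2 ^ m" for j m
    using that
  proof (induction m arbitrary: j)
    case 0 then have "j = 0 \<or> j = 1" by auto
    then show ?case using E01 by auto
  next
    case (Suc m)
    show ?case
    proof (cases "j \<le> 2 ^ m")
      case True
      from E_half [OF Suc.IH [OF this]] show ?thesis by (simp add: field_simps)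
    next
      case False
      then have j: "j - 2 ^ m \<le> 2 ^ m" "j - 2 ^ m > 0" using Suc.prems by auto
      have "real (j - 2 ^ m) / 2 ^ m > 0" using j by simp
      from E_half' [OF Suc.IH [OF j(1)] this] False show ?thesis by (simp add: field_simps of_nat_diff)
    qed
  qed
  have equivariant: "h (t, g \<otimes> x \<otimes> inv g) = g \<otimes> h (t, x) \<otimes> inv g"
    if g: "g \<in> carrier G" and t: "t \<in> {0..1}" and x: "x \<in> K" for g t x
  proof -
    have c1: "continuous_map II T (\<lambda>s. h (s, g \<otimes> x \<otimes> inv g))"
      by (rule continuous_map_comp [OF hT], intro continuous_map_pairedI) (use K_conj [OF g x] tK in auto)
    have c2: "continuous_map II T (\<lambda>s. g \<otimes> h (s, x) \<otimes> inv g)"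
    proof (rule continuous_map_conj)
      show "continuous_map II T (\<lambda>s. h (s, x))"
        by (rule continuous_map_comp [OF hT], intro continuous_map_pairedI) (use x tK in auto)
    qed (use g topspace_T in auto)
    let ?S = "{s \<in> topspace II. h (s, g \<otimes> x \<otimes> inv g) = g \<otimes> h (s, x) \<otimes> inv g}"
    have "closedin II ?S" by (rule closedin_continuous_maps_eq [OF Hausdorff_T c1 c2])
    then have S: "closed ?S" using closedin_closed_trans by blast
    \<comment> \<open>Dyadic approximations of \<open>t\<close> from below.\<close>
    define s where "s m = real (nat \<lfloor>t * 2 ^ m\<rfloor>) / 2 ^ m" for m
    have s_eq: "s m = of_int \<lfloor>t * 2 ^ m\<rfloor> / 2 ^ m" for m using t by (simp add: s_def)
    have "s m \<in> ?S" for m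
    proof -
      have "t * 2 ^ m \<le> 1 * 2 ^ m" by (rule mult_right_mono) (use t in auto)
      then have "\<lfloor>t * 2 ^ m\<rfloor> \<le> 2 ^ m"
        by (metis floor_mono floor_of_int mult_1 of_int_numeral of_int_power)
      then have "nat \<lfloor>t * 2 ^ m\<rfloor> \<le> 2 ^ m" by (simp add: nat_le_iff)
      from dyadic [OF this] show ?thesis using x g by (auto simp: s_def E_def)
    qed
    moreover have "s \<longlonglongrightarrow> t"
    proof (rule LIMSEQ_I)
      fix r :: real assume "r > 0"
      then obtain N where N: "(1/2) ^ N < r" using real_arch_pow_inv [of r "1/2"] by auto
      have "norm (s m - t) < r" if "m \<ge> N" for m
      proof -
        have "\<bar>of_int \<lfloor>t * 2 ^ m\<rfloor> - t * 2 ^ m\<bar> \<le> 1" by linarith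
        moreover have "s m - t = (of_int \<lfloor>t * 2 ^ m\<rfloor> - t * 2 ^ m) / 2 ^ m" by (simp add: s_eq field_simps)
        ultimately have "norm (s m - t) \<le> 1 / 2 ^ m" by (simp add: abs_divide divide_right_mono)
        also have "\<dots> = (1/2) ^ m" by (simp add: power_one_over)
        also have "\<dots> \<le> (1/2) ^ N" by (rule power_decreasing) (use that in auto)
        finally show ?thesis using N by linarith
      qed
      then show "\<exists>N. \<forall>m\<ge>N. norm (s m - t) < r" by blast
    qed
    ultimately have "t \<in> ?S" using closed_sequentially [OF S] by blast
    then show ?thesis by simp
  qed
  have h_one: "h (t, \<one>) = \<one>" if t: "t \<in> {0..1}" for t
    using h_bound [OF one_K t] hM [OF one_K t] one_M zero [of "h (t, \<one>)" \<one>] nonneg [of "h (t, \<one>)" \<one>] by simp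
  show ?thesis
    by (rule that [OF K_closed K_nhd K_conj hT h0 h1 h_one equivariant])
qed

end

section \<open>From a neighbourhood of the unit to the whole group\<close>

context compact_topological_group
begin

lemma regular_nhd:
  assumes "openin T V" "x \<in> V"
  obtains W C where "openin T W" "closedin T C" "x \<in> W" "W \<subseteq> C" "C \<subseteq> V"
proof -
  have "regular_space T" by (rule compact_Hausdorff_imp_regular_space [OF compact_T Hausdorff_T])
  then have "neighbourhood_base_of (closedin T) T" by (simp add: neighbourhood_base_of_closedin)
  then show ?thesis using assms that unfolding neighbourhood_base_of by blast
qed

text \<open>The supremum of a Urysohn function over each conjugacy class is a class function.
  Compactness of the group makes the supremum attained and continuous.\<close>

lemma class_function_exists:
  assumes V: "openin T V" "\<one> \<in> V"
  obtains w :: "'a \<Rightarrow> real" where "continuous_map T euclideanreal w" "\<And>x. x \<in> carrier G \<Longrightarrow> 0 \<le> w x" "w \<one> = 0"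
    "\<And>g x. g \<in> carrier G \<Longrightarrow> x \<in> carrier G \<Longrightarrow> w (g \<otimes> x \<otimes> inv g) = w x"
    "\<And>x. x \<in> carrier G \<Longrightarrow> w x < 1 \<Longrightarrow> x \<in> V"
proof -
  have "completely_regular_space T"
    by (intro normal_imp_completely_regular_space compact_Hausdorff_or_regular_imp_normal_space compact_T)
      (use Hausdorff_T in auto)
  moreover have "closedin T (topspace T - V)" by (intro closedin_diff closedin_topspace V)
  moreover have "\<one> \<in> topspace T - (topspace T - V)"
    using V topspace_T by auto
  ultimately obtain f where f: "continuous_map T II f" "f \<one> = 0" "f ` (topspace T - V) \<subseteq> {1}"
    unfolding completely_regular_space_def by blast
  have fR: "continuous_map T euclideanreal f" by (rule continuous_map_II_euclidean [OF f(1)])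
  have f01: "0 \<le> f x" "f x \<le> 1" if "x \<in> carrier G" for x
    using f(1) that topspace_T by (auto simp: continuous_map_def Pi_iff)
  define S where "S x = (\<lambda>g. f (g \<otimes> x \<otimes> inv g)) ` carrier G" for x
  define w where "w x = Sup (S x)" for x
  have bdd: "bdd_above (S x)" if "x \<in> carrier G" for x
    unfolding S_def using f01 that by (auto intro!: bdd_aboveI [where M = 1])
  have att: "\<exists>g\<in>carrier G. w x = f (g \<otimes> x \<otimes> inv g)" if x: "x \<in> carrier G" for x
  proof -
    have "continuous_map T euclideanreal (\<lambda>g. f (g \<otimes> x \<otimes> inv g))"
      by (rule continuous_map_comp [OF fR]) (use x topspace_T in \<open>intro continuous_map_conj; simp\<close>)
    then have "compactin euclideanreal (S x)"
      unfolding S_def using compact_T topspace_T image_compactin by (metis compact_space_def)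
    moreover have "S x \<noteq> {}" using one_closed by (auto simp: S_def)
    ultimately obtain s where "s \<in> S x" "\<And>t. t \<in> S x \<Longrightarrow> t \<le> s"
      using compact_attains_sup [of "S x"] by auto
    then have "w x = s" "s \<in> S x" unfolding w_def using cSup_eq_maximum by metis+
    then show ?thesis by (auto simp: S_def)
  qed
  have up: "f (g \<otimes> x \<otimes> inv g) \<le> w x" if "x \<in> carrier G" "g \<in> carrier G" for g x
    unfolding w_def by (rule cSup_upper [OF _ bdd [OF that(1)]]) (use that in \<open>auto simp: S_def\<close>)
  let ?F = "\<lambda>z. f (fst z \<otimes> snd z \<otimes> inv (fst z))"
  have Fc: "continuous_map (prod_topology T T) euclideanreal ?F"
    by (rule continuous_map_comp [OF fR]) (intro continuous_map_conj continuous_map_fst continuous_map_snd)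
  have wc: "continuous_map T euclideanreal w"
    unfolding continuous_map_upper_lower_semicontinuous_lt
  proof (intro conjI allI)
    fix c
    \<comment> \<open>Lower semicontinuity: a supremum exceeds \<open>c\<close> exactly when one of
      the continuous functions does.\<close>
    have "{x \<in> topspace T. c < w x} = (\<Union>g\<in>carrier G. {x \<in> topspace T. f (g \<otimes> x \<otimes> inv g) \<in> {c<..}})"
    proof (intro equalityI subsetI)
      fix x assume "x \<in> {x \<in> topspace T. c < w x}"
      then have x: "x \<in> carrier G" "c < w x" using topspace_T by auto
      obtain g where "g \<in> carrier G" "w x = f (g \<otimes> x \<otimes> inv g)" using att [OF x(1)] by blast
      then show "x \<in> (\<Union>g\<in>carrier G. {x \<in> topspace T. f (g \<otimes> x \<otimes> inv g) \<in> {c<..}})"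
        using x topspace_T by auto
    next
      fix x assume "x \<in> (\<Union>g\<in>carrier G. {x \<in> topspace T. f (g \<otimes> x \<otimes> inv g) \<in> {c<..}})"
      then obtain g where "g \<in> carrier G" "x \<in> carrier G" "c < f (g \<otimes> x \<otimes> inv g)" using topspace_T by auto
      then show "x \<in> {x \<in> topspace T. c < w x}" using up [of x g] topspace_T by auto
    qed
    moreover have "openin T {x \<in> topspace T. f (g \<otimes> x \<otimes> inv g) \<in> {c<..}}" if "g \<in> carrier G" for g
    proof (rule openin_continuous_map_preimage)
      show "continuous_map T euclideanreal (\<lambda>x. f (g \<otimes> x \<otimes> inv g))"
        by (rule continuous_map_comp [OF fR]) (use that topspace_T in \<open>intro continuous_map_conj; simp\<close>)
    qed auto
    ultimately show "openin T {x \<in> topspace T. c < w x}" by auto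
    \<comment> \<open>Upper semicontinuity: the set where \<open>w\<close> is at least
      \<open>c\<close> is the image of a closed set under the projection along the compact
      factor.\<close>
    have "closedin (prod_topology T T) {z \<in> topspace (prod_topology T T). ?F z \<in> {c..}}"
      by (rule closedin_continuous_map_preimage [OF Fc]) auto
    then have "closedin T (snd ` {z \<in> topspace (prod_topology T T). ?F z \<in> {c..}})"
      using closed_map_snd [OF compact_T] unfolding closed_map_def by blast
    moreover have "snd ` {z \<in> topspace (prod_topology T T). ?F z \<in> {c..}} = topspace T - {x \<in> topspace T. w x < c}"
    proof (intro equalityI subsetI)
      fix x assume "x \<in> snd ` {z \<in> topspace (prod_topology T T). ?F z \<in> {c..}}"
      then obtain z where z: "x = snd z" "z \<in> topspace (prod_topology T T)" "?F z \<in> {c..}" by blast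
      then have "x \<in> carrier G" "fst z \<in> carrier G" "c \<le> f (fst z \<otimes> x \<otimes> inv (fst z))"
        unfolding topspace_prod_topology topspace_T mem_Times_iff by simp_all
      moreover from up [OF this(1,2)] this(3) have "\<not> w x < c" by linarith
      ultimately show "x \<in> topspace T - {x \<in> topspace T. w x < c}" unfolding topspace_T by blast
    next
      fix x assume "x \<in> topspace T - {x \<in> topspace T. w x < c}"
      then have x: "x \<in> carrier G" "c \<le> w x" using topspace_T by auto
      obtain g where g: "g \<in> carrier G" "w x = f (g \<otimes> x \<otimes> inv g)" using att [OF x(1)] by blast
      then have "(g, x) \<in> {z \<in> topspace (prod_topology T T). ?F z \<in> {c..}}"
        unfolding topspace_prod_topology topspace_T using x by simp
      then show "x \<in> snd ` {z \<in> topspace (prod_topology T T). ?F z \<in> {c..}}"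
        by (rule image_eqI [rotated]) simp
    qed
    ultimately show "openin T {x \<in> topspace T. w x < c}"
      by (simp add: openin_closedin_eq)
  qed
  show thesis
  proof (rule that [OF wc])
    show "0 \<le> w x" if x: "x \<in> carrier G" for x
      using up [OF x one_closed] f01(1) [OF x] x by simp
    show "w \<one> = 0" using att [of \<one>] f(2) by auto
    show "w (g \<otimes> x \<otimes> inv g) = w x" if gx: "g \<in> carrier G" "x \<in> carrier G" for g x
    proof -
      have "S (g \<otimes> x \<otimes> inv g) = S x"
        unfolding S_def
      proof (intro equalityI subsetI)
        fix t assume "t \<in> (\<lambda>k. f (k \<otimes> (g \<otimes> x \<otimes> inv g) \<otimes> inv k)) ` carrier G"
        then obtain k where "k \<in> carrier G" "t = f (k \<otimes> (g \<otimes> x \<otimes> inv g) \<otimes> inv k)" by auto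
        then show "t \<in> (\<lambda>k. f (k \<otimes> x \<otimes> inv k)) ` carrier G"
          using conj_conj gx by (intro image_eqI [of _ _ "k \<otimes> g"]) auto
      next
        fix t assume "t \<in> (\<lambda>k. f (k \<otimes> x \<otimes> inv k)) ` carrier G"
        then obtain k where k: "k \<in> carrier G" "t = f (k \<otimes> x \<otimes> inv k)" by auto
        have "(k \<otimes> inv g) \<otimes> (g \<otimes> x \<otimes> inv g) \<otimes> inv (k \<otimes> inv g) = k \<otimes> x \<otimes> inv k"
          using conj_conj [of "k \<otimes> inv g" g x] gx k(1) by (simp add: m_assoc)
        then show "t \<in> (\<lambda>k. f (k \<otimes> (g \<otimes> x \<otimes> inv g) \<otimes> inv k)) ` carrier G"
          using gx k by (intro image_eqI [of _ _ "k \<otimes> inv g"]) auto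
      qed
      then show ?thesis by (simp add: w_def)
    qed
    show "x \<in> V" if x: "x \<in> carrier G" "w x < 1" for x
    proof (rule ccontr)
      assume "x \<notin> V"
      then have "f x = 1" using f(3) x topspace_T by auto
      then show False using up [OF x(1) one_closed] x by simp
    qed
  qed
qed

text \<open>A conjugation-equivariant form of an NDR structure on the pair of the group and its
  unit. Applied to one entry of a commuting tuple, \<open>D\<close> and \<open>v\<close> become the
  data of \<open>idempotent_cube\<close>.\<close>

definition conj_contractible :: "(real \<times> 'a \<Rightarrow> 'a) \<Rightarrow> ('a \<Rightarrow> real) \<Rightarrow> bool" where
  "conj_contractible D v \<longleftrightarrow>
     continuous_map (prod_topology II T) T D \<and> continuous_map T euclideanreal v \<and>
     (\<forall>x\<in>carrier G. D (0, x) = x \<and> 0 \<le> v x \<and> (v x < 1 \<longrightarrow> D (1, x) = \<one>)) \<and>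
     v \<one> = 0 \<and> (\<forall>s\<in>{0..1}. D (s, \<one>) = \<one>) \<and>
     (\<forall>g\<in>carrier G. \<forall>x\<in>carrier G. v (g \<otimes> x \<otimes> inv g) = v x \<and>
        (\<forall>s\<in>{0..1}. D (s, g \<otimes> x \<otimes> inv g) = g \<otimes> D (s, x) \<otimes> inv g))"

text \<open>A class function slows the contraction down until it stands still away from the unit, so
  that it extends by the identity.\<close>

lemma conj_contractible_extend:
  assumes K: "closedin T K" "openin T V" "\<one> \<in> V" "V \<subseteq> K"
    and h: "continuous_map (prod_topology II (subtopology T K)) T h"
    and h0: "\<And>x. x \<in> K \<Longrightarrow> h (0, x) = \<one>" and h1: "\<And>x. x \<in> K \<Longrightarrow> h (1, x) = x"
    and h_one: "\<And>t. t \<in> {0..1} \<Longrightarrow> h (t, \<one>) = \<one>"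
    and h_conj: "\<And>g t x. g \<in> carrier G \<Longrightarrow> t \<in> {0..1} \<Longrightarrow> x \<in> K \<Longrightarrow> h (t, g \<otimes> x \<otimes> inv g) = g \<otimes> h (t, x) \<otimes> inv g"
  shows "\<exists>D v. conj_contractible D v"
proof -
  obtain w :: "'a \<Rightarrow> real" where wc: "continuous_map T euclideanreal w"
    and w: "\<And>x. x \<in> carrier G \<Longrightarrow> 0 \<le> w x" "w \<one> = 0"
    "\<And>g x. g \<in> carrier G \<Longrightarrow> x \<in> carrier G \<Longrightarrow> w (g \<otimes> x \<otimes> inv g) = w x"
    "\<And>x. x \<in> carrier G \<Longrightarrow> w x < 1 \<Longrightarrow> x \<in> V"
    using class_function_exists [OF K(2,3)] by metis
  have wK: "x \<in> K" if "x \<in> carrier G" "w x \<le> 1/2" for x using w(4) [of x] that K(4) by auto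
  \<comment> \<open>A cutoff that is 1 where \<open>w\<close> is at most 1/4 and 0 where
    \<open>w\<close> is at least 1/2.\<close>
  define \<theta> where "\<theta> x = max 0 (min 1 (2 - 4 * w x))" for x
  have \<theta>: "0 \<le> \<theta> x" "\<theta> x \<le> 1" for x by (auto simp: \<theta>_def)
  have s\<theta>: "1 - s * \<theta> x \<in> {0..1}" if "s \<in> {0..1}" for s x
  proof -
    have "s * \<theta> x \<le> 1" "0 \<le> s * \<theta> x" using that \<theta> [of x] by (auto intro: mult_le_one)
    then show ?thesis by auto
  qed
  have \<theta>c: "continuous_map T euclideanreal \<theta>"
    unfolding \<theta>_def by (intro continuous_map_real_max continuous_map_real_min continuous_map_diff continuous_map_real_mult wc) auto
  \<comment> \<open>\<open>h\<close> runs from the unit to \<open>x\<close>; its time is reversed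
    because \<open>D\<close> has to start at \<open>x\<close>.\<close>
  define D where "D z = (if w (snd z) \<le> 1/2 then h (1 - fst z * \<theta> (snd z), snd z) else snd z)" for z
  let ?P = "prod_topology II T"
  have ws: "continuous_map ?P euclideanreal (\<lambda>z. w (snd z))"
    by (rule continuous_map_comp [OF wc continuous_map_snd])
  have Dc: "continuous_map ?P T D"
    unfolding D_def [abs_def]
  proof (rule continuous_map_II_split [OF ws])
    let ?L = "subtopology ?P {x \<in> topspace ?P. w (snd x) \<le> 1/2}"
    show "continuous_map ?L T (\<lambda>z. h (1 - fst z * \<theta> (snd z), snd z))"
    proof (rule continuous_map_comp [OF h], intro continuous_map_pairedI)
      have "continuous_map ?P euclideanreal (\<lambda>z. 1 - fst z * \<theta> (snd z))"
        by (intro continuous_map_diff continuous_map_real_mult continuous_map_II_euclidean [OF continuous_map_projections(1)]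
             continuous_map_comp [OF \<theta>c continuous_map_snd]) auto
      then show "continuous_map ?L II (\<lambda>z. 1 - fst z * \<theta> (snd z))"
        by (intro continuous_map_II continuous_map_from_subtopology) (use s\<theta> in auto)
      show "continuous_map ?L (subtopology T K) snd"
        unfolding continuous_map_in_subtopology
        by (intro conjI continuous_map_from_subtopology continuous_map_snd) (use wK topspace_T in auto)
    qed
    show "continuous_map (subtopology ?P {x \<in> topspace ?P. 1/2 \<le> w (snd x)}) T snd"
      by (intro continuous_map_from_subtopology continuous_map_snd)
    fix z assume z: "z \<in> topspace ?P" "w (snd z) = 1/2"
    then have "\<theta> (snd z) = 0" "snd z \<in> K" using wK topspace_T by (auto simp: \<theta>_def)
    then show "h (1 - fst z * \<theta> (snd z), snd z) = snd z" using h1 by simp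
  qed
  \<comment> \<open>The factor 4 makes height below 1 imply \<open>\<theta> x = 1\<close>, so that
    \<open>D\<close> does reach the unit there.\<close>
  have "conj_contractible D (\<lambda>x. 4 * w x)"
    unfolding conj_contractible_def
  proof (intro conjI ballI impI)
    show "continuous_map T euclideanreal (\<lambda>x. 4 * w x)" by (intro continuous_map_real_mult wc) auto
    show "D (0, x) = x" if "x \<in> carrier G" for x using h1 wK that by (simp add: D_def)
    show "D (1, x) = \<one>" if "x \<in> carrier G" "4 * w x < 1" for x
    proof -
      have "\<theta> x = 1" "w x \<le> 1/2" using that by (auto simp: \<theta>_def)
      then show ?thesis using h0 wK that by (simp add: D_def)
    qed
    show "D (s, \<one>) = \<one>" if "s \<in> {0..1}" for s using h_one s\<theta> [OF that] by (simp add: D_def)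
    show "D (s, g \<otimes> x \<otimes> inv g) = g \<otimes> D (s, x) \<otimes> inv g" if "g \<in> carrier G" "x \<in> carrier G" "s \<in> {0..1}" for g x s
    proof -
      have "\<theta> (g \<otimes> x \<otimes> inv g) = \<theta> x" using w(3) [OF that(1,2)] by (simp add: \<theta>_def)
      then show ?thesis
        using h_conj [OF that(1) s\<theta> [OF that(3), of x] wK [OF that(2)]] w(3) [OF that(1,2)] by (simp add: D_def)
    qed
  qed (use w Dc in auto)
  then show ?thesis by blast
qed

end

section \<open>Expansion of squaring in a compact Lie group\<close>

context compact_lie_group
begin

lemma compact_topological_group: "compact_topological_group G T"
  by unfold_locales (use topspace_eq Hausdorff compact continuous_map_mult continuous_map_inv in auto)

text \<open>A small closed ball of the sum metric in a chart satisfies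
  \<open>square_expanding_group\<close>. Both metric inequalities come from the approximation of the
  product by addition, and roots near the unit come from invariance of domain.\<close>

theorem conj_contractible_exists: "\<exists>D v. compact_topological_group.conj_contractible G T D v"
proof -
  interpret C: compact_topological_group G T by (rule compact_topological_group)
  obtain c where "c \<in> A" "\<one> \<in> fst c"
    using atlas topspace_eq one_closed unfolding smooth_atlas_def by blast
  then obtain U \<phi> where UA: "(U, \<phi>) \<in> A" and one: "\<one> \<in> U" by (cases c) auto
  let ?E = "Euclidean_space d"
  have chart: "is_chart T d (U, \<phi>)" using atlas UA by (auto simp: smooth_atlas_def)
  note ch = is_chartD [OF chart]
  have UG: "U \<subseteq> carrier G" using openin_subset [OF ch(1)] topspace_eq by simp
  have tU: "topspace (subtopology T U) = U" using UG topspace_eq by auto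
  define \<psi> where "\<psi> = inv_into U \<phi>"
  have \<psi>U: "\<psi> u \<in> U" "\<phi> (\<psi> u) = u" if "u \<in> \<phi> ` U" for u
    using that by (auto simp: \<psi>_def inv_into_into f_inv_into_f)
  have \<psi>\<phi>: "\<psi> (\<phi> x) = x" if "x \<in> U" for x using ch(3) that by (simp add: \<psi>_def)
  have \<psi>c: "continuous_map (subtopology ?E (\<phi> ` U)) T \<psi>"
    using ch(5) continuous_map_into_fulltopology by (auto simp: \<psi>_def)
  have \<phi>0: "\<phi> x i = 0" if "x \<in> U" "i \<ge> d" for x i
    using openin_subset [OF ch(2)] that by (auto simp: topspace_Euclidean_space)
  have proj: "continuous_map ?E euclideanreal (\<lambda>z. z i)" for i
    unfolding Euclidean_space_def
    by (rule continuous_map_from_subtopology [OF continuous_map_product_projection]) simp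
  have \<phi>c: "continuous_map (subtopology T U) ?E \<phi>" by (rule continuous_map_into_fulltopology [OF ch(4)])
  have \<phi>ic: "continuous_map (subtopology T U) euclideanreal (\<lambda>x. \<phi> x i)" for i
    by (rule continuous_map_comp [OF proj \<phi>c])
  define \<delta> where "\<delta> x y = (\<Sum>i<d. \<bar>\<phi> x i - \<phi> y i\<bar>)" for x y
  have \<delta>c: "continuous_map (subtopology T U) euclideanreal (\<delta> x)" for x
    unfolding \<delta>_def by (intro continuous_map_sum continuous_map_real_abs continuous_map_diff \<phi>ic) auto
  have \<delta>_sym: "\<delta> x y = \<delta> y x" for x y by (simp add: \<delta>_def abs_minus_commute)
  have coord: "\<forall>i<d. \<bar>\<phi> x i - \<phi> y i\<bar> \<le> r" if "\<delta> x y \<le> r" for x y r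
    using that member_le_sum [of _ "{..<d}" "\<lambda>i. \<bar>\<phi> x i - \<phi> y i\<bar>"] by (fastforce simp: \<delta>_def)
  \<comment> \<open>The errors of the \<open>d\<close> coordinates add up to at most 1/4 of the
    distances; the summand 1 keeps \<open>\<eta>\<close> positive when \<open>d = 0\<close>.\<close>
  define \<eta> where "\<eta> = 1 / (4 * (real d + 1))"
  have \<eta>: "\<eta> > 0" "real d * \<eta> \<le> 1/4" by (auto simp: \<eta>_def field_simps)
  obtain \<delta>1 where \<delta>1: "\<delta>1 > 0"
    "\<And>x y x' y'. \<lbrakk>x \<in> U; y \<in> U; x' \<in> U; y' \<in> U;
        \<forall>i<d. \<bar>\<phi> x i - \<phi> \<one> i\<bar> \<le> \<delta>1; \<forall>i<d. \<bar>\<phi> y i - \<phi> \<one> i\<bar> \<le> \<delta>1;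
        \<forall>i<d. \<bar>\<phi> x' i - \<phi> \<one> i\<bar> \<le> \<delta>1; \<forall>i<d. \<bar>\<phi> y' i - \<phi> \<one> i\<bar> \<le> \<delta>1\<rbrakk>
      \<Longrightarrow> x \<otimes> y \<in> U \<and> (\<forall>j<d. \<bar>\<phi> (x \<otimes> y) j - \<phi> (x' \<otimes> y') j - (\<phi> x j - \<phi> x' j) - (\<phi> y j - \<phi> y' j)\<bar>
          \<le> \<eta> * (\<delta> x x' + \<delta> y y'))"
    using chart_strict_mult [OF UA one \<eta>(1)] unfolding \<delta>_def by blast
  \<comment> \<open>\<open>M\<close> has to be closed in the whole group and not just in
    \<open>U\<close>. A radius for which \<open>M\<close> lies in \<open>W\<close> places it in the
    closed set \<open>C\<close>, where closedness relative to \<open>U\<close> is closedness in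
    \<open>T\<close>.\<close>
  obtain W C where WC: "openin T W" "closedin T C" "\<one> \<in> W" "W \<subseteq> C" "C \<subseteq> U"
    using C.regular_nhd [OF ch(1) one] by blast
  have "openin ?E {u \<in> topspace (subtopology ?E (\<phi> ` U)). \<psi> u \<in> W}"
    using openin_continuous_map_preimage [OF \<psi>c WC(1)] ch(2) openin_trans_full by blast
  moreover have "\<phi> \<one> \<in> {u \<in> topspace (subtopology ?E (\<phi> ` U)). \<psi> u \<in> W}"
    using one WC(3) \<psi>\<phi> openin_subset [OF ch(2)] by auto
  ultimately obtain \<delta>2 where \<delta>2: "\<delta>2 > 0"
    "{x \<in> topspace ?E. \<forall>i<d. \<bar>x i - \<phi> \<one> i\<bar> \<le> \<delta>2} \<subseteq> {u \<in> topspace (subtopology ?E (\<phi> ` U)). \<psi> u \<in> W}"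
    using Euclidean_space_cube_nhd by blast
  define r where "r = min \<delta>1 \<delta>2"
  have r: "r > 0" "r \<le> \<delta>1" "r \<le> \<delta>2" using \<delta>1(1) \<delta>2(1) by (auto simp: r_def)
  have cube: "u \<in> \<phi> ` U" "\<psi> u \<in> W" if "u \<in> topspace ?E" "\<forall>i<d. \<bar>u i - \<phi> \<one> i\<bar> \<le> r" for u
    using \<delta>2(2) that r(3) by force+
  define M where "M = {x \<in> U. \<delta> x \<one> \<le> r}"
  have MU: "x \<in> U" and M1: "\<forall>i<d. \<bar>\<phi> x i - \<phi> \<one> i\<bar> \<le> \<delta>1" if "x \<in> M" for x
    using that coord [of x \<one> \<delta>1] r by (auto simp: M_def)
  have MW: "x \<in> W" if "x \<in> M" for x
  proof -
    have "\<phi> x \<in> topspace ?E" using \<phi>0 MU [OF that] by (auto simp: topspace_Euclidean_space)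
    moreover have "\<forall>i<d. \<bar>\<phi> x i - \<phi> \<one> i\<bar> \<le> r" using that coord by (auto simp: M_def)
    ultimately show ?thesis using cube(2) [of "\<phi> x"] \<psi>\<phi> MU [OF that] by simp
  qed
  have M_closed: "closedin T M"
  proof -
    have "closedin (subtopology T U) {x \<in> topspace (subtopology T U). \<delta> \<one> x \<in> {..r}}"
      by (rule closedin_continuous_map_preimage [OF \<delta>c]) auto
    then have "closedin (subtopology T U) M"
      unfolding tU M_def by (simp add: \<delta>_sym)
    then have "closedin (subtopology (subtopology T U) C) M"
      by (rule closedin_subset_topspace) (use MW WC in auto)
    moreover have "subtopology (subtopology T U) C = subtopology T C"
      using WC(5) by (simp add: subtopology_subtopology Int_absorb1)
    ultimately show ?thesis using WC(2) closedin_trans_full by metis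
  qed
  have ball_open: "openin T {x \<in> U. \<delta> x \<one> < r}"
  proof -
    have "openin (subtopology T U) {x \<in> topspace (subtopology T U). \<delta> \<one> x \<in> {..<r}}"
      by (rule openin_continuous_map_preimage [OF \<delta>c]) auto
    then have "openin (subtopology T U) {x \<in> U. \<delta> x \<one> < r}"
      unfolding tU by (simp add: \<delta>_sym)
    then show ?thesis using ch(1) openin_trans_full by blast
  qed
  have \<delta>0: "\<delta> \<one> \<one> = 0" by (simp add: \<delta>_def)
  have est: "x \<otimes> y \<in> U" "(\<Sum>j<d. \<bar>\<phi> (x \<otimes> y) j - \<phi> (x' \<otimes> y') j - (\<phi> x j - \<phi> x' j) - (\<phi> y j - \<phi> y' j)\<bar>) \<le> 1/4 * (\<delta> x x' + \<delta> y y')"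
    if "x \<in> M" "y \<in> M" "x' \<in> M" "y' \<in> M" for x y x' y'
  proof -
    note * = \<delta>1(2) [OF MU [OF that(1)] MU [OF that(2)] MU [OF that(3)] MU [OF that(4)]
        M1 [OF that(1)] M1 [OF that(2)] M1 [OF that(3)] M1 [OF that(4)]]
    show "x \<otimes> y \<in> U" using * by blast
    have "(\<Sum>j<d. \<bar>\<phi> (x \<otimes> y) j - \<phi> (x' \<otimes> y') j - (\<phi> x j - \<phi> x' j) - (\<phi> y j - \<phi> y' j)\<bar>) \<le> (\<Sum>j<d. \<eta> * (\<delta> x x' + \<delta> y y'))"
      using * by (intro sum_mono) auto
    also have "\<dots> = real d * \<eta> * (\<delta> x x' + \<delta> y y')" by simp
    also have "\<dots> \<le> 1/4 * (\<delta> x x' + \<delta> y y')"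
      by (rule mult_right_mono [OF \<eta>(2)]) (auto simp: \<delta>_def intro!: add_nonneg_nonneg sum_nonneg)
    finally show "(\<Sum>j<d. \<bar>\<phi> (x \<otimes> y) j - \<phi> (x' \<otimes> y') j - (\<phi> x j - \<phi> x' j) - (\<phi> y j - \<phi> y' j)\<bar>) \<le> 1/4 * (\<delta> x x' + \<delta> y y')" .
  qed
  \<comment> \<open>Squaring doubles differences up to an error of
    \<open>1/4 * (\<delta> x y + \<delta> x y)\<close>, and \<open>2 - 1/2 = 3/2\<close>.\<close>
  have sq: "3/2 * \<delta> x y \<le> \<delta> (x \<otimes> x) (y \<otimes> y)" if "x \<in> M" "y \<in> M" for x y
  proof -
    have "2 * \<delta> x y = (\<Sum>j<d. 2 * \<bar>\<phi> x j - \<phi> y j\<bar>)" by (simp add: \<delta>_def sum_distrib_left)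
    also have "\<dots> \<le> (\<Sum>j<d. \<bar>\<phi> (x \<otimes> x) j - \<phi> (y \<otimes> y) j\<bar>
        + \<bar>\<phi> (x \<otimes> x) j - \<phi> (y \<otimes> y) j - (\<phi> x j - \<phi> y j) - (\<phi> x j - \<phi> y j)\<bar>)"
    proof (rule sum_mono)
      have *: "2 * \<bar>a\<bar> \<le> \<bar>b\<bar> + \<bar>b - a - a\<bar>" for a b :: real by linarith
      show "2 * \<bar>\<phi> x j - \<phi> y j\<bar> \<le> \<bar>\<phi> (x \<otimes> x) j - \<phi> (y \<otimes> y) j\<bar>
        + \<bar>\<phi> (x \<otimes> x) j - \<phi> (y \<otimes> y) j - (\<phi> x j - \<phi> y j) - (\<phi> x j - \<phi> y j)\<bar>" for j
        by (rule * )
    qed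
    also have "\<dots> \<le> \<delta> (x \<otimes> x) (y \<otimes> y) + 1/4 * (\<delta> x y + \<delta> x y)"
      unfolding sum.distrib using est(2) [OF that(1,1,2,2)] by (simp add: \<delta>_def)
    finally have "2 * \<delta> x y \<le> \<delta> (x \<otimes> x) (y \<otimes> y) + 1/4 * (\<delta> x y + \<delta> x y)" .
    moreover have "3/2 * a \<le> b" if "2 * a \<le> b + 1/4 * (a + a)" for a b :: real
      using that by (simp add: field_simps)
    ultimately show ?thesis by blast
  qed
  \<comment> \<open>With the left factor fixed, differences are preserved up to a quarter of
    \<open>\<delta> y z\<close>.\<close>
  have lip: "\<delta> (x \<otimes> y) (x \<otimes> z) \<le> 5/4 * \<delta> y z" if "x \<in> M" "y \<in> M" "z \<in> M" for x y z
  proof -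
    have "\<delta> (x \<otimes> y) (x \<otimes> z) \<le> (\<Sum>j<d. \<bar>\<phi> y j - \<phi> z j\<bar>
        + \<bar>\<phi> (x \<otimes> y) j - \<phi> (x \<otimes> z) j - (\<phi> x j - \<phi> x j) - (\<phi> y j - \<phi> z j)\<bar>)"
      unfolding \<delta>_def
    proof (rule sum_mono)
      have *: "\<bar>b\<bar> \<le> \<bar>a\<bar> + \<bar>b - (c - c) - a\<bar>" for a b c :: real by linarith
      show "\<bar>\<phi> (x \<otimes> y) j - \<phi> (x \<otimes> z) j\<bar> \<le> \<bar>\<phi> y j - \<phi> z j\<bar>
        + \<bar>\<phi> (x \<otimes> y) j - \<phi> (x \<otimes> z) j - (\<phi> x j - \<phi> x j) - (\<phi> y j - \<phi> z j)\<bar>" for j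
        by (rule * )
    qed
    also have "\<dots> \<le> \<delta> y z + 1/4 * (\<delta> x x + \<delta> y z)"
      unfolding sum.distrib using est(2) [OF that(1,2) that(1,3)] by (simp add: \<delta>_def)
    also have "\<delta> x x = 0" by (simp add: \<delta>_def)
    finally have "\<delta> (x \<otimes> y) (x \<otimes> z) \<le> \<delta> y z + 1/4 * (0 + \<delta> y z)" .
    moreover have "b \<le> 5/4 * a" if "b \<le> a + 1/4 * (0 + a)" for a b :: real
      using that by (simp add: field_simps)
    ultimately show ?thesis by blast
  qed
  have zeroD: "x = y" if "x \<in> U" "y \<in> U" "\<delta> x y = 0" for x y
  proof -
    have "\<forall>i<d. \<phi> x i = \<phi> y i" using coord [of x y 0] that(3) by auto
    then have "\<phi> x = \<phi> y" using \<phi>0 that by (metis ext linorder_not_less)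
    then show ?thesis using ch(3) that by (auto dest: inj_onD)
  qed
  define B where "B = {x \<in> U. \<delta> x \<one> < r}"
  have BM: "x \<in> M" if "x \<in> B" for x using that by (auto simp: B_def M_def)
  have B: "openin T B" "\<one> \<in> B" "B \<subseteq> U" using ball_open one r \<delta>0 by (auto simp: B_def)
  have sq_open: "openin T ((\<lambda>x. x \<otimes> x) ` B)"
  proof -
    let ?V = "\<phi> ` B"
    have V_eq: "?V = {u \<in> topspace (subtopology ?E (\<phi> ` U)). \<psi> u \<in> B}"
      using B(3) \<psi>\<phi> \<psi>U openin_subset [OF ch(2)] by (auto simp: image_iff subset_iff) metis+
    have V: "openin ?E ?V"
      unfolding V_eq using openin_continuous_map_preimage [OF \<psi>c B(1)] ch(2) openin_trans_full by blast
    let ?f = "\<lambda>u. \<phi> (\<psi> u \<otimes> \<psi> u)"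
    have f\<phi>: "?f (\<phi> x) = \<phi> (x \<otimes> x)" if "x \<in> B" for x using \<psi>\<phi> B(3) that by auto
    have sqU: "x \<otimes> x \<in> U" if "x \<in> B" for x using est(1) BM that by blast
    have "continuous_map (subtopology ?E ?V) T (\<lambda>u. \<psi> u \<otimes> \<psi> u)"
      by (intro C.continuous_map_mult2 continuous_map_from_subtopology_mono [OF \<psi>c]) (use B(3) in auto)
    then have "continuous_map (subtopology ?E ?V) (subtopology T U) (\<lambda>u. \<psi> u \<otimes> \<psi> u)"
      unfolding continuous_map_in_subtopology using sqU \<psi>\<phi> B(3) by auto
    then have fc: "continuous_map (subtopology ?E ?V) ?E ?f"
      by (rule continuous_map_comp [OF \<phi>c])
    have finj: "inj_on ?f ?V"
    proof (rule inj_onI)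
      fix u v assume "u \<in> ?V" "v \<in> ?V" and eq: "?f u = ?f v"
      then obtain x y where xy: "x \<in> B" "u = \<phi> x" "y \<in> B" "v = \<phi> y" by auto
      then have "x \<otimes> x = y \<otimes> y" using eq f\<phi> sqU ch(3) by (simp add: inj_on_eq_iff)
      then have "\<delta> x y \<le> 0" using sq [OF BM BM, OF xy(1,3)] by (simp add: \<delta>_def)
      moreover have "0 \<le> \<delta> x y" by (simp add: \<delta>_def sum_nonneg)
      ultimately have "\<delta> x y = 0" by (rule antisym)
      then show "u = v" using zeroD xy B(3) by auto
    qed
    \<comment> \<open>By \<open>sq\<close>, squaring is injective on \<open>B\<close>; invariance of
      domain makes its image open.\<close>
    have fo: "openin ?E (?f ` ?V)" by (rule invariance_of_domain_Euclidean_space [OF V fc finj])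
    have "openin (subtopology T U) {x \<in> topspace (subtopology T U). \<phi> x \<in> ?f ` ?V}"
      by (rule openin_continuous_map_preimage [OF \<phi>c fo])
    moreover have "{x \<in> topspace (subtopology T U). \<phi> x \<in> ?f ` ?V} = (\<lambda>x. x \<otimes> x) ` B"
      unfolding tU using f\<phi> sqU ch(3) by (auto simp: inj_on_eq_iff image_iff)
    ultimately show ?thesis using ch(1) openin_trans_full by metis
  qed
  \<comment> \<open>Straight segments from the unit in coordinates; they stay in the chart because
    the cube of radius \<open>r\<close> is contained in it.\<close>
  define \<gamma> where "\<gamma> = (\<lambda>(t, x). \<psi> (\<lambda>i. if i < d then \<phi> \<one> i + t * (\<phi> x i - \<phi> \<one> i) else 0))"
  have \<gamma>_in: "(\<lambda>i. if i < d then \<phi> \<one> i + t * (\<phi> x i - \<phi> \<one> i) else 0) \<in> \<phi> ` U" if "x \<in> M" "t \<in> {0..1}" for x t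
  proof (rule cube(1))
    show "\<forall>i<d. \<bar>(if i < d then \<phi> \<one> i + t * (\<phi> x i - \<phi> \<one> i) else 0) - \<phi> \<one> i\<bar> \<le> r"
    proof (intro allI impI)
      fix i assume i: "i < d"
      have "\<bar>\<phi> x i - \<phi> \<one> i\<bar> \<le> r" using that coord i by (auto simp: M_def)
      moreover have "\<bar>t * (\<phi> x i - \<phi> \<one> i)\<bar> \<le> 1 * \<bar>\<phi> x i - \<phi> \<one> i\<bar>"
        unfolding abs_mult by (rule mult_right_mono) (use that in auto)
      ultimately show "\<bar>(if i < d then \<phi> \<one> i + t * (\<phi> x i - \<phi> \<one> i) else 0) - \<phi> \<one> i\<bar> \<le> r" using i by simp
    qed
  qed (simp add: topspace_Euclidean_space)
  have \<gamma>U: "\<gamma> (t, x) \<in> U" "\<phi> (\<gamma> (t, x)) = (\<lambda>i. if i < d then \<phi> \<one> i + t * (\<phi> x i - \<phi> \<one> i) else 0)" if "x \<in> M" "t \<in> {0..1}" for x t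
    using \<psi>U [OF \<gamma>_in [OF that]] by (auto simp: \<gamma>_def)
  have \<gamma>_dist: "\<delta> (\<gamma> (t, x)) \<one> \<le> \<delta> x \<one>" if "x \<in> M" "t \<in> {0..1}" for x t
    unfolding \<delta>_def
  proof (rule sum_mono)
    fix i assume "i \<in> {..<d}"
    moreover have "\<bar>t * (\<phi> x i - \<phi> \<one> i)\<bar> \<le> 1 * \<bar>\<phi> x i - \<phi> \<one> i\<bar>"
      unfolding abs_mult by (rule mult_right_mono) (use that in auto)
    ultimately show "\<bar>\<phi> (\<gamma> (t, x)) i - \<phi> \<one> i\<bar> \<le> \<bar>\<phi> x i - \<phi> \<one> i\<bar>" using \<gamma>U(2) [OF that] by simp
  qed
  have \<gamma>M: "\<gamma> (t, x) \<in> M" if "x \<in> M" "t \<in> {0..1}" for x t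
    using \<gamma>U(1) [OF that] \<gamma>_dist [OF that] that(1) by (simp add: M_def)
  have tM: "topspace (subtopology T M) = M" using MU UG topspace_eq by auto
  have "square_expanding_group G T M \<delta> \<gamma>"
  proof unfold_locales
    show "0 \<le> \<delta> x y" for x y by (simp add: \<delta>_def sum_nonneg)
    show "\<delta> x y = \<delta> y x" for x y by (rule \<delta>_sym)
    show "(\<delta> x y = 0) = (x = y)" if "x \<in> M" "y \<in> M" for x y
      using zeroD MU that by (auto simp: \<delta>_def)
    show "\<delta> x z \<le> \<delta> x y + \<delta> y z" for x y z
      unfolding \<delta>_def sum.distrib [symmetric] by (rule sum_mono) linarith
    show "closedin T M" by (rule M_closed)
    show "\<exists>O1. openin T O1 \<and> \<one> \<in> O1 \<and> O1 \<subseteq> M" using B BM by blast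
    show "continuous_map (subtopology T M) euclideanreal (\<delta> x)" for x
      by (rule continuous_map_from_subtopology_mono [OF \<delta>c]) (use MU in blast)
    show "3/2 * \<delta> x y \<le> \<delta> (x \<otimes> x) (y \<otimes> y)" if "x \<in> M" "y \<in> M" for x y by (rule sq [OF that])
    show "\<delta> (x \<otimes> y) (x \<otimes> z) \<le> 5/4 * \<delta> y z" if "x \<in> M" "y \<in> M" "z \<in> M" for x y z by (rule lip [OF that])
    show "\<exists>V. openin T V \<and> \<one> \<in> V \<and> (\<forall>x\<in>V. \<exists>y\<in>M. y \<otimes> y = x)"
    proof (intro exI conjI)
      show "openin T ((\<lambda>x. x \<otimes> x) ` B)" by (rule sq_open)
      show "\<one> \<in> (\<lambda>x. x \<otimes> x) ` B" using B(2) by (intro image_eqI [of _ _ \<one>]) auto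
      show "\<forall>x\<in>(\<lambda>x. x \<otimes> x) ` B. \<exists>y\<in>M. y \<otimes> y = x" using BM by blast
    qed
    show "continuous_map (prod_topology II (subtopology T M)) (subtopology T M) \<gamma>"
    proof -
      let ?P = "prod_topology II (subtopology T M)"
      have x: "continuous_map ?P (subtopology T U) snd"
        using continuous_map_into_fulltopology [OF continuous_map_snd [of II "subtopology T M"]] MU tM
        by (auto simp: continuous_map_in_subtopology)
      have "continuous_map ?P ?E (\<lambda>z i. if i < d then \<phi> \<one> i + fst z * (\<phi> (snd z) i - \<phi> \<one> i) else 0)"
        unfolding continuous_map_componentwise_Euclidean_space
        by (intro allI impI continuous_map_add continuous_map_real_mult continuous_map_diff
            continuous_map_II_euclidean [OF continuous_map_fst] continuous_map_comp [OF \<phi>ic x]) auto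
      then have "continuous_map ?P (subtopology ?E (\<phi> ` U)) (\<lambda>z i. if i < d then \<phi> \<one> i + fst z * (\<phi> (snd z) i - \<phi> \<one> i) else 0)"
        unfolding continuous_map_in_subtopology using \<gamma>_in tM by auto
      from continuous_map_comp [OF \<psi>c this] have "continuous_map ?P T \<gamma>"
        by (simp add: \<gamma>_def case_prod_unfold)
      then show ?thesis unfolding continuous_map_in_subtopology using \<gamma>M tM by auto
    qed
    show "\<gamma> (0, x) = \<one>" if "x \<in> M" for x
    proof -
      have "\<phi> (\<gamma> (0, x)) = \<phi> \<one>" using \<gamma>U(2) [OF that, of 0] \<phi>0 [OF one] by (auto simp: fun_eq_iff)
      then show ?thesis using \<gamma>U(1) [OF that, of 0] one ch(3) by (auto dest: inj_onD)
    qed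
    show "\<gamma> (1, x) = x" if "x \<in> M" for x
    proof -
      have "\<phi> (\<gamma> (1, x)) = \<phi> x" using \<gamma>U(2) [OF that, of 1] \<phi>0 [OF MU [OF that]] by (auto simp: fun_eq_iff)
      then show ?thesis using \<gamma>U(1) [OF that, of 1] MU [OF that] ch(3) by (auto dest: inj_onD)
    qed
    show "\<delta> (\<gamma> (t, x)) \<one> \<le> \<delta> x \<one>" if "x \<in> M" "t \<in> {0..1}" for x t by (rule \<gamma>_dist [OF that])
  qed
  then interpret S: square_expanding_group G T M \<delta> \<gamma> .
  show ?thesis
  proof (rule S.local_equivariant_contraction)
    fix K h assume K: "closedin T K" "\<exists>V. openin T V \<and> \<one> \<in> V \<and> V \<subseteq> K"
      "\<And>g x. g \<in> carrier G \<Longrightarrow> x \<in> K \<Longrightarrow> g \<otimes> x \<otimes> inv g \<in> K"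
      "continuous_map (prod_topology II (subtopology T K)) T h"
      "\<And>x. x \<in> K \<Longrightarrow> h (0, x) = \<one>" "\<And>x. x \<in> K \<Longrightarrow> h (1, x) = x"
      "\<And>t. t \<in> {0..1} \<Longrightarrow> h (t, \<one>) = \<one>"
      "\<And>g t x. g \<in> carrier G \<Longrightarrow> t \<in> {0..1} \<Longrightarrow> x \<in> K \<Longrightarrow> h (t, g \<otimes> x \<otimes> inv g) = g \<otimes> h (t, x) \<otimes> inv g"
    then obtain V where "openin T V" "\<one> \<in> V" "V \<subseteq> K" by blast
    from C.conj_contractible_extend [OF K(1) this K(4-8)] show ?thesis .
  qed
qed

end

section \<open>Representation spaces\<close>

context compact_topological_group
begin

section \<open>Commuting tuples up to conjugation, and maps induced on classes\<close>

lemma mem_Hom: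
  "x \<in> topspace (Hom_Z G T n) \<longleftrightarrow>
     x \<in> extensional {..<n} \<and> (\<forall>i<n. x i \<in> carrier G) \<and> (\<forall>i<n. \<forall>j<n. x i \<otimes> x j = x j \<otimes> x i)"
  by (auto simp: Hom_Z_def PiE_iff topspace_T)

lemma continuous_map_coord: "i < n \<Longrightarrow> continuous_map (Hom_Z G T n) T (\<lambda>x. x i)"
  unfolding Hom_Z_def by (rule continuous_map_from_subtopology [OF continuous_map_product_projection]) simp

lemma continuous_map_into_Hom:
  assumes "\<And>y. y \<in> topspace Y \<Longrightarrow> f y \<in> topspace (Hom_Z G T n)"
    and "\<And>i. i < n \<Longrightarrow> continuous_map Y T (\<lambda>y. f y i)"
  shows "continuous_map Y (Hom_Z G T n) f"
  unfolding Hom_Z_def continuous_map_in_subtopology continuous_map_componentwise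
  using assms unfolding mem_Hom by auto

lemma conj_tuple_comp:
  assumes "g \<in> carrier G" "h \<in> carrier G" "x \<in> topspace (Hom_Z G T n)"
  shows "conj_tuple G n g (conj_tuple G n h x) = conj_tuple G n (g \<otimes> h) x"
  using assms conj_conj by (auto simp: conj_tuple_def mem_Hom fun_eq_iff)

lemma conj_tuple_one:
  assumes "x \<in> topspace (Hom_Z G T n)"
  shows "conj_tuple G n \<one> x = x"
  using assms by (auto simp: conj_tuple_def mem_Hom fun_eq_iff extensional_def)

lemma Rep_class_conj:
  assumes "g \<in> carrier G" "x \<in> topspace (Hom_Z G T n)"
  shows "Rep_class G n (conj_tuple G n g x) = Rep_class G n x"
proof -
  have "\<exists>k\<in>carrier G. conj_tuple G n h x = conj_tuple G n k (conj_tuple G n g x)" if "h \<in> carrier G" for h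
    using conj_tuple_comp [of "h \<otimes> inv g" g x] assms that by (intro bexI [of _ "h \<otimes> inv g"]) (auto simp: m_assoc)
  moreover have "\<exists>k\<in>carrier G. conj_tuple G n h (conj_tuple G n g x) = conj_tuple G n k x" if "h \<in> carrier G" for h
    using conj_tuple_comp [of h g x] assms that by blast
  ultimately show ?thesis
    unfolding Rep_class_def orbit_def by auto
qed

lemma Rep_class_self: "x \<in> topspace (Hom_Z G T n) \<Longrightarrow> x \<in> Rep_class G n x"
  using conj_tuple_one [of x n] unfolding Rep_class_def orbit_def by (auto intro!: exI [of _ \<one>])

lemma Rep_class_memD: "y \<in> Rep_class G n x \<Longrightarrow> \<exists>g\<in>carrier G. y = conj_tuple G n g x"
  unfolding Rep_class_def orbit_def by auto

lemma quotient_map_Rep: "quotient_map (Hom_Z G T n) (Rep_Z G T n) (Rep_class G n)"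
  unfolding Rep_Z_def by (rule quotient_map_quotient_topology)

lemma topspace_Rep: "topspace (Rep_Z G T n) = Rep_class G n ` topspace (Hom_Z G T n)"
  by (simp add: Rep_Z_def)

definition equivariant :: "nat \<Rightarrow> nat \<Rightarrow> ((nat \<Rightarrow> 'a) \<Rightarrow> (nat \<Rightarrow> 'a)) \<Rightarrow> bool" where
  "equivariant n m f \<longleftrightarrow> (\<forall>x\<in>topspace (Hom_Z G T n). f x \<in> topspace (Hom_Z G T m) \<and>
     (\<forall>g\<in>carrier G. f (conj_tuple G n g x) = conj_tuple G m g (f x)))"

text \<open>\<open>SOME\<close> selects a representative of the orbit; for equivariant
  \<open>f\<close> the resulting class does not depend on it, by
  \<open>rep_map_class\<close>.\<close>

definition rep_map :: "nat \<Rightarrow> ((nat \<Rightarrow> 'a) \<Rightarrow> (nat \<Rightarrow> 'a)) \<Rightarrow> (nat \<Rightarrow> 'a) set \<Rightarrow> (nat \<Rightarrow> 'a) set" where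
  "rep_map m f X = Rep_class G m (f (SOME x. x \<in> X))"

lemma some_Rep_class:
  assumes "x \<in> topspace (Hom_Z G T n)"
  obtains g where "g \<in> carrier G" "(SOME y. y \<in> Rep_class G n x) = conj_tuple G n g x"
  using someI [of "\<lambda>y. y \<in> Rep_class G n x", OF Rep_class_self [OF assms]] Rep_class_memD by blast

lemma rep_map_class:
  assumes "equivariant n m f" "x \<in> topspace (Hom_Z G T n)"
  shows "rep_map m f (Rep_class G n x) = Rep_class G m (f x)"
proof -
  obtain g where "g \<in> carrier G" "(SOME y. y \<in> Rep_class G n x) = conj_tuple G n g x"
    using some_Rep_class [OF assms(2)] by blast
  then show ?thesis using assms Rep_class_conj by (simp add: rep_map_def equivariant_def)
qed

lemma continuous_map_rep_map_param:
  assumes f: "continuous_map (prod_topology II (Hom_Z G T n)) (Hom_Z G T m) (\<lambda>(s, x). f s x)"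
    and eqv: "\<And>s. s \<in> {0..1} \<Longrightarrow> equivariant n m (f s)"
  shows "continuous_map (prod_topology II (Rep_Z G T n)) (Rep_Z G T m) (\<lambda>(s, X). rep_map m (f s) X)"
proof -
  have Q: "quotient_map (prod_topology II (Hom_Z G T n)) (prod_topology II (Rep_Z G T n)) (\<lambda>(s, x). (s, Rep_class G n x))"
    by (rule quotient_map_prod_right [OF locally_compact_II(1) _ quotient_map_Rep]) (simp add: locally_compact_II)
  have "continuous_map (prod_topology II (Hom_Z G T n)) (Rep_Z G T m) ((\<lambda>(s, X). rep_map m (f s) X) \<circ> (\<lambda>(s, x). (s, Rep_class G n x)))"
  proof (rule continuous_map_eq)
    show "continuous_map (prod_topology II (Hom_Z G T n)) (Rep_Z G T m) (Rep_class G m \<circ> (\<lambda>(s, x). f s x))"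
      by (rule continuous_map_compose [OF f quotient_imp_continuous_map [OF quotient_map_Rep]])
    show "(Rep_class G m \<circ> (\<lambda>(s, x). f s x)) z = ((\<lambda>(s, X). rep_map m (f s) X) \<circ> (\<lambda>(s, x). (s, Rep_class G n x))) z"
      if "z \<in> topspace (prod_topology II (Hom_Z G T n))" for z
      using that rep_map_class [OF eqv] by (cases z) simp
  qed
  then show ?thesis by (rule continuous_compose_quotient_map [OF Q])
qed

lemma continuous_map_rep_map:
  assumes f: "continuous_map (Hom_Z G T n) (Hom_Z G T m) f" and eqv: "equivariant n m f"
  shows "continuous_map (Rep_Z G T n) (Rep_Z G T m) (rep_map m f)"
proof -
  have "continuous_map (Hom_Z G T n) (Rep_Z G T m) (rep_map m f \<circ> Rep_class G n)"
    by (rule continuous_map_eq [OF continuous_map_compose [OF f quotient_imp_continuous_map [OF quotient_map_Rep]]])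
      (simp add: rep_map_class [OF eqv])
  then show ?thesis by (rule continuous_compose_quotient_map [OF quotient_map_Rep])
qed

section \<open>Coordinate idempotents, selection and insertion of coordinates\<close>

definition set_one :: "nat \<Rightarrow> nat set \<Rightarrow> (nat \<Rightarrow> 'a) \<Rightarrow> nat \<Rightarrow> 'a" where
  "set_one n J x = (\<lambda>j\<in>{..<n}. if j \<in> J then \<one> else x j)"

text \<open>For injective \<open>b\<close> with values below \<open>n\<close>, \<open>pick\<close>
  and \<open>spread\<close> exhibit the tuples of length \<open>r\<close> as a retract of those of
  length \<open>n\<close>. By \<open>spread_pick\<close>, the corresponding idempotent is again of
  the form \<open>set_one\<close>.\<close>

definition pick :: "nat \<Rightarrow> (nat \<Rightarrow> nat) \<Rightarrow> (nat \<Rightarrow> 'a) \<Rightarrow> nat \<Rightarrow> 'a" where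
  "pick r b x = (\<lambda>k\<in>{..<r}. x (b k))"

definition spread :: "nat \<Rightarrow> nat \<Rightarrow> (nat \<Rightarrow> nat) \<Rightarrow> (nat \<Rightarrow> 'a) \<Rightarrow> nat \<Rightarrow> 'a" where
  "spread n r b y = (\<lambda>j\<in>{..<n}. if j \<in> b ` {..<r} then y (inv_into {..<r} b j) else \<one>)"

lemma set_one_in: "x \<in> topspace (Hom_Z G T n) \<Longrightarrow> set_one n J x \<in> topspace (Hom_Z G T n)"
  by (auto simp: mem_Hom set_one_def)

lemma equivariant_set_one: "equivariant n n (set_one n J)"
  unfolding equivariant_def
proof (intro ballI conjI)
  fix x g assume "x \<in> topspace (Hom_Z G T n)" "g \<in> carrier G"
  then show "set_one n J (conj_tuple G n g x) = conj_tuple G n g (set_one n J x)"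
    by (auto simp: set_one_def conj_tuple_def fun_eq_iff)
qed (rule set_one_in)

lemma continuous_map_set_one: "continuous_map (Hom_Z G T n) (Hom_Z G T n) (set_one n J)"
proof (rule continuous_map_into_Hom [OF set_one_in])
  fix i assume i: "i < n"
  show "continuous_map (Hom_Z G T n) T (\<lambda>y. set_one n J y i)"
    by (cases "i \<in> J") (use i continuous_map_coord topspace_T in \<open>auto simp: set_one_def\<close>)
qed

lemma pick_in:
  assumes "\<And>k. k < r \<Longrightarrow> b k < n" "x \<in> topspace (Hom_Z G T n)"
  shows "pick r b x \<in> topspace (Hom_Z G T r)"
  using assms by (auto simp: mem_Hom pick_def)

lemma equivariant_pick:
  assumes "\<And>k. k < r \<Longrightarrow> b k < n"
  shows "equivariant n r (pick r b)"
  unfolding equivariant_def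
proof (intro ballI conjI)
  fix x g assume "x \<in> topspace (Hom_Z G T n)" "g \<in> carrier G"
  then show "pick r b (conj_tuple G n g x) = conj_tuple G r g (pick r b x)"
    using assms by (auto simp: pick_def conj_tuple_def fun_eq_iff)
qed (rule pick_in [OF assms])

lemma continuous_map_pick:
  assumes "\<And>k. k < r \<Longrightarrow> b k < n"
  shows "continuous_map (Hom_Z G T n) (Hom_Z G T r) (pick r b)"
  by (rule continuous_map_into_Hom [OF pick_in [OF assms]]) (use assms continuous_map_coord in \<open>auto simp: pick_def\<close>)

lemma spread_in:
  assumes "y \<in> topspace (Hom_Z G T r)"
  shows "spread n r b y \<in> topspace (Hom_Z G T n)"
proof -
  have "inv_into {..<r} b j < r" if "j \<in> b ` {..<r}" for j using inv_into_into [OF that] by simp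
  then show ?thesis using assms by (auto simp: mem_Hom spread_def)
qed

lemma equivariant_spread: "equivariant r n (spread n r b)"
  unfolding equivariant_def
proof (intro ballI conjI)
  fix y g assume y: "y \<in> topspace (Hom_Z G T r)" "g \<in> carrier G"
  have "inv_into {..<r} b j < r" if "j \<in> b ` {..<r}" for j using inv_into_into [OF that] by simp
  then show "spread n r b (conj_tuple G r g y) = conj_tuple G n g (spread n r b y)"
    using y by (auto simp: spread_def conj_tuple_def fun_eq_iff)
qed (rule spread_in)

lemma continuous_map_spread: "continuous_map (Hom_Z G T r) (Hom_Z G T n) (spread n r b)"
proof (rule continuous_map_into_Hom [OF spread_in])
  fix j assume j: "j < n"
  show "continuous_map (Hom_Z G T r) T (\<lambda>y. spread n r b y j)"
  proof (cases "j \<in> b ` {..<r}")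
    case True
    then have "inv_into {..<r} b j < r" using inv_into_into [OF True] by simp
    from continuous_map_coord [OF this] show ?thesis using True j by (simp add: spread_def)
  next
    case False then show ?thesis using j topspace_T by (simp add: spread_def)
  qed
qed

lemma pick_spread:
  assumes "inj_on b {..<r}" "\<And>k. k < r \<Longrightarrow> b k < n" "y \<in> topspace (Hom_Z G T r)"
  shows "pick r b (spread n r b y) = y"
  using assms by (auto simp: pick_def spread_def mem_Hom fun_eq_iff extensional_def)

lemma spread_pick:
  assumes "x \<in> topspace (Hom_Z G T n)"
  shows "spread n r b (pick r b x) = set_one n ({..<n} - b ` {..<r}) x"
proof -
  have "inv_into {..<r} b j < r" "b (inv_into {..<r} b j) = j" if "j \<in> b ` {..<r}" for j
    using inv_into_into [OF that] f_inv_into_f [OF that] by auto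
  then show ?thesis by (auto simp: pick_def spread_def set_one_def fun_eq_iff)
qed

lemma set_one_set_one: "set_one n J (set_one n K x) = set_one n (J \<union> K) x"
  by (auto simp: set_one_def fun_eq_iff)

lemma one_tuple_in: "(\<lambda>i\<in>{..<n}. \<one>) \<in> topspace (Hom_Z G T n)"
  by (auto simp: mem_Hom)

lemma set_one_all: "set_one n {..<n} x = (\<lambda>i\<in>{..<n}. \<one>)"
  by (auto simp: set_one_def fun_eq_iff)

end

section \<open>The idempotent cube on the representation space\<close>

locale conj_contractible_group = compact_topological_group G T
  for G (structure) and T :: "'a topology" +
  fixes D :: "real \<times> 'a \<Rightarrow> 'a" and v :: "'a \<Rightarrow> real"
  assumes contractible: "conj_contractible D v"
begin

lemma D_continuous: "continuous_map (prod_topology II T) T D"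
  and v_continuous: "continuous_map T euclideanreal v"
  and D_zero: "x \<in> carrier G \<Longrightarrow> D (0, x) = x"
  and v_nonneg: "x \<in> carrier G \<Longrightarrow> 0 \<le> v x"
  and D_one_near: "x \<in> carrier G \<Longrightarrow> v x < 1 \<Longrightarrow> D (1, x) = \<one>"
  and v_unit: "v \<one> = 0" and D_unit: "s \<in> {0..1} \<Longrightarrow> D (s, \<one>) = \<one>"
  and v_conj: "g \<in> carrier G \<Longrightarrow> x \<in> carrier G \<Longrightarrow> v (g \<otimes> x \<otimes> inv g) = v x"
  and D_conj: "g \<in> carrier G \<Longrightarrow> x \<in> carrier G \<Longrightarrow> s \<in> {0..1} \<Longrightarrow> D (s, g \<otimes> x \<otimes> inv g) = g \<otimes> D (s, x) \<otimes> inv g"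
  using contractible unfolding conj_contractible_def by blast+

lemma D_carrier: "x \<in> carrier G \<Longrightarrow> s \<in> {0..1} \<Longrightarrow> D (s, x) \<in> carrier G"
  using D_continuous topspace_T by (auto simp: continuous_map_def)

text \<open>\<open>y\<close> commutes with \<open>x\<close> exactly when conjugation by
  \<open>y\<close> fixes \<open>x\<close>, and then by equivariance it fixes
  \<open>D (s, x)\<close>. Deforming one entry therefore keeps a tuple commuting.\<close>

lemma D_commute:
  assumes "x \<in> carrier G" "y \<in> carrier G" "x \<otimes> y = y \<otimes> x" "s \<in> {0..1}"
  shows "D (s, x) \<otimes> y = y \<otimes> D (s, x)"
proof -
  have "y \<otimes> x \<otimes> inv y = x" using assms(1-3) by (metis inv_solve_right m_closed)
  then have "D (s, x) = y \<otimes> D (s, x) \<otimes> inv y" using D_conj [OF assms(2,1,4)] by simp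
  then show ?thesis using assms D_carrier [OF assms(1,4)] by (metis inv_solve_right m_closed)
qed

definition deform :: "nat \<Rightarrow> nat \<Rightarrow> real \<Rightarrow> (nat \<Rightarrow> 'a) \<Rightarrow> nat \<Rightarrow> 'a" where
  "deform n i s x = (\<lambda>j\<in>{..<n}. if j = i then D (s, x j) else x j)"

lemma deform_in:
  assumes "x \<in> topspace (Hom_Z G T n)" "s \<in> {0..1}"
  shows "deform n i s x \<in> topspace (Hom_Z G T n)"
  using assms D_carrier D_commute [OF _ _ _ assms(2)] by (auto simp: mem_Hom deform_def)

lemma equivariant_deform:
  assumes s: "s \<in> {0..1}"
  shows "equivariant n n (deform n i s)"
  unfolding equivariant_def
proof (intro ballI conjI)
  fix x g assume "x \<in> topspace (Hom_Z G T n)" "g \<in> carrier G"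
  then show "deform n i s (conj_tuple G n g x) = conj_tuple G n g (deform n i s x)"
    using D_conj s by (auto simp: deform_def conj_tuple_def fun_eq_iff mem_Hom)
qed (rule deform_in [OF _ s])

lemma continuous_map_deform:
  "continuous_map (prod_topology II (Hom_Z G T n)) (Hom_Z G T n) (\<lambda>(s, x). deform n i s x)"
proof (rule continuous_map_into_Hom)
  show "(\<lambda>(s, x). deform n i s x) y \<in> topspace (Hom_Z G T n)" if "y \<in> topspace (prod_topology II (Hom_Z G T n))" for y
    using that deform_in by auto
  fix j assume j: "j < n"
  have c: "continuous_map (prod_topology II (Hom_Z G T n)) T (\<lambda>z. snd z j)"
    by (rule continuous_map_comp [OF continuous_map_coord [OF j] continuous_map_snd])
  show "continuous_map (prod_topology II (Hom_Z G T n)) T (\<lambda>y. (\<lambda>(s, x). deform n i s x) y j)"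
  proof (cases "j = i")
    case True
    have "continuous_map (prod_topology II (Hom_Z G T n)) T (\<lambda>z. D (fst z, snd z j))"
      by (rule continuous_map_comp [OF D_continuous]) (intro continuous_map_pairedI continuous_map_fst c)
    then show ?thesis using j True by (simp add: deform_def case_prod_unfold)
  next
    case False then show ?thesis using j c by (simp add: deform_def case_prod_unfold)
  qed
qed

definition rep_unit :: "nat \<Rightarrow> nat \<Rightarrow> (nat \<Rightarrow> 'a) set \<Rightarrow> (nat \<Rightarrow> 'a) set" where
  "rep_unit n i = rep_map n (set_one n {i})"

definition rep_deform :: "nat \<Rightarrow> nat \<Rightarrow> real \<times> (nat \<Rightarrow> 'a) set \<Rightarrow> (nat \<Rightarrow> 'a) set" where
  "rep_deform n i = (\<lambda>(s, X). rep_map n (deform n i s) X)"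

text \<open>The value is the same for all representatives because \<open>v\<close> is a class
  function.\<close>

definition rep_height :: "nat \<Rightarrow> (nat \<Rightarrow> 'a) set \<Rightarrow> real" where
  "rep_height i X = v ((SOME x. x \<in> X) i)"

lemma rep_unit_class: "x \<in> topspace (Hom_Z G T n) \<Longrightarrow> rep_unit n i (Rep_class G n x) = Rep_class G n (set_one n {i} x)"
  unfolding rep_unit_def by (rule rep_map_class [OF equivariant_set_one])

lemma rep_deform_class:
  "x \<in> topspace (Hom_Z G T n) \<Longrightarrow> s \<in> {0..1} \<Longrightarrow> rep_deform n i (s, Rep_class G n x) = Rep_class G n (deform n i s x)"
  unfolding rep_deform_def using rep_map_class [OF equivariant_deform] by simp

lemma rep_height_class:
  assumes "i < n" "x \<in> topspace (Hom_Z G T n)"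
  shows "rep_height i (Rep_class G n x) = v (x i)"
proof -
  obtain g where "g \<in> carrier G" "(SOME y. y \<in> Rep_class G n x) = conj_tuple G n g x"
    using some_Rep_class [OF assms(2)] by blast
  then show ?thesis using assms v_conj by (simp add: rep_height_def conj_tuple_def mem_Hom)
qed

text \<open>Operations on different entries of a tuple do not interact, so the identities hold for
  representatives and pass to their classes.\<close>

lemma idempotent_cube_Rep:
  "idempotent_cube (Rep_Z G T n) n (rep_unit n) (rep_deform n) rep_height"
proof
  fix i assume i: "i < n"
  show "continuous_map (Rep_Z G T n) (Rep_Z G T n) (rep_unit n i)"
    unfolding rep_unit_def by (rule continuous_map_rep_map [OF continuous_map_set_one equivariant_set_one])
  show "continuous_map (prod_topology II (Rep_Z G T n)) (Rep_Z G T n) (rep_deform n i)"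
    unfolding rep_deform_def by (rule continuous_map_rep_map_param [OF continuous_map_deform equivariant_deform])
  show "continuous_map (Rep_Z G T n) euclideanreal (rep_height i)"
  proof (rule continuous_compose_quotient_map [OF quotient_map_Rep])
    show "continuous_map (Hom_Z G T n) euclideanreal (rep_height i \<circ> Rep_class G n)"
      by (rule continuous_map_eq [OF continuous_map_comp [OF v_continuous continuous_map_coord [OF i]]])
        (simp add: rep_height_class [OF i])
  qed
  fix X assume "X \<in> topspace (Rep_Z G T n)"
  then obtain x where x: "x \<in> topspace (Hom_Z G T n)" and X: "X = Rep_class G n x"
    unfolding topspace_Rep by blast
  have xi: "x i \<in> carrier G" using x i by (simp add: mem_Hom)
  note so = set_one_in [OF x] and dI = deform_in [OF x]
  show "rep_unit n i (rep_unit n i X) = rep_unit n i X"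
    by (simp add: X rep_unit_class x so set_one_set_one)
  show "rep_deform n i (0, X) = X"
  proof -
    have "deform n i 0 x = x" using x D_zero by (auto simp: deform_def mem_Hom fun_eq_iff extensional_def)
    then show ?thesis by (simp add: X rep_deform_class x)
  qed
  show "0 \<le> rep_height i X" by (simp add: X rep_height_class [OF i x] v_nonneg [OF xi])
  show "rep_height i (rep_unit n i X) = 0"
    using i by (simp add: X rep_unit_class x rep_height_class so) (simp add: set_one_def v_unit)
  show "rep_unit n i (rep_deform n i (1, X)) = rep_deform n i (1, X)" if "rep_height i X < 1"
  proof -
    have "D (1, x i) = \<one>" using that D_one_near [OF xi] rep_height_class [OF i x] X by simp
    then have "set_one n {i} (deform n i 1 x) = deform n i 1 x" by (auto simp: deform_def set_one_def fun_eq_iff)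
    then show ?thesis by (simp add: X rep_deform_class x rep_unit_class dI)
  qed
  show "rep_deform n i (s, rep_unit n i X) = rep_unit n i X" if s: "s \<in> {0..1}" for s
  proof -
    have "deform n i s (set_one n {i} x) = set_one n {i} x"
      using D_unit [OF s] by (auto simp: deform_def set_one_def fun_eq_iff)
    then show ?thesis using s by (simp add: X rep_deform_class rep_unit_class x so)
  qed
  fix j assume j: "j < n"
  show "rep_unit n i (rep_unit n j X) = rep_unit n j (rep_unit n i X)"
    by (simp add: X rep_unit_class x so set_one_set_one insert_commute)
  assume ij: "i \<noteq> j"
  show "rep_height i (rep_unit n j X) = rep_height i X"
    using i ij by (simp add: X rep_unit_class x so rep_height_class) (simp add: set_one_def)
  show "rep_deform n i (s, rep_unit n j X) = rep_unit n j (rep_deform n i (s, X))" if s: "s \<in> {0..1}" for s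
  proof -
    have "deform n i s (set_one n {j} x) = set_one n {j} (deform n i s x)"
      using ij by (auto simp: deform_def set_one_def fun_eq_iff)
    then show ?thesis using s by (simp add: X rep_deform_class rep_unit_class x so dI)
  qed
qed

text \<open>The subsets of size \<open>r\<close> number the copies in rank \<open>r\<close>. For
  such a subset \<open>I\<close>, an admissible loop amounts to a loop on the classes of rank
  \<open>r\<close> that is trivial on \<open>S1_bar G T r\<close>.\<close>

theorem Rep_suspension_splitting:
  assumes n: "n \<ge> 1"
  shows "fst (suspension (Rep_Z G T n, Rep_base G n)) homotopy_equivalent_space
    fst (wedge {1..n} (\<lambda>r.
      suspension (wedge {..<n choose r} (\<lambda>_. collapse (Rep_Z G T r) (S1_bar G T r)))))"
proof -
  interpret C: idempotent_cube "Rep_Z G T n" n "rep_unit n" "rep_deform n" rep_height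
    by (rule idempotent_cube_Rep)
  interpret W: wedge_of_suspensions "Rep_Z G T" "S1_bar G T" "{1..n}" "\<lambda>r. n choose r"
  proof
    fix r assume r: "r \<in> {1..n}"
    have "Rep_class G r (\<lambda>i\<in>{..<r}. \<one>) \<in> S1_bar G T r"
      unfolding S1_bar_def
    proof (intro imageI CollectI conjI exI [of _ 0])
      show "(\<lambda>i\<in>{..<r}. \<one>) \<in> topspace (Hom_Z G T r)" by (rule one_tuple_in)
    qed (use r in auto)
    then show "S1_bar G T r \<subseteq> topspace (Rep_Z G T r) \<and> S1_bar G T r \<noteq> {}"
      unfolding topspace_Rep by (auto simp: S1_bar_def)
    show "0 < n choose r" using r by simp
  qed
  let ?X = "Rep_Z G T n" and ?W = "fst W.whole" and ?w0 = "snd W.whole"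
  let ?P = "prod_topology ?X II"
  \<comment> \<open>An enumeration of \<open>I\<close>, fixed once and for all, identifies tuples
    supported on \<open>I\<close> with tuples of length \<open>card I\<close>.\<close>
  define \<beta> where "\<beta> I = (SOME b. bij_betw b {..<card I} I)" for I :: "nat set"
  have \<beta>: "bij_betw (\<beta> I) {..<card I} I" if "I \<subseteq> {..<n}" for I
  proof -
    have "finite I" using that finite_subset by blast
    from ex_bij_betw_nat_finite [OF this] show ?thesis
      unfolding \<beta>_def by (metis atLeast0LessThan someI_ex)
  qed
  have \<beta>n: "\<beta> I k < n" if "I \<subseteq> {..<n}" "k < card I" for I k
    using \<beta> [OF that(1)] that by (auto simp: bij_betw_def)
  have \<beta>im: "\<beta> I ` {..<card I} = I" and \<beta>inj: "inj_on (\<beta> I) {..<card I}" if "I \<subseteq> {..<n}" for I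
    using \<beta> [OF that] by (auto simp: bij_betw_def)
  have "\<exists>c. bij_betw c {I. I \<subseteq> {..<n} \<and> card I = r} {..<n choose r}" for r
  proof -
    have "finite {I. I \<subseteq> {..<n} \<and> card I = r}" "card {I. I \<subseteq> {..<n} \<and> card I = r} = card {..<n choose r}"
      using n_subsets [of "{..<n}" r] by auto
    then show ?thesis by (intro finite_same_card_bij) auto
  qed
  then obtain c where c: "\<And>r. bij_betw (c r) {I. I \<subseteq> {..<n} \<and> card I = r} {..<n choose r}"
    by metis
  \<comment> \<open>The number of the copy assigned to \<open>I\<close> among the subsets of its
    size; \<open>J\<close> below inverts this numbering.\<close>
  define \<kappa> where "\<kappa> I = c (card I) I" for I
  have card1: "card I \<in> {1..n}" if "I \<subseteq> {..<n}" "I \<noteq> {}" for I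
    using that card_mono [of "{..<n}" I] finite_subset [of I "{..<n}"] by (auto simp: Suc_le_eq card_gt_0_iff)
  have \<kappa>: "\<kappa> I < n choose card I" if "I \<subseteq> {..<n}" for I
    using c [of "card I"] that by (auto simp: bij_betw_def \<kappa>_def)
  have c_inv: "\<exists>I\<subseteq>{..<n}. card I = r \<and> \<kappa> I = k" if "k < n choose r" for r k
  proof -
    have "k \<in> c r ` {I. I \<subseteq> {..<n} \<and> card I = r}" using c [of r] that by (auto simp: bij_betw_def)
    then show ?thesis by (auto simp: \<kappa>_def)
  qed
  define J where "J r k = (SOME I. I \<subseteq> {..<n} \<and> card I = r \<and> \<kappa> I = k)" for r k
  have J: "J r k \<subseteq> {..<n}" "card (J r k) = r" "\<kappa> (J r k) = k" if "k < n choose r" for r k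
    using someI_ex [of "\<lambda>I. I \<subseteq> {..<n} \<and> card I = r \<and> \<kappa> I = k"] c_inv [OF that] unfolding J_def by blast+
  have J_\<kappa>: "J (card I) (\<kappa> I) = I" if I: "I \<subseteq> {..<n}" for I
  proof -
    have "J (card I) (\<kappa> I) \<subseteq> {..<n}" "card (J (card I) (\<kappa> I)) = card I" "\<kappa> (J (card I) (\<kappa> I)) = \<kappa> I"
      using J [OF \<kappa> [OF I]] by auto
    then show ?thesis using c [of "card I"] I unfolding bij_betw_def \<kappa>_def by (auto dest: inj_onD)
  qed
  \<comment> \<open>\<open>p I\<close> and \<open>\<sigma> I\<close> form the retraction and section
    of rank \<open>card I\<close>: \<open>p I\<close> after \<open>\<sigma> I\<close> is the
    identity, and \<open>\<sigma> I\<close> after \<open>p I\<close> applies all idempotents outside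
    \<open>I\<close>.\<close>
  define p where "p I = rep_map (card I) (pick (card I) (\<beta> I))" for I
  define \<sigma> where "\<sigma> I = rep_map n (spread n (card I) (\<beta> I))" for I
  have pc: "continuous_map ?X (Rep_Z G T (card I)) (p I)"
    and p_class: "\<And>x. x \<in> topspace (Hom_Z G T n) \<Longrightarrow> p I (Rep_class G n x) = Rep_class G (card I) (pick (card I) (\<beta> I) x)"
    if "I \<subseteq> {..<n}" for I
    unfolding p_def using continuous_map_rep_map [OF continuous_map_pick equivariant_pick] rep_map_class [OF equivariant_pick] \<beta>n [OF that]
    by auto
  have \<sigma>c: "continuous_map (Rep_Z G T (card I)) ?X (\<sigma> I)"
    and \<sigma>_class: "\<And>y. y \<in> topspace (Hom_Z G T (card I)) \<Longrightarrow> \<sigma> I (Rep_class G (card I) y) = Rep_class G n (spread n (card I) (\<beta> I) y)" for I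
    unfolding \<sigma>_def using continuous_map_rep_map [OF continuous_map_spread equivariant_spread] rep_map_class [OF equivariant_spread]
    by auto
  have p_in: "p I X \<in> topspace (Rep_Z G T (card I))" if "I \<subseteq> {..<n}" "X \<in> topspace ?X" for I X
    using pc [OF that(1)] that(2) by (auto simp: continuous_map_def)
  have \<sigma>_in: "\<sigma> I Y \<in> topspace ?X" if "Y \<in> topspace (Rep_Z G T (card I))" for I Y
    using \<sigma>c [of I] that by (auto simp: continuous_map_def)
  have p\<sigma>: "p I (\<sigma> I Y) = Y" if I: "I \<subseteq> {..<n}" and Y: "Y \<in> topspace (Rep_Z G T (card I))" for I Y
  proof -
    obtain y where "y \<in> topspace (Hom_Z G T (card I))" "Y = Rep_class G (card I) y" using Y unfolding topspace_Rep by blast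
    then show ?thesis using \<sigma>_class p_class [OF I] spread_in pick_spread [OF \<beta>inj [OF I]] \<beta>n [OF I] by simp
  qed
  have \<sigma>p: "\<sigma> I (p I (Rep_class G n x)) = Rep_class G n (set_one n ({..<n} - I) x)"
    if I: "I \<subseteq> {..<n}" and x: "x \<in> topspace (Hom_Z G T n)" for I x
  proof -
    have "pick (card I) (\<beta> I) x \<in> topspace (Hom_Z G T (card I))" by (rule pick_in [OF \<beta>n [OF I] x])
    then show ?thesis
      by (simp only: p_class [OF I x] \<sigma>_class spread_pick [OF x] \<beta>im [OF I])
  qed
  \<comment> \<open>The idempotents outside \<open>I\<close> are applied one at a time, and
    \<open>f\<close> is invariant under each of them.\<close>
  have retract: "f (\<sigma> I (p I X), t) = f (X, t)"
    if I: "I \<subseteq> {..<n}" and X: "X \<in> topspace ?X" and t: "t \<in> {0..1}" and f: "C.admissible z ({..<n} - I) I f"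
    for I X t and f :: "(nat \<Rightarrow> 'a) set \<times> real \<Rightarrow> 'z" and z
  proof -
    obtain x where x: "x \<in> topspace (Hom_Z G T n)" "X = Rep_class G n x" using X unfolding topspace_Rep by blast
    have "f (Rep_class G n (set_one n K x), t) = f (X, t)" if "finite K" "K \<subseteq> {..<n} - I" for K
      using that
    proof (induction K)
      case empty
      have "set_one n {} x = x" using x(1) by (auto simp: set_one_def mem_Hom fun_eq_iff extensional_def)
      then show ?case using x by simp
    next
      case (insert k K)
      have k: "k \<in> {..<n} - I" using insert.prems by simp
      have s: "set_one n K x \<in> topspace (Hom_Z G T n)" by (rule set_one_in [OF x(1)])
      have "Rep_class G n (set_one n (insert k K) x) = rep_unit n k (Rep_class G n (set_one n K x))"
        using rep_unit_class [OF s] by (simp add: set_one_set_one)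
      then show ?case
        using C.admissible_invariant [OF f k _ t, of "Rep_class G n (set_one n K x)"] s insert by (simp add: topspace_Rep)
    qed
    from this [of "{..<n} - I"] have "f (Rep_class G n (set_one n ({..<n} - I) x), t) = f (X, t)" by simp
    then show ?thesis
      using \<sigma>p [OF I x(1)] x(2) by simp
  qed
  \<comment> \<open>Together with \<open>section_fixed\<close>, this matches the vanishing condition
    on \<open>I\<close> with the collapsed subset of the statement.\<close>
  have vanish: "p I X \<in> S1_bar G T (card I)" if I: "I \<subseteq> {..<n}" and X: "X \<in> topspace ?X" and k: "k \<in> I" "rep_unit n k X = X" for I X k
  proof -
    obtain x where x: "x \<in> topspace (Hom_Z G T n)" "X = Rep_class G n x" using X unfolding topspace_Rep by blast
    have "k \<in> \<beta> I ` {..<card I}" using \<beta>im [OF I] k(1) by simp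
    then obtain i where i: "i < card I" "\<beta> I i = k" by auto
    have kn: "k < n" using I k(1) by auto
    let ?x = "set_one n {k} x"
    have s: "?x \<in> topspace (Hom_Z G T n)" by (rule set_one_in [OF x(1)])
    have "X = Rep_class G n ?x" using k(2) rep_unit_class [OF x(1)] x(2) by simp
    then have "p I X = Rep_class G (card I) (pick (card I) (\<beta> I) ?x)" using p_class [OF I s] by simp
    moreover have "pick (card I) (\<beta> I) ?x i = \<one>" using i kn by (simp add: pick_def set_one_def)
    then have "Rep_class G (card I) (pick (card I) (\<beta> I) ?x) \<in> S1_bar G T (card I)"
      unfolding S1_bar_def using pick_in [OF \<beta>n [OF I] s] i(1) by (intro imageI CollectI conjI exI [of _ i])
    ultimately show ?thesis by simp
  qed
  have section_fixed: "\<exists>k\<in>I. rep_unit n k (\<sigma> I Y) = \<sigma> I Y" if I: "I \<subseteq> {..<n}" and Y: "Y \<in> S1_bar G T (card I)" for I Y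
  proof -
    obtain y i where y: "y \<in> topspace (Hom_Z G T (card I))" "Y = Rep_class G (card I) y" "i < card I" "y i = \<one>"
      using Y unfolding S1_bar_def by blast
    have k: "\<beta> I i \<in> I" using \<beta>im [OF I] y(3) by blast
    have "inv_into {..<card I} (\<beta> I) (\<beta> I i) = i" using \<beta>inj [OF I] y(3) by simp
    then have "set_one n {\<beta> I i} (spread n (card I) (\<beta> I) y) = spread n (card I) (\<beta> I) y"
      using y(4) k \<beta>im [OF I] by (auto simp: set_one_def spread_def fun_eq_iff)
    then show ?thesis
      using y(2) \<sigma>_class [OF y(1)] rep_unit_class [OF spread_in [OF y(1)]] by (intro bexI [OF _ k]) simp
  qed
  \<comment> \<open>The wedge starts in rank 1 and has no summand for the empty set. A loop
    invariant under all idempotents is determined by its values at the basepoint, so the loop for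
    the empty set is constant.\<close>
  define \<omega> where "\<omega> I = (if I = {} then (\<lambda>_. ?w0) else (\<lambda>(X, t). W.inclusion (card I) (\<kappa> I) (p I X, t)))" for I
  have p_unit: "p I (rep_unit n j X) = p I X" if I: "I \<subseteq> {..<n}" and X: "X \<in> topspace ?X" and j: "j \<in> {..<n} - I" for I X j
  proof -
    obtain x where x: "x \<in> topspace (Hom_Z G T n)" "X = Rep_class G n x" using X unfolding topspace_Rep by blast
    have "\<beta> I k \<noteq> j" if "k < card I" for k using \<beta>im [OF I] j that by auto
    then have "pick (card I) (\<beta> I) (set_one n {j} x) = pick (card I) (\<beta> I) x"
      using \<beta>n [OF I] by (auto simp: pick_def set_one_def fun_eq_iff)
    then show ?thesis using p_class [OF I] set_one_in [OF x(1)] rep_unit_class [OF x(1)] x by simp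
  qed
  \<comment> \<open>The basepoint of the wedge is reached through rank 1, which is present because
    \<open>n \<ge> 1\<close>.\<close>
  let ?Y = "Rep_class G 1 (\<lambda>i\<in>{..<1}. \<one>)"
  have Y1: "?Y \<in> topspace (Rep_Z G T 1)" unfolding topspace_Rep using one_tuple_in by blast
  have n1: "0 < n choose 1" "1 \<in> {1..n}" using n by auto
  have w0_eq: "?w0 = W.inclusion 1 0 (?Y, 0)" using W.inclusion_base [OF n1(2,1) Y1, of 0] by simp
  have w0: "?w0 \<in> topspace ?W"
  proof -
    have "(?Y, 0) \<in> topspace (prod_topology (Rep_Z G T 1) II)" using Y1 by simp
    then show ?thesis
      unfolding w0_eq using W.continuous_map_inclusion [OF n1(2,1)] unfolding continuous_map_def by blast
  qed
  have \<omega>c: "continuous_map ?P ?W (\<omega> I)" if I: "I \<subseteq> {..<n}" for I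
  proof (cases "I = {}")
    case True then show ?thesis using w0 by (simp add: \<omega>_def)
  next
    case False
    have "continuous_map ?P (prod_topology (Rep_Z G T (card I)) II) (\<lambda>z. (p I (fst z), snd z))"
      by (intro continuous_map_pairedI continuous_map_snd continuous_map_comp [OF pc [OF I] continuous_map_fst])
    from continuous_map_comp [OF W.continuous_map_inclusion [OF card1 [OF I False] \<kappa> [OF I]] this] False
    show ?thesis by (simp add: \<omega>_def case_prod_unfold)
  qed
  have \<omega>a: "C.admissible ?w0 ({..<n} - I) I (\<omega> I)" if I: "I \<subseteq> {..<n}" for I
  proof (cases "I = {}")
    case True then show ?thesis using C.admissible_const by (simp add: \<omega>_def)
  next
    case False
    note ib = W.inclusion_base [OF card1 [OF I False] \<kappa> [OF I] p_in [OF I]]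
    have \<omega>I: "\<omega> I (X, t) = W.inclusion (card I) (\<kappa> I) (p I X, t)" for X t using False by (simp add: \<omega>_def)
    obtain k where k: "k \<in> I" using False by blast
    show ?thesis
      unfolding C.admissible_def
    proof (intro ballI conjI impI)
      fix X assume X: "X \<in> topspace ?X"
      show "\<omega> I (X, 0) = ?w0" "\<omega> I (X, 1) = ?w0" unfolding \<omega>I by (rule ib [OF X]; simp)+
      fix t :: real assume t: "t \<in> {0..1}"
      show van: "\<omega> I (X, t) = ?w0" if "i \<in> I" "rep_unit n i X = X" for i
        unfolding \<omega>I using ib [OF X t] vanish [OF I X that] by blast
      show "\<omega> I (X, t) = ?w0" if "\<forall>i<n. rep_unit n i X = X"
        using van [OF k] that k I by blast
      show "\<omega> I (rep_unit n j X, t) = \<omega> I (X, t)" if "j \<in> {..<n} - I" for j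
        unfolding \<omega>I using p_unit [OF I X that] by simp
    qed
  qed
  \<comment> \<open>Generic in the target, so that one fact supplies both lifting hypotheses of
    \<open>suspension_homotopy_equivalent\<close>.\<close>
  have lift: "\<exists>g. continuous_map (prod_topology II ?W) Z g \<and>
      (\<forall>I\<subseteq>{..<n}. \<forall>s\<in>{0..1}. \<forall>y\<in>topspace ?P. g (s, \<omega> I y) = h I (s, y))"
    if hc: "\<And>I. I \<subseteq> {..<n} \<Longrightarrow> continuous_map (prod_topology II ?P) Z (h I)"
      and ha: "\<And>I s. I \<subseteq> {..<n} \<Longrightarrow> s \<in> {0..1} \<Longrightarrow> C.admissible z ({..<n} - I) I (\<lambda>y. h I (s, y))"
    for Z :: "'z topology" and z h
  proof -
    have h\<sigma>: "continuous_map (prod_topology II (prod_topology (Rep_Z G T r) II)) Z (\<lambda>w. h (J r k) (fst w, \<sigma> (J r k) (fst (snd w)), snd (snd w)))"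
      if "k < n choose r" for r k
      by (rule continuous_map_comp [OF hc [OF J(1) [OF that]]])
        (use \<sigma>c [of "J r k"] J(2) [OF that] in \<open>intro continuous_map_pairedI continuous_map_projections
          continuous_map_comp [OF _ continuous_map_projections(3)]; simp\<close>)
    obtain g where g: "continuous_map (prod_topology II ?W) Z g"
      "\<And>r k s Y t. \<lbrakk>r \<in> {1..n}; k < n choose r; s \<in> {0..1}; Y \<in> topspace (Rep_Z G T r); t \<in> {0..1}\<rbrakk> \<Longrightarrow>
        g (s, W.inclusion r k (Y, t)) = h (J r k) (s, \<sigma> (J r k) Y, t)"
    proof (rule W.total_lift [of Z "\<lambda>r k w. h (J r k) (fst w, \<sigma> (J r k) (fst (snd w)), snd (snd w))" z])
      fix r k and s t :: real and Y
      assume r: "r \<in> {1..n}" and k: "k < n choose r" and s: "s \<in> {0..1}" and Y: "Y \<in> topspace (Rep_Z G T r)"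
        and t: "t \<in> {0..1}" "Y \<in> S1_bar G T r \<or> t \<in> {0, 1}"
      note a = ha [OF J(1) [OF k] s]
      have sY: "\<sigma> (J r k) Y \<in> topspace ?X" using \<sigma>_in [of Y "J r k"] Y J(2) [OF k] by simp
      have "h (J r k) (s, \<sigma> (J r k) Y, t) = z"
      proof (cases "t \<in> {0, 1}")
        case True then show ?thesis using C.admissible_ends [OF a sY] by auto
      next
        case False
        then obtain i where "i \<in> J r k" "rep_unit n i (\<sigma> (J r k) Y) = \<sigma> (J r k) Y"
          using section_fixed [OF J(1) [OF k], of Y] t J(2) [OF k] by auto
        from C.admissible_vanish [OF a this sY t(1)] show ?thesis .
      qed
      then show "h (J r k) (fst (s, Y, t), \<sigma> (J r k) (fst (snd (s, Y, t))), snd (snd (s, Y, t))) = z" by simp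
    qed (use h\<sigma> in auto)
    have "g (s, \<omega> I y) = h I (s, y)" if I: "I \<subseteq> {..<n}" and s: "s \<in> {0..1}" and y: "y \<in> topspace ?P" for I s y
    proof -
      obtain X t where X: "y = (X, t)" "X \<in> topspace ?X" "t \<in> {0..1}" using y by auto
      show ?thesis
      proof (cases "I = {}")
        case False
        have "g (s, \<omega> I y) = h I (s, \<sigma> I (p I X), t)"
          using g(2) [OF card1 [OF I False] \<kappa> [OF I] s p_in [OF I X(2)] X(3)] J_\<kappa> [OF I] False X(1) by (simp add: \<omega>_def)
        also have "\<dots> = h I (s, y)" using retract [OF I X(2,3) ha [OF I s]] X(1) by simp
        finally show ?thesis .
      next
        \<comment> \<open>For \<open>I = {}\<close> both sides are \<open>z\<close>:
          \<open>\<sigma> I (p I X)\<close> is fixed by all idempotents, and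
          \<open>\<omega> I\<close> is constantly the basepoint, which \<open>g\<close> sends to
          \<open>z\<close>.\<close>
        case True
        have "h I (s, \<sigma> I (p I X), t) = h I (s, y)" using retract [OF I X(2,3) ha [OF I s]] X(1) by simp
        moreover have "h I (s, \<sigma> I (p I X), t) = z"
        proof (rule C.admissible_base [OF ha [OF I s] \<sigma>_in [OF p_in [OF I X(2)]] X(3)])
          obtain x where x: "x \<in> topspace (Hom_Z G T n)" "X = Rep_class G n x" using X(2) unfolding topspace_Rep by blast
          have e: "\<sigma> I (p I X) = Rep_class G n (set_one n {..<n} x)"
            using \<sigma>p [OF I x(1)] x(2) True by simp
          show "rep_unit n i (\<sigma> I (p I X)) = \<sigma> I (p I X)" if "i < n" for i
            unfolding e rep_unit_class [OF set_one_in [OF x(1)]] set_one_set_one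
            using that by (simp add: insert_absorb)
        qed
        moreover have "g (s, ?w0) = z"
        proof -
          have "g (s, ?w0) = h (J 1 0) (s, \<sigma> (J 1 0) ?Y, 0)"
            unfolding w0_eq using g(2) [OF n1(2,1) s Y1, of 0] by simp
          moreover have "\<sigma> (J 1 0) ?Y \<in> topspace ?X" using \<sigma>_in [of ?Y "J 1 0"] Y1 J(2) [OF n1(1)] by simp
          ultimately show ?thesis using C.admissible_ends(1) [OF ha [OF J(1) [OF n1(1)] s]] by simp
        qed
        ultimately show ?thesis using True by (simp add: \<omega>_def)
      qed
    qed
    with g(1) show ?thesis by blast
  qed
  show ?thesis
  proof (rule C.suspension_homotopy_equivalent [where \<omega> = \<omega> and ?w0.0 = ?w0])
    show "Rep_base G n \<in> topspace ?X" unfolding Rep_base_def topspace_Rep using one_tuple_in by blast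
    show "(\<forall>i<n. rep_unit n i X = X) \<longleftrightarrow> X = Rep_base G n" if X: "X \<in> topspace ?X" for X
    proof
      assume fixed: "\<forall>i<n. rep_unit n i X = X"
      obtain x where x: "x \<in> topspace (Hom_Z G T n)" "X = Rep_class G n x" using X unfolding topspace_Rep by blast
      \<comment> \<open>Entries are replaced by the unit one after the other; each replacement is
        one of the idempotents that fix \<open>X\<close>.\<close>
      have "Rep_class G n (set_one n {..<m} x) = X" if "m \<le> n" for m
        using that
      proof (induction m)
        case 0
        have "set_one n {} x = x" using x(1) by (auto simp: set_one_def mem_Hom fun_eq_iff extensional_def)
        then show ?case using x by simp
      next
        case (Suc m)
        have "Rep_class G n (set_one n {..<Suc m} x) = rep_unit n m (Rep_class G n (set_one n {..<m} x))"
          unfolding rep_unit_class [OF set_one_in [OF x(1)]] set_one_set_one by (simp add: lessThan_Suc)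
        then show ?case using Suc fixed by simp
      qed
      from this [of n] show "X = Rep_base G n" unfolding set_one_all Rep_base_def by simp
    next
      assume X0: "X = Rep_base G n"
      have "set_one n {i} (\<lambda>i\<in>{..<n}. \<one>) = (\<lambda>i\<in>{..<n}. \<one>)" for i by (auto simp: set_one_def fun_eq_iff)
      then show "\<forall>i<n. rep_unit n i X = X" unfolding X0 Rep_base_def using rep_unit_class [OF one_tuple_in] by simp
    qed
    show "\<exists>I\<subseteq>{..<n}. \<exists>y\<in>topspace ?P. w = \<omega> I y" if w: "w \<in> topspace ?W" for w
    proof -
      obtain r k Y t where r: "r \<in> {1..n}" "k < n choose r" "Y \<in> topspace (Rep_Z G T r)" "t \<in> {0..1}" "w = W.inclusion r k (Y, t)"
        using W.inclusion_surj [OF w] by blast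
      let ?I = "J r k"
      have I: "?I \<subseteq> {..<n}" "card ?I = r" "\<kappa> ?I = k" using J [OF r(2)] by auto
      then have ne: "?I \<noteq> {}" using r(1) by auto
      have "p ?I (\<sigma> ?I Y) = Y" using p\<sigma> [OF I(1), of Y] I(2) r(3) by simp
      then have "\<omega> ?I (\<sigma> ?I Y, t) = w" using ne I r(5) by (simp add: \<omega>_def)
      moreover have "(\<sigma> ?I Y, t) \<in> topspace ?P" using \<sigma>_in [of Y ?I] I(2) r(3,4) by simp
      ultimately show ?thesis using I(1) by blast
    qed
    show "continuous_map ?P ?W (\<omega> I)" "C.admissible ?w0 ({..<n} - I) I (\<omega> I)" if "I \<subseteq> {..<n}" for I
      by (rule \<omega>c [OF that], rule \<omega>a [OF that])
    show "\<exists>g. continuous_map (prod_topology II ?W) ?W g \<and>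
        (\<forall>I\<subseteq>{..<n}. \<forall>s\<in>{0..1}. \<forall>y\<in>topspace ?P. g (s, \<omega> I y) = h I (s, y))"
      if "\<And>I. I \<subseteq> {..<n} \<Longrightarrow> continuous_map (prod_topology II ?P) ?W (h I)"
        "\<And>I s. I \<subseteq> {..<n} \<Longrightarrow> s \<in> {0..1} \<Longrightarrow> C.admissible ?w0 ({..<n} - I) I (\<lambda>y. h I (s, y))" for h
      by (rule lift [OF that])
    show "\<exists>g. continuous_map (prod_topology II ?W) (fst (suspension (?X, Rep_base G n))) g \<and>
        (\<forall>I\<subseteq>{..<n}. \<forall>s\<in>{0..1}. \<forall>y\<in>topspace ?P. g (s, \<omega> I y) = h I (s, y))"
      if "\<And>I. I \<subseteq> {..<n} \<Longrightarrow> continuous_map (prod_topology II ?P) (fst (suspension (?X, Rep_base G n))) (h I)"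
        "\<And>I s. I \<subseteq> {..<n} \<Longrightarrow> s \<in> {0..1} \<Longrightarrow> C.admissible (snd (suspension (?X, Rep_base G n))) ({..<n} - I) I (\<lambda>y. h I (s, y))" for h
      by (rule lift [OF that])
  qed
qed

end

theorem theorem1p2:
  fixes G :: "('a, 'b) monoid_scheme" and T :: "'a topology"
    and d :: nat and A :: "'a chart set" and n :: nat
  assumes "compact_lie_group G T d A"
    and "n \<ge> 1"
  shows "fst (suspension (Rep_Z G T n, Rep_base G n)) homotopy_equivalent_space
    fst (wedge {1..n} (\<lambda>r.
      suspension (wedge {..<n choose r} (\<lambda>_. collapse (Rep_Z G T r) (S1_bar G T r)))))"
proof -
  interpret compact_lie_group G T d A by (rule assms)
  obtain D v where Dv: "compact_topological_group.conj_contractible G T D v"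
    using conj_contractible_exists by blast
  interpret C: compact_topological_group G T by (rule compact_topological_group)
  interpret conj_contractible_group G T D v by unfold_locales (rule Dv)
  show ?thesis by (rule Rep_suspension_splitting [OF assms(2)])
qed

end
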